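(* Let $(X_j)_{j\ge 1}$ be a stationary real-valued Gaussian process with $EX_1=0$, $EX_1^2=1$ and $r(k):=E X_1X_{k+1}=k^{-D}L(k)$ for $k\ge 1$, where $D\in(0,1)$ and $L$ is slowly varying at infinity. Let $G:\mathbb R\to\mathbb R^p$ be measurable, $Y_j:=G(X_j)$, $F(x):=P(Y_1\le x)$, and let $m:=\min\{m(x):x\in\mathbb R^p\}$ be the Hermite rank of the family $(1_{\{G(\cdot)\le x\}}-F(x))_{x\in\mathbb R^p}$. Assume $0<D<1/m$ and put $$d_N^2=\operatorname{Var}\Bigl(\sum_{j=1}^N H_m(X_j)\Bigr).$$ Then there exist constants $C,\kappa>0$ such that for every $N\ge 1$ and every $0<\varepsilon\le 1$ $$P\Biggl(\max_{n\le N}\ \sup_{x\in[-\infty,\infty]^p} d_N^{-1}\Bigl|\sum_{j=1}^n\Bigl(1_{\{Y_j\le x\}}-F(x)-\frac{J_m(x)}{m!}H_m(X_j)\Bigr)\Bigr|>\varepsilon\Biggr)\le C N^{-\kappa}(1+\varepsilon^{-3}).$$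
   Context: For vectors, $x\le y$ means $x^{(i)}\le y^{(i)}$ for all coordinates $i$ (also for extended-real coordinates). $H_n(y)=(-1)^n e^{y^2/2}\frac{d^n}{dy^n}e^{-y^2/2}$ is the $n$-th Hermite polynomial. For $x\in[-\infty,\infty]^p$ put $J_q(x)=E[(1_{\{Y_1\le x\}}-F(x))H_q(X_1)]$. The Hermite rank $m(x)$ is the smallest index $q$ with $J_q(x)\neq 0$ (so $m(x)\ge 1$, and $m(x)=\infty$ if there is no such $q$); the hypothesis $0<D<1/m$ includes $m<\infty$. *)

theory Defs
  imports "HOL-Probability.Probability"
begin

text \<open>Normal random variables, including the degenerate (almost surely constant) ones.\<close>

definition normal_rv :: "'a measure \<Rightarrow> ('a \<Rightarrow> real) \<Rightarrow> bool" where
  "normal_rv M Z \<longleftrightarrow> Z \<in> borel_measurable M \<and>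
     ((\<exists>\<mu> \<sigma>. 0 < \<sigma> \<and> distributed M lborel Z (normal_density \<mu> \<sigma>)) \<or>
      (\<exists>\<mu>. AE \<omega> in M. Z \<omega> = \<mu>))"

text \<open>Processes are indexed by the integers $j \ge 1$; the value at index 0 is irrelevant.\<close>

definition gaussian_process :: "'a measure \<Rightarrow> (nat \<Rightarrow> 'a \<Rightarrow> real) \<Rightarrow> bool" where
  "gaussian_process M X \<longleftrightarrow>
     (\<forall>I a. finite I \<and> I \<subseteq> {1..} \<longrightarrow> normal_rv M (\<lambda>\<omega>. \<Sum>i\<in>I. a i * X i \<omega>))"

definition stationary_process :: "'a measure \<Rightarrow> (nat \<Rightarrow> 'a \<Rightarrow> real) \<Rightarrow> bool" where
  "stationary_process M X \<longleftrightarrow>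
     (\<forall>h. distr M (Pi\<^sub>M {1..} (\<lambda>_. borel)) (\<lambda>\<omega>. \<lambda>j\<in>{1..}. X (j + h) \<omega>) =
          distr M (Pi\<^sub>M {1..} (\<lambda>_. borel)) (\<lambda>\<omega>. \<lambda>j\<in>{1..}. X j \<omega>))"

text \<open>Karamata's definition: \<open>L\<close> is positive and measurable on some half-line; its values
  elsewhere are unconstrained.\<close>

definition slowly_varying :: "(real \<Rightarrow> real) \<Rightarrow> bool" where
  "slowly_varying L \<longleftrightarrow>
     (\<exists>a. (\<forall>x\<ge>a. 0 < L x) \<and> L \<in> borel_measurable (restrict_space borel {a..})) \<and>
     (\<forall>c>0. ((\<lambda>x. L (c * x) / L x) \<longlongrightarrow> 1) at_top)"

definition hermite :: "nat \<Rightarrow> real \<Rightarrow> real" where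
  "hermite n y = (-1) ^ n * exp (y\<^sup>2 / 2) * (deriv ^^ n) (\<lambda>t. exp (- (t\<^sup>2 / 2))) y"

definition ereal_vec :: "real ^ 'p \<Rightarrow> ereal ^ 'p" where
  "ereal_vec y = (\<chi> i. ereal (y $ i))"

text \<open>The order on vectors is the componentwise one (\<open>less_eq_vec_def\<close>).\<close>

definition lower_orthant :: "ereal ^ 'p \<Rightarrow> (real ^ 'p) set" where
  "lower_orthant x = {y. ereal_vec y \<le> x}"

definition dist_fun :: "'a measure \<Rightarrow> ('a \<Rightarrow> real ^ 'p) \<Rightarrow> ereal ^ 'p \<Rightarrow> real" where
  "dist_fun M Y x = measure M {\<omega> \<in> space M. Y \<omega> \<in> lower_orthant x}"

text \<open>In the following, \<open>Z\<close> plays the role of $X_1$ and \<open>G \<circ> Z\<close> that of $Y_1$.\<close>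

definition hermite_coeff ::
  "'a measure \<Rightarrow> (real \<Rightarrow> real ^ 'p) \<Rightarrow> ('a \<Rightarrow> real) \<Rightarrow> nat \<Rightarrow> ereal ^ 'p \<Rightarrow> real" where
  "hermite_coeff M G Z q x =
     prob_space.expectation M
       (\<lambda>\<omega>. (indicator (lower_orthant x) (G (Z \<omega>)) - dist_fun M (G \<circ> Z) x) * hermite q (Z \<omega>))"

text \<open>The infimum over the empty set is \<open>\<infinity>\<close>; every other infimum in \<open>enat\<close> is attained.\<close>

definition hermite_rank_at ::
  "'a measure \<Rightarrow> (real \<Rightarrow> real ^ 'p) \<Rightarrow> ('a \<Rightarrow> real) \<Rightarrow> ereal ^ 'p \<Rightarrow> enat" where
  "hermite_rank_at M G Z x = Inf {enat q | q. hermite_coeff M G Z q x \<noteq> 0}"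

definition hermite_rank ::
  "'a measure \<Rightarrow> (real \<Rightarrow> real ^ 'p) \<Rightarrow> ('a \<Rightarrow> real) \<Rightarrow> enat" where
  "hermite_rank M G Z = (INF x :: real ^ 'p. hermite_rank_at M G Z (ereal_vec x))"

end

(* The proof combines three ingredients.

   (1) Reduction of covariances. The bivariate normal law with correlation rho has the Mehler kernel K as its
   density relative to the independent pair. Subtracting from K the terms of order at most m of its
   Hermite expansion leaves a kernel of L2-norm |rho|^(m+1) / sqrt (1 - rho^2). A function f orthogonal to H_0, ..., H_m therefore satisfies
   |E f(X_i) f(X_j)| <= (2 |r(i-j)|)^(m+1) ||f||^2. Since the norm of K is an explicit Gaussian integral,
   the completeness of the Hermite polynomials is not needed. For the residual of an indicator of A one has ||f||^2 <= P(A).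

   (2) Asymptotics. Potter bounds for L follow from the uniform convergence theorem, and for suitable
   mD < s' < s < 1 they give N sum_{k <= N} |r(k)|^(m+1) = O(N^(2-s)) while d_N^2 >= c N^(2-s').

   (3) Chaining. Each coordinate axis is cut into about 2 N^4 cells that are singletons or have mass at most N^-4.
   Initial segments of time and lower orthants of cells split into dyadic boxes. For a fixed vector of
   levels the boxes are disjoint, so the second moments of their increments add up to O(N^(2-s)); the number of
   level vectors is polylogarithmic in N for every dimension p. What is left between neighbouring
   grid points is absorbed by the trivial bound, thanks to the fineness of the cells. *)

theory Submission
  imports Defs
begin

section \<open>Hermite polynomials\<close>

text \<open>The obstacle is the supremum over x: F may have atoms and G is an arbitrary measurable
  map. The decisive feature of the covariance bound is that it yields second moments linear in the
  number of times and in P(A). Summing over disjoint boxes then costs nothing, and all boxes of all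
  levels fit into one integrable variable Q that dominates every n and every grid point at once. The
  price is a power of K, where K is of order log N. The lower bound for d_N^2 beats the second
  moments by N^(s - s'); half of this exponent absorbs the power of K, the other half is \<kappa>.
  The rank speaks of orthants only, while the boxes are preimages of more general sets, so the
  vanishing of the lower coefficients has to be extended to all Borel preimages. The mesh N^(-4)
  comes from Cauchy-Schwarz: a set of mass \<delta> contributes up to sqrt \<delta> to the
  coefficient of order m, and N * sqrt (N^(-4)) = 1 / N. Markov's inequality gives \<epsilon>^(-2)
  for Q and \<epsilon>^(-1) for the remainder; both are at most \<epsilon>^(-3) because \<epsilon>
  \<le> 1.\<close>

fun Hpoly :: "nat \<Rightarrow> real poly" where
  "Hpoly 0 = 1"
| "Hpoly (Suc n) = [:0, 1:] * Hpoly n - pderiv (Hpoly n)"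

text \<open>Differentiating the recursion reproduces \<open>Hpoly (Suc n)\<close> once and the
  induction hypothesis supplies the remaining multiples. The rule turns the recursion into the
  three-term recurrence and lets every integration by parts lower the degree.\<close>

lemma pderiv_Hpoly: "pderiv (Hpoly (Suc n)) = smult (real (Suc n)) (Hpoly n)"
proof (induction n)
  case 0
  then show ?case by (simp add: pderiv_pCons)
next
  case (Suc n)
  have "pderiv (Hpoly (Suc (Suc n))) =
      Hpoly (Suc n) + ([:0, 1:] * pderiv (Hpoly (Suc n)) - pderiv (pderiv (Hpoly (Suc n))))"
    unfolding Hpoly.simps(2)[of "Suc n"] pderiv_diff pderiv_mult by (simp add: pderiv_pCons)
  also have "[:0, 1:] * pderiv (Hpoly (Suc n)) - pderiv (pderiv (Hpoly (Suc n)))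
      = smult (real (Suc n)) (Hpoly (Suc n))"
    unfolding Suc pderiv_smult by (simp add: smult_diff_right del: of_nat_Suc)
  moreover have "smult 2 (Hpoly (Suc n)) = 2 * Hpoly (Suc n)"
    by (simp add: numeral_poly)
  ultimately show ?case by (simp add: algebra_simps smult_add_left del: Hpoly.simps)
qed

text \<open>Differentiating q(t) exp (- t^2 / 2) replaces q by q' - t q. Up to the sign collected in
  (-1)^n this is the recursion of \<open>Hpoly\<close>.\<close>

lemma hermite_eq_poly: "hermite n = poly (Hpoly n)"
proof
  fix y
  have "(deriv ^^ n) (\<lambda>t::real. exp (- (t\<^sup>2 / 2))) =
      (\<lambda>t. (-1) ^ n * poly (Hpoly n) t * exp (- (t\<^sup>2 / 2)))"
  proof (induction n)
    case (Suc n)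
    show ?case
    proof
      fix t :: real
      show "(deriv ^^ Suc n) (\<lambda>t::real. exp (- (t\<^sup>2 / 2))) t =
        (-1) ^ Suc n * poly (Hpoly (Suc n)) t * exp (- (t\<^sup>2 / 2))"
        unfolding funpow.simps(2) o_def Suc
        by (rule DERIV_imp_deriv) (auto intro!: derivative_eq_intros simp: algebra_simps)
    qed
  qed simp
  moreover have "(-1) ^ n * (-1) ^ n = (1::real)"
    by (simp flip: power_mult_distrib)
  moreover have "exp (y\<^sup>2 / 2) * exp (- (y\<^sup>2 / 2)) = (1::real)"
    by (simp flip: exp_add)
  ultimately show "hermite n y = poly (Hpoly n) y"
    unfolding hermite_def by (simp add: mult.assoc mult.left_commute)
qed

lemma borel_measurable_poly [measurable]: "poly (p::real poly) \<in> borel_measurable borel"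
  by (intro borel_measurable_continuous_onI continuous_intros)

lemma borel_measurable_hermite [measurable]: "hermite n \<in> borel_measurable borel"
  by (simp add: hermite_eq_poly)

lemma hermite_0 [simp]: "hermite 0 y = 1"
  by (simp add: hermite_eq_poly)

lemma hermite_Suc_Suc:
  "hermite (Suc (Suc n)) y = y * hermite (Suc n) y - real (Suc n) * hermite n y"
  unfolding hermite_eq_poly Hpoly.simps(2)[of "Suc n"] poly_diff pderiv_Hpoly by simp

lemma hermite_1: "hermite (Suc 0) y = y"
  by (simp add: hermite_eq_poly)

lemma std_normal_integrable_poly [simp]: "integrable std_normal_distribution (poly p)"
proof -
  have "integrable std_normal_distribution (\<lambda>x. \<Sum>i\<le>degree p. coeff p i * x ^ i)"
    by (intro Bochner_Integration.integrable_sum integrable_mult_right integrable_std_normal_distribution_moment)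
  then show ?thesis
    by (simp add: poly_altdef[abs_def])
qed

lemma std_normal_moment_rec:
  "(\<integral>x. x ^ Suc (Suc n) \<partial>std_normal_distribution) = real (Suc n) * (\<integral>x. x ^ n \<partial>std_normal_distribution)"
proof (cases "even n")
  case True
  then obtain k where n: "n = 2 * k" by (elim evenE)
  have S: "Suc (Suc (2 * k)) = 2 * Suc k" by simp
  have f: "fact (2 * Suc k) = (2 * real k + 2) * (2 * real k + 1) * fact (2 * k)"
    by (simp add: algebra_simps)
  show ?thesis
    unfolding n S std_normal_distribution_even_moments(1) f
    by (simp add: divide_simps) (simp add: algebra_simps)
next
  case False
  then show ?thesis
    using integral_std_normal_distribution_moment_odd[of n]
      integral_std_normal_distribution_moment_odd[of "Suc (Suc n)"] by simp
qed

lemma std_normal_integrable_times_poly [simp]: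
  "integrable std_normal_distribution (\<lambda>x. x * poly p x)"
  using std_normal_integrable_poly[of "[:0, 1:] * p"]
  by (rule back_subst[where P = "integrable _"]) auto

text \<open>On monomials this is the recursion of the normal moments; linearity then replaces any
  discussion of boundary terms.\<close>

lemma std_normal_integration_by_parts:
  "(\<integral>x. x * poly p x \<partial>std_normal_distribution) = (\<integral>x. poly (pderiv p) x \<partial>std_normal_distribution)"
proof -
  have monom: "(\<integral>x. x * poly (monom a n) x \<partial>std_normal_distribution) =
      (\<integral>x. poly (pderiv (monom a n)) x \<partial>std_normal_distribution)" for a n
  proof (cases n)
    case 0
    then show ?thesis
      using integral_std_normal_distribution_moment_odd[of 1]
      by (simp add: poly_monom pderiv_monom)
  next
    case (Suc k)
    have "(\<integral>x. x * poly (monom a n) x \<partial>std_normal_distribution) =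
        a * (\<integral>x. x ^ Suc (Suc k) \<partial>std_normal_distribution)"
      by (simp add: poly_monom Suc algebra_simps flip: integral_mult_right_zero)
    moreover have "poly (pderiv (monom a n)) x = (a * real (Suc k)) * x ^ k" for x
      by (simp add: poly_monom pderiv_monom Suc)
    ultimately show ?thesis
      unfolding std_normal_moment_rec by (simp del: of_nat_Suc)
  qed
  have monoms: "(\<integral>x. x * poly (\<Sum>i\<le>n. monom (coeff p i) i) x \<partial>std_normal_distribution) =
      (\<integral>x. poly (pderiv (\<Sum>i\<le>n. monom (coeff p i) i)) x \<partial>std_normal_distribution)" for n
  proof (induction n)
    case (Suc n)
    then show ?case
      using monom[of "coeff p (Suc n)" "Suc n"] by (simp add: pderiv_add ring_distribs)
  qed (use monom[of "coeff p 0" 0] in simp)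
  show ?thesis
    using monoms[of "degree p"] unfolding poly_as_sum_of_monoms .
qed

lemma std_normal_integrable_hermite [simp]: "integrable std_normal_distribution (hermite k)"
  by (simp add: hermite_eq_poly)

lemma std_normal_integrable_hermite_mult [simp]:
  "integrable std_normal_distribution (\<lambda>x. hermite j x * hermite k x)"
  using std_normal_integrable_poly[of "Hpoly j * Hpoly k"]
  by (rule back_subst[where P = "integrable _"]) (auto simp: hermite_eq_poly)

text \<open>Multiplication by x minus differentiation is adjoint to differentiation under the normal
  law: the term with \<open>pderiv (Hpoly j)\<close> cancels against the one in the
  recursion.\<close>

lemma hermite_inner_Suc:
  "(\<integral>x. hermite (Suc j) x * hermite k x \<partial>std_normal_distribution) =
     (\<integral>x. poly (Hpoly j * pderiv (Hpoly k)) x \<partial>std_normal_distribution)"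
proof -
  have "(\<integral>x. hermite (Suc j) x * hermite k x \<partial>std_normal_distribution) =
      (\<integral>x. x * poly (Hpoly j * Hpoly k) x - poly (pderiv (Hpoly j) * Hpoly k) x \<partial>std_normal_distribution)"
    by (simp add: hermite_eq_poly algebra_simps)
  also have "\<dots> = (\<integral>x. poly (pderiv (Hpoly j * Hpoly k)) x - poly (pderiv (Hpoly j) * Hpoly k) x \<partial>std_normal_distribution)"
    by (simp add: std_normal_integration_by_parts del: poly_mult)
  also have "\<dots> = (\<integral>x. poly (Hpoly j * pderiv (Hpoly k)) x \<partial>std_normal_distribution)"
    by (simp add: pderiv_mult algebra_simps)
  finally show ?thesis .
qed

lemma hermite_orthogonal:
  "(\<integral>x. hermite j x * hermite k x \<partial>std_normal_distribution) = (if j = k then fact k else 0)"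
proof (induction j arbitrary: k)
  case 0
  show ?case
  proof (cases k)
    case 0
    then show ?thesis using std_normal_distribution_even_moments(1)[of 0] by simp
  next
    case (Suc l)
    then show ?thesis
      using hermite_inner_Suc[of l 0] by (simp add: pderiv_1)
  qed
next
  case (Suc j)
  show ?case
  proof (cases k)
    case 0
    then show ?thesis
      using hermite_inner_Suc[of j 0] by (simp add: pderiv_1)
  next
    case (Suc l)
    show ?thesis
      using Suc.IH[of l] unfolding hermite_inner_Suc Suc pderiv_Hpoly poly_mult poly_smult
      by (simp add: hermite_eq_poly mult.left_commute)
  qed
qed

section \<open>Joint normality\<close>

text \<open>Under the probability measure with density \<open>w / c\<close> the variable
  \<open>X\<close> has the standard normal characteristic function, so Levy's uniqueness theorem
  identifies its law there. With \<open>w\<close> built from a second variable this becomes a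
  statement of independence.\<close>

lemma (in prob_space) weighted_law_std_normal:
  fixes X w :: "'a \<Rightarrow> real"
  assumes [measurable]: "X \<in> borel_measurable M" "w \<in> borel_measurable M"
    and w0: "\<And>\<omega>. 0 \<le> w \<omega>" and wB: "\<And>\<omega>. w \<omega> \<le> B"
    and c: "expectation w = c" "0 < c"
    and char: "\<And>a. (CLINT \<omega>|M. w \<omega> *\<^sub>R iexp (a * X \<omega>)) = complex_of_real (c * exp (- a\<^sup>2 / 2))"
    and [measurable]: "A \<in> sets borel"
  shows "expectation (\<lambda>\<omega>. w \<omega> * indicator A (X \<omega>)) = c * measure std_normal_distribution A"
proof -
  define N where "N = density M (\<lambda>\<omega>. ennreal (w \<omega> / c))"
  have int_w: "integrable M w"
    by (rule integrable_const_bound[where B = B]) (use w0 wB in auto)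
  have [measurable_cong]: "sets N = sets M" by (simp add: N_def)
  have "emeasure N (space N) = (\<integral>\<^sup>+\<omega>. ennreal (w \<omega> / c) \<partial>M)"
    unfolding N_def by (subst emeasure_density) (auto intro!: nn_integral_cong)
  also have "\<dots> = 1"
    using int_w w0 c by (subst nn_integral_eq_integral) auto
  finally interpret N: prob_space N by (rule prob_spaceI)
  have real: "real_distribution (distr N borel X)"
    by (intro real_distribution.intro N.prob_space_distr) (auto simp: real_distribution_axioms_def)
  have "char (distr N borel X) t = char std_normal_distribution t" for t
  proof -
    have "char (distr N borel X) t = (CLINT \<omega>|N. iexp (t * X \<omega>))"
      unfolding char_def by (subst integral_distr) auto
    also have "\<dots> = (CLINT \<omega>|M. (w \<omega> / c) *\<^sub>R iexp (t * X \<omega>))"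
      unfolding N_def using w0 c by (subst integral_density) auto
    also have "\<dots> = (CLINT \<omega>|M. (1 / c) *\<^sub>R (w \<omega> *\<^sub>R iexp (t * X \<omega>)))"
      by (simp add: divide_inverse mult.commute)
    also have "\<dots> = (1 / c) *\<^sub>R (CLINT \<omega>|M. (w \<omega> *\<^sub>R iexp (t * X \<omega>)))"
      by (rule integral_scaleR_right)
    also have "\<dots> = char std_normal_distribution t"
      unfolding char char_std_normal_distribution using c by (simp add: scaleR_conv_of_real)
    finally show ?thesis .
  qed
  then have eq: "distr N borel X = std_normal_distribution"
    by (intro Levy_uniqueness real real_dist_normal_dist ext)
  have "measure std_normal_distribution A = (\<integral>\<omega>. indicator A (X \<omega>) \<partial>N)"
  proof -
    have "measure std_normal_distribution A = measure N (X -` A \<inter> space N)"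
      unfolding eq[symmetric] by (rule measure_distr) auto
    also have "\<dots> = (\<integral>\<omega>. indicator (X -` A) \<omega> \<partial>N)"
      by simp
    finally show ?thesis by (simp add: indicator_vimage)
  qed
  also have "\<dots> = expectation (\<lambda>\<omega>. (w \<omega> / c) * indicator A (X \<omega>))"
    unfolding N_def using w0 c by (subst integral_density) auto
  also have "\<dots> = expectation (\<lambda>\<omega>. (1 / c) * (w \<omega> * indicator A (X \<omega>)))"
    by simp
  also have "\<dots> = (1 / c) * expectation (\<lambda>\<omega>. w \<omega> * indicator A (X \<omega>))"
    by (rule integral_mult_right_zero)
  finally show ?thesis using c by simp
qed

text \<open>Only the one-dimensional uniqueness theorem for characteristic functions is available. It is applied
  to the law of \<open>X\<close> under the weights \<open>1 + cos (b * Z)\<close> and \<open>1 + sin (b * Z)\<close>, which are nonnegative, and then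
  to the law of \<open>Z\<close> under the weight \<open>indicator A X\<close>.\<close>

lemma (in prob_space) joint_law_std_normal:
  fixes X Z :: "'a \<Rightarrow> real"
  assumes [measurable]: "X \<in> borel_measurable M" "Z \<in> borel_measurable M"
    and char: "\<And>a b. (CLINT \<omega>|M. iexp (a * X \<omega> + b * Z \<omega>)) = complex_of_real (exp (- (a\<^sup>2 + b\<^sup>2) / 2))"
  shows "distr M (borel \<Otimes>\<^sub>M borel) (\<lambda>\<omega>. (X \<omega>, Z \<omega>)) = std_normal_distribution \<Otimes>\<^sub>M std_normal_distribution"
proof -
  have int [simp]: "integrable M (\<lambda>\<omega>. iexp (f \<omega>))" if [measurable]: "f \<in> borel_measurable M" for f
    by (rule integrable_const_bound[where B = 1]) auto
  have split_exp: "exp (- (a\<^sup>2 + b\<^sup>2) / 2) = exp (- a\<^sup>2 / 2) * exp (- b\<^sup>2 / 2 :: real)" for a b :: real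
    by (simp add: add_divide_distrib flip: exp_add)
  \<comment> \<open>These formulas express trigonometric weights through the joint characteristic
    function at (a, b) and (a, -b).\<close>
  have cos_iexp: "cos v *\<^sub>R iexp u = (iexp (u + v) + iexp (u + - v)) / 2"
    and sin_iexp: "sin v *\<^sub>R iexp u = (iexp (u + v) - iexp (u + - v)) * (- \<i> / 2)" for u v
    unfolding cis_conv_exp[symmetric] by (auto simp: complex_eq_iff cos_add sin_add cos_diff sin_diff field_simps)
  have cos_char: "(CLINT \<omega>|M. cos (b * Z \<omega>) *\<^sub>R iexp (a * X \<omega>)) = exp (- a\<^sup>2 / 2) * exp (- b\<^sup>2 / 2)" for a b
  proof -
    have "cos (b * Z \<omega>) *\<^sub>R iexp (a * X \<omega>) =
        (iexp (a * X \<omega> + b * Z \<omega>) + iexp (a * X \<omega> + (- b) * Z \<omega>)) / 2" for \<omega>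
      using cos_iexp[of "b * Z \<omega>" "a * X \<omega>"] by simp
    then have "(CLINT \<omega>|M. cos (b * Z \<omega>) *\<^sub>R iexp (a * X \<omega>)) =
        ((CLINT \<omega>|M. iexp (a * X \<omega> + b * Z \<omega>)) + (CLINT \<omega>|M. iexp (a * X \<omega> + (- b) * Z \<omega>))) / 2"
      by (simp only: integral_divide_zero integral_mult_left_zero)
        (subst Bochner_Integration.integral_add; (rule int)?; measurable)
    then show ?thesis
      unfolding char by (simp only: power2_minus split_exp of_real_mult) simp
  qed
  have sin_char: "(CLINT \<omega>|M. sin (b * Z \<omega>) *\<^sub>R iexp (a * X \<omega>)) = 0" for a b
  proof -
    have "sin (b * Z \<omega>) *\<^sub>R iexp (a * X \<omega>) =
        (iexp (a * X \<omega> + b * Z \<omega>) - iexp (a * X \<omega> + (- b) * Z \<omega>)) * (- \<i> / 2)" for \<omega>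
      using sin_iexp[of "b * Z \<omega>" "a * X \<omega>"] by simp
    then have "(CLINT \<omega>|M. sin (b * Z \<omega>) *\<^sub>R iexp (a * X \<omega>)) =
        ((CLINT \<omega>|M. iexp (a * X \<omega> + b * Z \<omega>)) - (CLINT \<omega>|M. iexp (a * X \<omega> + (- b) * Z \<omega>))) * (- \<i> / 2)"
      by (simp only: integral_divide_zero integral_mult_left_zero)
        (subst Bochner_Integration.integral_diff; (rule int)?; measurable)
    then show ?thesis
      unfolding char by simp
  qed
  have char_X: "(CLINT \<omega>|M. iexp (a * X \<omega>)) = exp (- a\<^sup>2 / 2)" for a
    using char[of a 0] by simp
  have bdd: "integrable M (\<lambda>\<omega>. f \<omega> *\<^sub>R iexp (a * X \<omega>))" if [measurable]: "f \<in> borel_measurable M"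
    and "\<And>\<omega>. \<bar>f \<omega>\<bar> \<le> 1" for f a
    by (rule integrable_const_bound[where B = 1]) (use that in \<open>auto\<close>)
  have bddr: "integrable M f" if [measurable]: "f \<in> borel_measurable M" and "\<And>\<omega>. \<bar>f \<omega>\<bar> \<le> 1" for f :: "'a \<Rightarrow> real"
    by (rule integrable_const_bound[where B = 1]) (use that in \<open>auto\<close>)
  have cosZ: "expectation (\<lambda>\<omega>. cos (b * Z \<omega>)) = exp (- b\<^sup>2 / 2)" for b
  proof -
    have "complex_of_real (expectation (\<lambda>\<omega>. cos (b * Z \<omega>))) = exp (- b\<^sup>2 / 2)"
      using cos_char[of b 0] by (simp add: scaleR_conv_of_real flip: integral_complex_of_real)
    then show ?thesis by (simp only: of_real_eq_iff)
  qed
  have sinZ: "expectation (\<lambda>\<omega>. sin (b * Z \<omega>)) = 0" for b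
  proof -
    have "complex_of_real (expectation (\<lambda>\<omega>. sin (b * Z \<omega>))) = 0"
      using sin_char[of b 0] by (simp add: scaleR_conv_of_real flip: integral_complex_of_real)
    then show ?thesis by simp
  qed
  interpret G: real_distribution std_normal_distribution by (rule real_dist_normal_dist)
  have XA: "expectation (\<lambda>\<omega>. indicator A (X \<omega>)) = G.prob A" if [measurable]: "A \<in> sets borel" for A
  proof -
    have "expectation (\<lambda>\<omega>. 1 * indicator A (X \<omega>)) = 1 * G.prob A"
      by (rule weighted_law_std_normal[where B = 1]) (use char_X in \<open>auto simp: prob_space\<close>)
    then show ?thesis by simp
  qed
  \<comment> \<open>The weight 1 is settled by \<open>XA\<close>, so subtraction isolates the
    cosine. \<open>A_cos\<close> and \<open>A_sin\<close> together give the characteristic function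
    of \<open>Z\<close> restricted to the event that \<open>X\<close> lies in
    \<open>A\<close>.\<close>
  have A_cos: "expectation (\<lambda>\<omega>. indicator A (X \<omega>) * cos (b * Z \<omega>)) = G.prob A * exp (- b\<^sup>2 / 2)"
    if [measurable]: "A \<in> sets borel" for A b
  proof -
    have "expectation (\<lambda>\<omega>. (1 + cos (b * Z \<omega>)) * indicator A (X \<omega>)) = (1 + exp (- b\<^sup>2 / 2)) * G.prob A"
    proof (rule weighted_law_std_normal[where B = 2])
      fix a
      have "(CLINT \<omega>|M. (1 + cos (b * Z \<omega>)) *\<^sub>R iexp (a * X \<omega>)) =
         (CLINT \<omega>|M. iexp (a * X \<omega>)) + (CLINT \<omega>|M. cos (b * Z \<omega>) *\<^sub>R iexp (a * X \<omega>))"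
        unfolding scaleR_add_left scaleR_one
        by (rule Bochner_Integration.integral_add; (rule int | rule bdd)) auto
      also have "\<dots> = complex_of_real ((1 + exp (- b\<^sup>2 / 2)) * exp (- a\<^sup>2 / 2))"
        unfolding char_X cos_char by (simp add: ring_distribs)
      finally show "(CLINT \<omega>|M. (1 + cos (b * Z \<omega>)) *\<^sub>R iexp (a * X \<omega>)) = \<dots>" .
    next
      show "expectation (\<lambda>\<omega>. 1 + cos (b * Z \<omega>)) = 1 + exp (- b\<^sup>2 / 2)"
        using cosZ by (simp add: bddr prob_space)
      show "1 + cos (b * Z \<omega>) \<ge> 0" for \<omega> using cos_ge_minus_one[of "b * Z \<omega>"] by linarith
      show "1 + cos (b * Z \<omega>) \<le> 2" for \<omega> using cos_le_one[of "b * Z \<omega>"] by linarith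
    qed (auto intro: add_pos_pos)
    moreover have "expectation (\<lambda>\<omega>. (1 + cos (b * Z \<omega>)) * indicator A (X \<omega>)) =
        expectation (\<lambda>\<omega>. indicator A (X \<omega>)) + expectation (\<lambda>\<omega>. indicator A (X \<omega>) * cos (b * Z \<omega>))"
      by (subst Bochner_Integration.integral_add[symmetric])
        (auto intro!: bddr simp: algebra_simps split: split_indicator)
    ultimately show ?thesis using XA[OF that] by (simp add: algebra_simps)
  qed
  have A_sin: "expectation (\<lambda>\<omega>. indicator A (X \<omega>) * sin (b * Z \<omega>)) = 0"
    if [measurable]: "A \<in> sets borel" for A b
  proof -
    have "expectation (\<lambda>\<omega>. (1 + sin (b * Z \<omega>)) * indicator A (X \<omega>)) = 1 * G.prob A"
    proof (rule weighted_law_std_normal[where B = 2])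
      fix a
      have "(CLINT \<omega>|M. (1 + sin (b * Z \<omega>)) *\<^sub>R iexp (a * X \<omega>)) =
         (CLINT \<omega>|M. iexp (a * X \<omega>)) + (CLINT \<omega>|M. sin (b * Z \<omega>) *\<^sub>R iexp (a * X \<omega>))"
        unfolding scaleR_add_left scaleR_one
        by (rule Bochner_Integration.integral_add; (rule int | rule bdd)) auto
      also have "\<dots> = complex_of_real (1 * exp (- a\<^sup>2 / 2))"
        unfolding char_X sin_char by simp
      finally show "(CLINT \<omega>|M. (1 + sin (b * Z \<omega>)) *\<^sub>R iexp (a * X \<omega>)) = \<dots>" .
    next
      show "expectation (\<lambda>\<omega>. 1 + sin (b * Z \<omega>)) = 1"
        using sinZ by (simp add: bddr prob_space)
      show "1 + sin (b * Z \<omega>) \<ge> 0" for \<omega> using sin_ge_minus_one[of "b * Z \<omega>"] by linarith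
      show "1 + sin (b * Z \<omega>) \<le> 2" for \<omega> using sin_le_one[of "b * Z \<omega>"] by linarith
    qed auto
    moreover have "expectation (\<lambda>\<omega>. (1 + sin (b * Z \<omega>)) * indicator A (X \<omega>)) =
        expectation (\<lambda>\<omega>. indicator A (X \<omega>)) + expectation (\<lambda>\<omega>. indicator A (X \<omega>) * sin (b * Z \<omega>))"
      by (subst Bochner_Integration.integral_add[symmetric])
        (auto intro!: bddr simp: algebra_simps split: split_indicator)
    ultimately show ?thesis using XA[OF that] by (simp add: algebra_simps)
  qed
  have AB: "expectation (\<lambda>\<omega>. indicator A (X \<omega>) * indicator B (Z \<omega>)) = G.prob A * G.prob B"
    if [measurable]: "A \<in> sets borel" "B \<in> sets borel" for A B
  \<comment> \<open>The total weight has to be positive for normalisation; if it is 0, both sides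
    vanish.\<close>
  proof (cases "G.prob A = 0")
    case True
    have "expectation (\<lambda>\<omega>. indicator A (X \<omega>) * indicator B (Z \<omega>)) \<le> expectation (\<lambda>\<omega>. indicator A (X \<omega>) :: real)"
      by (intro integral_mono bddr) (auto split: split_indicator)
    moreover have "0 \<le> expectation (\<lambda>\<omega>. indicator A (X \<omega>) * indicator B (Z \<omega>) :: real)"
      by (intro integral_nonneg_AE) auto
    ultimately show ?thesis using True XA[of A] by simp
  next
    case False
    show ?thesis
    proof (rule weighted_law_std_normal[where B = 1])
      fix b
      have "(CLINT \<omega>|M. indicator A (X \<omega>) *\<^sub>R iexp (b * Z \<omega>)) =
         (CLINT \<omega>|M. complex_of_real (indicator A (X \<omega>) * cos (b * Z \<omega>)) +
            \<i> * complex_of_real (indicator A (X \<omega>) * sin (b * Z \<omega>)))"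
        unfolding cis_conv_exp[symmetric]
        by (intro Bochner_Integration.integral_cong refl) (auto simp: complex_eq_iff split: split_indicator)
      also have "\<dots> = (CLINT \<omega>|M. complex_of_real (indicator A (X \<omega>) * cos (b * Z \<omega>))) +
            (CLINT \<omega>|M. \<i> * complex_of_real (indicator A (X \<omega>) * sin (b * Z \<omega>)))"
        by (rule Bochner_Integration.integral_add; rule integrable_const_bound[where B = 1])
           (auto simp: norm_mult split: split_indicator)
      also have "\<dots> = complex_of_real (G.prob A * exp (- b\<^sup>2 / 2))"
        unfolding integral_mult_right_zero integral_complex_of_real A_cos[OF that(1)] A_sin[OF that(1)] by simp
      finally show "(CLINT \<omega>|M. indicator A (X \<omega>) *\<^sub>R iexp (b * Z \<omega>)) = \<dots>" .
    next
      show "0 < G.prob A" using False by (simp add: zero_less_measure_iff)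
    qed (auto simp: XA)
  qed
  show ?thesis
  proof (rule sym, rule pair_measure_eqI)
    fix A B assume "A \<in> sets std_normal_distribution" "B \<in> sets std_normal_distribution"
    then have [measurable]: "A \<in> sets borel" "B \<in> sets borel" by auto
    have "emeasure (distr M (borel \<Otimes>\<^sub>M borel) (\<lambda>\<omega>. (X \<omega>, Z \<omega>))) (A \<times> B) =
        emeasure M {\<omega> \<in> space M. X \<omega> \<in> A \<and> Z \<omega> \<in> B}"
      by (subst emeasure_distr) (auto intro!: arg_cong[where f = "emeasure M"])
    also have "\<dots> = ennreal (expectation (indicator {\<omega> \<in> space M. X \<omega> \<in> A \<and> Z \<omega> \<in> B}))"
      by (simp add: emeasure_eq_measure)
    also have "expectation (indicator {\<omega> \<in> space M. X \<omega> \<in> A \<and> Z \<omega> \<in> B}) =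
        expectation (\<lambda>\<omega>. indicator A (X \<omega>) * indicator B (Z \<omega>) :: real)"
      by (intro Bochner_Integration.integral_cong) (auto split: split_indicator)
    finally show "emeasure std_normal_distribution A * emeasure std_normal_distribution B =
        emeasure (distr M (borel \<Otimes>\<^sub>M borel) (\<lambda>\<omega>. (X \<omega>, Z \<omega>))) (A \<times> B)"
      by (simp add: AB G.emeasure_eq_measure ennreal_mult)
  qed (auto intro: G.sigma_finite_measure_axioms simp: sets_distr cong: sets_pair_measure_cong)
qed

section \<open>Mehler's kernel\<close>

lemma integrable_mult_L2:
  fixes f g :: "'a \<Rightarrow> real"
  assumes [measurable]: "f \<in> borel_measurable M" "g \<in> borel_measurable M"
    and "integrable M (\<lambda>x. (f x)\<^sup>2)" "integrable M (\<lambda>x. (g x)\<^sup>2)"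
  shows "integrable M (\<lambda>x. f x * g x)"
proof (rule Bochner_Integration.integrable_bound)
  show "integrable M (\<lambda>x. (f x)\<^sup>2 + (g x)\<^sup>2)" using assms by simp
  have "\<bar>a * b\<bar> \<le> a\<^sup>2 + b\<^sup>2" for a b :: real
    using sum_squares_bound[of "\<bar>a\<bar>" "\<bar>b\<bar>"] zero_le_power2[of a] zero_le_power2[of b]
    unfolding abs_mult power2_abs by linarith
  then show "AE x in M. norm (f x * g x) \<le> norm ((f x)\<^sup>2 + (g x)\<^sup>2)" by simp
qed simp

lemma integral_cauchy_schwarz:
  fixes f g :: "'a \<Rightarrow> real"
  assumes [measurable]: "f \<in> borel_measurable M" "g \<in> borel_measurable M"
    and int: "integrable M (\<lambda>x. (f x)\<^sup>2)" "integrable M (\<lambda>x. (g x)\<^sup>2)"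
  shows "\<bar>\<integral>x. f x * g x \<partial>M\<bar> \<le> sqrt (\<integral>x. (f x)\<^sup>2 \<partial>M) * sqrt (\<integral>x. (g x)\<^sup>2 \<partial>M)"
proof -
  define A B C where "A = (\<integral>x. (f x)\<^sup>2 \<partial>M)" and "B = (\<integral>x. f x * g x \<partial>M)" and "C = (\<integral>x. (g x)\<^sup>2 \<partial>M)"
  have fg: "integrable M (\<lambda>x. f x * g x)" by (intro integrable_mult_L2 assms)
  have quad: "0 \<le> A * t\<^sup>2 + 2 * B * t + C" for t
  proof -
    have "0 \<le> (\<integral>x. (t * f x + g x)\<^sup>2 \<partial>M)" by simp
    also have "(\<lambda>x. (t * f x + g x)\<^sup>2) = (\<lambda>x. t\<^sup>2 * (f x)\<^sup>2 + (2 * t) * (f x * g x) + (g x)\<^sup>2)"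
      by (auto simp: power2_eq_square algebra_simps)
    also have "(\<integral>x. t\<^sup>2 * (f x)\<^sup>2 + (2 * t) * (f x * g x) + (g x)\<^sup>2 \<partial>M) = A * t\<^sup>2 + 2 * B * t + C"
      using int fg by (simp add: A_def B_def C_def)
    finally show ?thesis .
  qed
  have nn: "0 \<le> A" "0 \<le> C" by (auto simp: A_def C_def)
  have "B\<^sup>2 \<le> A * C"
  proof (cases "A = 0")
    case True
    have "B = 0"
    proof (rule ccontr)
      assume "B \<noteq> 0"
      \<comment> \<open>At this point the function 2 * B * t + C takes the value -1.\<close>
      then show False using quad[of "- (C + 1) / (2 * B)"] True by (simp add: field_simps)
    qed
    then show ?thesis using True by simp
  next
    case False
    then have "0 < A" using nn by simp
    have "A * (- B / A)\<^sup>2 + 2 * B * (- B / A) + C = C - B\<^sup>2 / A"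
      using False by (simp add: power2_eq_square field_simps)
    then have "B\<^sup>2 / A \<le> C"
      using quad[of "- B / A"] by simp
    then show ?thesis
      using \<open>0 < A\<close> by (simp add: pos_divide_le_eq mult.commute)
  qed
  then have "sqrt (B\<^sup>2) \<le> sqrt (A * C)" by (rule real_sqrt_le_mono)
  then show ?thesis by (simp add: A_def B_def C_def real_sqrt_mult)
qed

lemma hermite_affine_integrable [simp]:
  "integrable std_normal_distribution (\<lambda>z. hermite k (a + b * z))"
  using std_normal_integrable_poly[of "Hpoly k \<circ>\<^sub>p [:a, b:]"]
  by (rule back_subst[where P = "integrable _"]) (auto simp: hermite_eq_poly poly_pcompose mult.commute)

interpretation std_normal: prob_space std_normal_distribution
  using real_dist_normal_dist by (simp add: real_distribution_def)

text \<open>The Hermite polynomials are eigenfunctions of the Ornstein-Uhlenbeck operator. In the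
  three-term recurrence the factor z is integrated by parts and produces s^2 = 1 - \<rho>^2; the
  part without \<rho>^2 cancels against the last term, and what remains is the recurrence times
  \<rho>^(k+2).\<close>

lemma hermite_mehler:
  assumes "s\<^sup>2 = 1 - \<rho>\<^sup>2"
  shows "(\<integral>z. hermite k (\<rho> * x + s * z) \<partial>std_normal_distribution) = \<rho> ^ k * hermite k x"
proof (induction k rule: induct_nat_012)
  case 1
  have "(\<integral>z. z \<partial>std_normal_distribution) = 0"
    using integral_std_normal_distribution_moment_odd[of 1] by simp
  then show ?case
    using integrable_std_normal_distribution_moment[of 1]
      std_normal.prob_space by (simp add: hermite_1)
next
  case (ge2 k)
  let ?q = "[:\<rho> * x, s:]"
  have zint: "integrable std_normal_distribution (\<lambda>z. z * hermite (Suc k) (\<rho> * x + s * z))"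
    using std_normal_integrable_times_poly[of "Hpoly (Suc k) \<circ>\<^sub>p ?q"]
    by (simp add: hermite_eq_poly poly_pcompose mult.commute)
  have "(\<integral>z. z * hermite (Suc k) (\<rho> * x + s * z) \<partial>std_normal_distribution) =
      (\<integral>z. z * poly (Hpoly (Suc k) \<circ>\<^sub>p ?q) z \<partial>std_normal_distribution)"
    by (simp add: hermite_eq_poly poly_pcompose mult.commute)
  also have "\<dots> = (\<integral>z. poly (pderiv (Hpoly (Suc k) \<circ>\<^sub>p ?q)) z \<partial>std_normal_distribution)"
    by (rule std_normal_integration_by_parts)
  also have "\<dots> = (\<integral>z. (s * real (Suc k)) * hermite k (\<rho> * x + s * z) \<partial>std_normal_distribution)"
    unfolding pderiv_pcompose pderiv_Hpoly
    by (intro Bochner_Integration.integral_cong refl)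
      (simp add: hermite_eq_poly poly_pcompose pcompose_smult pderiv_pCons mult.commute)
  finally have parts: "(\<integral>z. z * hermite (Suc k) (\<rho> * x + s * z) \<partial>std_normal_distribution) =
      s * real (Suc k) * (\<rho> ^ k * hermite k x)"
    using ge2 by simp
  have "(\<integral>z. hermite (Suc (Suc k)) (\<rho> * x + s * z) \<partial>std_normal_distribution) =
      (\<integral>z. \<rho> * x * hermite (Suc k) (\<rho> * x + s * z) + s * (z * hermite (Suc k) (\<rho> * x + s * z))
         - real (Suc k) * hermite k (\<rho> * x + s * z) \<partial>std_normal_distribution)"
    unfolding hermite_Suc_Suc by (simp add: algebra_simps)
  also have "\<dots> = \<rho> * x * (\<rho> ^ Suc k * hermite (Suc k) x) + s * (s * real (Suc k) * (\<rho> ^ k * hermite k x))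
      - real (Suc k) * (\<rho> ^ k * hermite k x)"
    using zint ge2 by (simp add: parts del: of_nat_Suc power_Suc)
  also have "s * (s * real (Suc k) * (\<rho> ^ k * hermite k x)) = s\<^sup>2 * (real (Suc k) * (\<rho> ^ k * hermite k x))"
    by (simp add: power2_eq_square)
  finally show ?case
    unfolding assms hermite_Suc_Suc by (simp add: algebra_simps power2_eq_square)
qed (use std_normal_distribution_even_moments(1)[of 0] in simp)

abbreviation std_normal_pair :: "(real \<times> real) measure" where
  "std_normal_pair \<equiv> std_normal_distribution \<Otimes>\<^sub>M std_normal_distribution"

interpretation std_normal_pair: pair_prob_space std_normal_distribution std_normal_distribution ..

lemma sets_std_normal_pair [measurable_cong]: "sets std_normal_pair = sets (borel \<Otimes>\<^sub>M borel)"
  by (intro sets_pair_measure_cong) auto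

lemma std_normal_pair_tensor:
  fixes f g :: "real \<Rightarrow> real"
  assumes f: "integrable std_normal_distribution f" and g: "integrable std_normal_distribution g"
  shows "integrable std_normal_pair (\<lambda>z. f (fst z) * g (snd z))"
    and "(\<integral>z. f (fst z) * g (snd z) \<partial>std_normal_pair) =
      (\<integral>x. f x \<partial>std_normal_distribution) * (\<integral>x. g x \<partial>std_normal_distribution)"
proof -
  have [measurable]: "f \<in> borel_measurable borel" "g \<in> borel_measurable borel"
    using borel_measurable_integrable[OF f] borel_measurable_integrable[OF g] by auto
  have "integrable std_normal_pair (\<lambda>(x, y). f x * g y)"
    by (rule std_normal_pair.Fubini_integrable) (use f g in \<open>auto simp: abs_mult\<close>)
  then show i: "integrable std_normal_pair (\<lambda>z. f (fst z) * g (snd z))"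
    by (simp add: case_prod_beta')
  show "(\<integral>z. f (fst z) * g (snd z) \<partial>std_normal_pair) =
      (\<integral>x. f x \<partial>std_normal_distribution) * (\<integral>x. g x \<partial>std_normal_distribution)"
    using std_normal_pair.integral_fst'[OF i] by simp
qed

text \<open>The density of a standard normal pair with correlation \<open>\<rho>\<close> relative to the independent pair.\<close>

definition mehler_kernel :: "real \<Rightarrow> real \<times> real \<Rightarrow> real" where
  "mehler_kernel \<rho> z = normal_density (\<rho> * fst z) (sqrt (1 - \<rho>\<^sup>2)) (snd z) / std_normal_density (snd z)"

lemma mehler_kernel_measurable [measurable]: "mehler_kernel \<rho> \<in> borel_measurable (borel \<Otimes>\<^sub>M borel)"
  unfolding mehler_kernel_def[abs_def] normal_density_def by measurable

lemma mehler_kernel_nonneg: "0 \<le> mehler_kernel \<rho> z"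
  by (simp add: mehler_kernel_def)

text \<open>Completing the square shows that the weighted square of the kernel is again Gaussian,
  with correlation 2 \<rho> / (1 + \<rho>^2). It is written as marginal times conditional density,
  so that integrating first over y and then over x leaves just the prefactor.\<close>

lemma mehler_kernel_sq:
  assumes "\<bar>\<rho>\<bar> < 1"
  shows "std_normal_density x * (std_normal_density y * (mehler_kernel \<rho> (x, y))\<^sup>2) =
    (1 / (1 - \<rho>\<^sup>2)) * (normal_density 0 (sqrt ((1 + \<rho>\<^sup>2) / (1 - \<rho>\<^sup>2))) x *
       normal_density (2 * \<rho> * x / (1 + \<rho>\<^sup>2)) (sqrt ((1 - \<rho>\<^sup>2) / (1 + \<rho>\<^sup>2))) y)"
proof -
  define q where "q = \<rho>\<^sup>2"
  have q: "0 \<le> q" "q < 1" using assms abs_square_less_1[of \<rho>] by (auto simp: q_def)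
  have pos: "0 < 1 - q" "0 < 1 + q" using q by auto
  have e: "- x\<^sup>2 / 2 + (- y\<^sup>2 / 2) + 2 * (- (y - \<rho> * x)\<^sup>2 / (2 * (1 - q)) + y\<^sup>2 / 2) =
     - x\<^sup>2 / (2 * ((1 + q) / (1 - q))) - (y - 2 * \<rho> * x / (1 + q))\<^sup>2 / (2 * ((1 - q) / (1 + q)))"
  proof -
    have r: "- x\<^sup>2 / (2 * ((1 + q) / (1 - q))) = - (x\<^sup>2 * (1 - q)) / (2 * (1 + q))"
      using pos by (simp add: field_simps)
    have r2: "(y - 2 * \<rho> * x / (1 + q))\<^sup>2 / (2 * ((1 - q) / (1 + q))) =
        (y * (1 + q) - 2 * \<rho> * x)\<^sup>2 / (2 * (1 - q) * (1 + q))"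
    proof -
      have E: "y - 2 * \<rho> * x / (1 + q) = (y * (1 + q) - 2 * \<rho> * x) / (1 + q)"
        using pos by (simp add: field_simps)
      have *: "(a / u)\<^sup>2 / (2 * (v / u)) = a\<^sup>2 / (2 * v * u)" if "0 < u" "0 < v" for a u v :: real
        using that by (simp add: power2_eq_square field_simps)
      show ?thesis unfolding E by (rule *) (use pos in auto)
    qed
    have "2 * (1 - q) * (1 + q) * (- x\<^sup>2 / 2 + (- y\<^sup>2 / 2) + 2 * (- (y - \<rho> * x)\<^sup>2 / (2 * (1 - q)) + y\<^sup>2 / 2)) =
        - x\<^sup>2 * (1 - q) * (1 + q) - y\<^sup>2 * (1 - q) * (1 + q) - 2 * (1 + q) * (y - \<rho> * x)\<^sup>2 + 2 * y\<^sup>2 * (1 - q) * (1 + q)"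
      using pos by (simp add: field_simps)
    also have "\<dots> = - x\<^sup>2 * (1 - q) * (1 - q) - (y * (1 + q) - 2 * \<rho> * x)\<^sup>2"
      unfolding q_def by (simp add: power2_eq_square algebra_simps)
    also have "\<dots> = 2 * (1 - q) * (1 + q) *
        (- (x\<^sup>2 * (1 - q)) / (2 * (1 + q)) - (y * (1 + q) - 2 * \<rho> * x)\<^sup>2 / (2 * (1 - q) * (1 + q)))"
    proof -
      have *: "2 * v * u * (- (a * v) / (2 * u) - b / (2 * v * u)) = - a * v * v - b"
        if "0 < u" "0 < v" for a b u v :: real
        using that by (simp add: right_diff_distrib)
      show ?thesis by (rule *[symmetric]) (use pos in auto)
    qed
    finally show ?thesis unfolding r r2 using pos by simp
  qed
  have sq: "(exp t)\<^sup>2 = exp (2 * t)" for t :: real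
    by (simp add: power2_eq_square flip: exp_add)
  \<comment> \<open>The two variances are reciprocal to each other, so their normalising constants
    multiply to 1 / (2 * pi).\<close>
  have c: "1 / sqrt (2 * pi * 1) * (1 / sqrt (2 * pi * 1) * (sqrt (2 * pi * 1) / sqrt (2 * pi * (1 - q)))\<^sup>2) =
     1 / (1 - q) * (1 / sqrt (2 * pi * ((1 + q) / (1 - q))) * (1 / sqrt (2 * pi * ((1 - q) / (1 + q)))))"
  proof -
    have "sqrt (2 * pi * ((1 + q) / (1 - q))) * sqrt (2 * pi * ((1 - q) / (1 + q))) =
        sqrt ((2 * pi * ((1 + q) / (1 - q))) * (2 * pi * ((1 - q) / (1 + q))))"
      by (rule real_sqrt_mult[symmetric])
    also have "(2 * pi * ((1 + q) / (1 - q))) * (2 * pi * ((1 - q) / (1 + q))) = (2 * pi)\<^sup>2"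
      using pos by (simp add: power2_eq_square)
    also have "sqrt ((2 * pi)\<^sup>2) = 2 * pi" unfolding real_sqrt_abs by simp
    finally have "1 / sqrt (2 * pi * ((1 + q) / (1 - q))) * (1 / sqrt (2 * pi * ((1 - q) / (1 + q)))) = 1 / (2 * pi)"
      by (metis mult_1 times_divide_times_eq)
    moreover have "(sqrt (2 * pi * 1) / sqrt (2 * pi * (1 - q)))\<^sup>2 = 1 / (1 - q)"
      using pos by (simp add: power_divide)
    moreover have "1 / sqrt (2 * pi * 1) * (1 / sqrt (2 * pi * 1) * t) = t / (2 * pi)" for t
      by simp
    ultimately show ?thesis by simp
  qed
  have n1: "std_normal_density t = 1 / sqrt (2 * pi * 1) * exp (- t\<^sup>2 / 2)" for t
    by (simp add: normal_density_def)
  have n2: "normal_density \<mu> (sqrt v) t = 1 / sqrt (2 * pi * v) * exp (- (t - \<mu>)\<^sup>2 / (2 * v))" if "0 \<le> v" for \<mu> v t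
    using that by (simp add: normal_density_def)
  have K: "mehler_kernel \<rho> (x, y) = sqrt (2 * pi * 1) / sqrt (2 * pi * (1 - q)) *
      exp (- (y - \<rho> * x)\<^sup>2 / (2 * (1 - q)) + y\<^sup>2 / 2)"
  proof -
    have *: "(1 / b * E) / (1 / a * inverse F) = a / b * (E * F)" for a b E F :: real
      by (simp add: divide_inverse mult_ac)
    have "exp (- y\<^sup>2 / 2) = inverse (exp (y\<^sup>2 / 2))"
      by (simp add: exp_minus)
    moreover have "0 \<le> 1 - q" using pos by simp
    ultimately show ?thesis
      unfolding mehler_kernel_def fst_conv snd_conv q_def[symmetric] n1 exp_add
      by (simp only: n2 *)
  qed
  have "std_normal_density x * (std_normal_density y * (mehler_kernel \<rho> (x, y))\<^sup>2) =
      (1 / sqrt (2 * pi * 1) * (1 / sqrt (2 * pi * 1) * (sqrt (2 * pi * 1) / sqrt (2 * pi * (1 - q)))\<^sup>2)) *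
      exp (- x\<^sup>2 / 2 + (- y\<^sup>2 / 2) + 2 * (- (y - \<rho> * x)\<^sup>2 / (2 * (1 - q)) + y\<^sup>2 / 2))"
    unfolding K n1 power_mult_distrib sq by (simp only: exp_add distrib_left mult_ac)
  also have "\<dots> = (1 / (1 - q) * (1 / sqrt (2 * pi * ((1 + q) / (1 - q))) * (1 / sqrt (2 * pi * ((1 - q) / (1 + q)))))) *
      exp (- x\<^sup>2 / (2 * ((1 + q) / (1 - q))) + (- (y - 2 * \<rho> * x / (1 + q))\<^sup>2 / (2 * ((1 - q) / (1 + q)))))"
    unfolding c e by (simp only: diff_conv_add_uminus minus_divide_left)
  also have "\<dots> = 1 / (1 - q) * (normal_density 0 (sqrt ((1 + q) / (1 - q))) x *
       normal_density (2 * \<rho> * x / (1 + q)) (sqrt ((1 - q) / (1 + q))) y)"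
  proof -
    have v: "0 \<le> (1 + q) / (1 - q)" "0 \<le> (1 - q) / (1 + q)" using pos by auto
    show ?thesis
      unfolding n2[OF v(1)] n2[OF v(2)] by (simp only: exp_add mult_ac diff_zero)
  qed
  finally show ?thesis by (simp add: q_def)
qed

lemma mehler_kernel_L2:
  assumes "\<bar>\<rho>\<bar> < 1"
  shows "integrable std_normal_pair (\<lambda>z. (mehler_kernel \<rho> z)\<^sup>2)"
    and "(\<integral>z. (mehler_kernel \<rho> z)\<^sup>2 \<partial>std_normal_pair) = 1 / (1 - \<rho>\<^sup>2)"
proof -
  have q: "\<rho>\<^sup>2 < 1" using assms abs_square_less_1[of \<rho>] by auto
  have pos: "0 < 1 - \<rho>\<^sup>2" "0 < 1 + \<rho>\<^sup>2" using q by (auto intro: add_pos_nonneg)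
  let ?n1 = "normal_density 0 (sqrt ((1 + \<rho>\<^sup>2) / (1 - \<rho>\<^sup>2)))"
  let ?n2 = "\<lambda>x. normal_density (2 * \<rho> * x / (1 + \<rho>\<^sup>2)) (sqrt ((1 - \<rho>\<^sup>2) / (1 + \<rho>\<^sup>2)))"
  have one: "(\<integral>\<^sup>+y. ennreal (normal_density \<mu> \<sigma> y) \<partial>lborel) = 1" if "0 < \<sigma>" for \<mu> \<sigma>
    by (subst nn_integral_eq_integral) (use that in auto)
  have [measurable]: "(\<lambda>y. mehler_kernel \<rho> (x, y)) \<in> borel_measurable borel" for x by measurable
  have "(\<integral>\<^sup>+z. ennreal ((mehler_kernel \<rho> z)\<^sup>2) \<partial>std_normal_pair) =
     (\<integral>\<^sup>+x. \<integral>\<^sup>+y. ennreal ((mehler_kernel \<rho> (x, y))\<^sup>2) \<partial>std_normal_distribution \<partial>std_normal_distribution)"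
    by (subst std_normal.nn_integral_fst[symmetric]) auto
  also have "\<dots> = (\<integral>\<^sup>+x. \<integral>\<^sup>+y. ennreal (std_normal_density x * (std_normal_density y * (mehler_kernel \<rho> (x, y))\<^sup>2)) \<partial>lborel \<partial>lborel)"
    by (simp add: nn_integral_density nn_integral_cmult[symmetric] ennreal_mult)
  also have "\<dots> = (\<integral>\<^sup>+x. \<integral>\<^sup>+y. ennreal (1 / (1 - \<rho>\<^sup>2)) * (ennreal (?n1 x) * ennreal (?n2 x y)) \<partial>lborel \<partial>lborel)"
    unfolding mehler_kernel_sq[OF assms] using pos by (subst ennreal_mult ennreal_mult | simp)+
  also have "\<dots> = ennreal (1 / (1 - \<rho>\<^sup>2))"
    using pos by (simp add: nn_integral_cmult one del: ennreal_1)
  finally have nn: "(\<integral>\<^sup>+z. ennreal ((mehler_kernel \<rho> z)\<^sup>2) \<partial>std_normal_pair) = ennreal (1 / (1 - \<rho>\<^sup>2))" .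
  show i: "integrable std_normal_pair (\<lambda>z. (mehler_kernel \<rho> z)\<^sup>2)"
    by (rule integrableI_nonneg) (auto simp: nn)
  show "(\<integral>z. (mehler_kernel \<rho> z)\<^sup>2 \<partial>std_normal_pair) = 1 / (1 - \<rho>\<^sup>2)"
    using pos nn by (subst integral_eq_nn_integral) auto
qed

section \<open>Covariance of functions of correlated normal variables\<close>

text \<open>Bessel's computation in terms of Gram coefficients. In
  \<open>mehler_remainder_L2\<close> these coefficients are read off from Hermite orthogonality and
  covariances.\<close>

lemma integral_square_diff_sum:
  fixes K :: "'b \<Rightarrow> real" and e :: "nat \<Rightarrow> 'b \<Rightarrow> real"
  assumes K: "integrable N (\<lambda>z. (K z)\<^sup>2)" and Ke: "\<And>k. integrable N (\<lambda>z. K z * e k z)"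
    and ee: "\<And>j k. integrable N (\<lambda>z. e j z * e k z)"
  shows "integrable N (\<lambda>z. (K z - (\<Sum>k\<le>m. c k * e k z))\<^sup>2)"
    and "(\<integral>z. (K z - (\<Sum>k\<le>m. c k * e k z))\<^sup>2 \<partial>N) = (\<integral>z. (K z)\<^sup>2 \<partial>N)
      - 2 * (\<Sum>k\<le>m. c k * (\<integral>z. K z * e k z \<partial>N))
      + (\<Sum>j\<le>m. \<Sum>k\<le>m. c j * c k * (\<integral>z. e j z * e k z \<partial>N))"
proof -
  define A B where "A = (\<lambda>z. \<Sum>k\<le>m. c k * (K z * e k z))"
    and "B = (\<lambda>z. \<Sum>j\<le>m. \<Sum>k\<le>m. c j * c k * (e j z * e k z))"
  have expand: "(K z - (\<Sum>k\<le>m. c k * e k z))\<^sup>2 = (K z)\<^sup>2 - 2 * A z + B z" for z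
  proof -
    have "B z = (\<Sum>k\<le>m. c k * e k z)\<^sup>2"
      unfolding B_def power2_eq_square sum_product by (simp add: mult_ac)
    moreover have "A z = K z * (\<Sum>k\<le>m. c k * e k z)"
      unfolding A_def sum_distrib_left by (simp add: mult_ac)
    ultimately show ?thesis by (simp add: power2_eq_square algebra_simps)
  qed
  have A: "integrable N A" and B: "integrable N B"
    unfolding A_def B_def by (intro Bochner_Integration.integrable_sum integrable_mult_right Ke ee)+
  have iA: "(\<integral>z. A z \<partial>N) = (\<Sum>k\<le>m. c k * (\<integral>z. K z * e k z \<partial>N))"
    unfolding A_def by (subst Bochner_Integration.integral_sum) (simp_all add: Ke)
  have iB: "(\<integral>z. B z \<partial>N) = (\<Sum>j\<le>m. \<Sum>k\<le>m. c j * c k * (\<integral>z. e j z * e k z \<partial>N))"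
  proof -
    have "(\<integral>z. B z \<partial>N) = (\<Sum>j\<le>m. \<integral>z. (\<Sum>k\<le>m. c j * c k * (e j z * e k z)) \<partial>N)"
      unfolding B_def by (rule Bochner_Integration.integral_sum)
        (intro Bochner_Integration.integrable_sum integrable_mult_right ee)
    also have "\<dots> = (\<Sum>j\<le>m. \<Sum>k\<le>m. \<integral>z. c j * c k * (e j z * e k z) \<partial>N)"
      by (intro sum.cong refl Bochner_Integration.integral_sum integrable_mult_right ee)
    finally show ?thesis by simp
  qed
  show "integrable N (\<lambda>z. (K z - (\<Sum>k\<le>m. c k * e k z))\<^sup>2)"
    unfolding expand using K A B by simp
  show "(\<integral>z. (K z - (\<Sum>k\<le>m. c k * e k z))\<^sup>2 \<partial>N) = (\<integral>z. (K z)\<^sup>2 \<partial>N)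
      - 2 * (\<Sum>k\<le>m. c k * (\<integral>z. K z * e k z \<partial>N))
      + (\<Sum>j\<le>m. \<Sum>k\<le>m. c j * c k * (\<integral>z. e j z * e k z \<partial>N))"
    unfolding expand iA[symmetric] iB[symmetric] using K A B by simp
qed

text \<open>Joint normality enters through the characteristic function, the form from which
  \<open>joint_law_std_normal\<close> starts. The condition on \<rho> gives the pair a
  density.\<close>

locale std_normal_correlated = prob_space M for M :: "'a measure" +
  fixes X Y :: "'a \<Rightarrow> real" and \<rho> :: real
  assumes X_measurable [measurable]: "X \<in> borel_measurable M"
    and Y_measurable [measurable]: "Y \<in> borel_measurable M"
    and law_X: "distr M borel X = std_normal_distribution"
    and law_Y: "distr M borel Y = std_normal_distribution"
    and rho_less_1: "\<bar>\<rho>\<bar> < 1"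
    and char_XY: "\<And>a b. (CLINT \<omega>|M. iexp (a * X \<omega> + b * Y \<omega>)) =
      complex_of_real (exp (- (a\<^sup>2 + 2 * a * b * \<rho> + b\<^sup>2) / 2))"
begin

lemma rho_sq_less_1: "\<rho>\<^sup>2 < 1"
  using rho_less_1 abs_square_less_1[of \<rho>] by auto

definition s :: real where "s = sqrt (1 - \<rho>\<^sup>2)"

lemma s_pos: "0 < s" and s_sq: "s\<^sup>2 = 1 - \<rho>\<^sup>2"
  using rho_sq_less_1 by (auto simp: s_def)

text \<open>The standardised innovation of \<open>Y\<close> given \<open>X\<close>, as in
  Gram-Schmidt; it is independent of \<open>X\<close>.\<close>

definition Z :: "'a \<Rightarrow> real" where "Z \<omega> = (Y \<omega> - \<rho> * X \<omega>) / s"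

lemma Z_measurable [measurable]: "Z \<in> borel_measurable M"
  unfolding Z_def[abs_def] by measurable

lemma Y_eq: "Y \<omega> = \<rho> * X \<omega> + s * Z \<omega>"
  using s_pos by (simp add: Z_def)

lemma law_XZ: "distr M (borel \<Otimes>\<^sub>M borel) (\<lambda>\<omega>. (X \<omega>, Z \<omega>)) = std_normal_pair"
proof (rule joint_law_std_normal)
  fix a b
  have "a * X \<omega> + b * Z \<omega> = (a - b * \<rho> / s) * X \<omega> + (b / s) * Y \<omega>" for \<omega>
    using s_pos by (simp add: Z_def field_simps)
  then have "(CLINT \<omega>|M. iexp (a * X \<omega> + b * Z \<omega>)) =
      complex_of_real (exp (- ((a - b * \<rho> / s)\<^sup>2 + 2 * (a - b * \<rho> / s) * (b / s) * \<rho> + (b / s)\<^sup>2) / 2))"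
    by (simp only: char_XY)
  also have "(a - b * \<rho> / s)\<^sup>2 + 2 * (a - b * \<rho> / s) * (b / s) * \<rho> + (b / s)\<^sup>2 =
      a\<^sup>2 + b\<^sup>2 * ((1 - \<rho>\<^sup>2) / s\<^sup>2)"
    using s_pos by (simp add: field_simps power2_eq_square)
  also have "(1 - \<rho>\<^sup>2) / s\<^sup>2 = 1"
    using s_pos by (simp add: s_sq[symmetric])
  finally show "(CLINT \<omega>|M. iexp (a * X \<omega> + b * Z \<omega>)) = complex_of_real (exp (- (a\<^sup>2 + b\<^sup>2) / 2))"
    by simp
qed auto

text \<open>Given X = x, the variable Y is an affine image of Z. The substitution y = \<rho> * x + s
  * z turns the density of Z into the normal density with mean \<rho> * x and deviation s, and its
  quotient by the standard density is the kernel.\<close>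

lemma nn_integral_XY:
  assumes [measurable]: "u \<in> borel_measurable (borel \<Otimes>\<^sub>M borel)"
  shows "(\<integral>\<^sup>+\<omega>. u (X \<omega>, Y \<omega>) \<partial>M) = (\<integral>\<^sup>+z. ennreal (mehler_kernel \<rho> z) * u z \<partial>std_normal_pair)"
proof -
  have inner: "(\<integral>\<^sup>+z. u (x, \<rho> * x + s * z) \<partial>std_normal_distribution) =
      (\<integral>\<^sup>+y. ennreal (mehler_kernel \<rho> (x, y)) * u (x, y) \<partial>std_normal_distribution)" for x
  proof -
    have "std_normal_density y \<noteq> 0" for y
      using normal_density_pos[of 1 0 y] by simp
    then have "(\<integral>\<^sup>+y. ennreal (mehler_kernel \<rho> (x, y)) * u (x, y) \<partial>std_normal_distribution) =
       (\<integral>\<^sup>+y. ennreal (normal_density (\<rho> * x) s y) * u (x, y) \<partial>lborel)"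
      by (subst nn_integral_density)
        (auto simp: mehler_kernel_def s_def mult.assoc[symmetric] ennreal_mult[symmetric] mehler_kernel_nonneg
          intro!: nn_integral_cong arg_cong2[where f = "(*)"] arg_cong[where f = ennreal])
    also have "\<dots> = ennreal \<bar>s\<bar> * (\<integral>\<^sup>+z. ennreal (normal_density (\<rho> * x) s (\<rho> * x + s * z)) * u (x, \<rho> * x + s * z) \<partial>lborel)"
      using s_pos by (intro nn_integral_real_affine) auto
    also have "\<dots> = (\<integral>\<^sup>+z. ennreal \<bar>s\<bar> * (ennreal (normal_density (\<rho> * x) s (\<rho> * x + s * z)) * u (x, \<rho> * x + s * z)) \<partial>lborel)"
      by (rule nn_integral_cmult[symmetric]) measurable
    also have "\<dots> = (\<integral>\<^sup>+z. ennreal (std_normal_density z) * u (x, \<rho> * x + s * z) \<partial>lborel)"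
    proof (rule nn_integral_cong)
      fix z
      have "s * normal_density (\<rho> * x) s (\<rho> * x + s * z) = std_normal_density z"
        using s_pos by (simp add: normal_density_def real_sqrt_mult power_mult_distrib)
      then show "ennreal \<bar>s\<bar> * (ennreal (normal_density (\<rho> * x) s (\<rho> * x + s * z)) * u (x, \<rho> * x + s * z)) =
          ennreal (std_normal_density z) * u (x, \<rho> * x + s * z)"
        using s_pos by (simp add: mult.assoc[symmetric] ennreal_mult[symmetric])
    qed
    also have "\<dots> = (\<integral>\<^sup>+z. u (x, \<rho> * x + s * z) \<partial>std_normal_distribution)"
      by (rule nn_integral_density[symmetric]) auto
    finally show ?thesis ..
  qed
  have "(\<integral>\<^sup>+\<omega>. u (X \<omega>, Y \<omega>) \<partial>M) =
      (\<integral>\<^sup>+z. u (fst z, \<rho> * fst z + s * snd z) \<partial>distr M (borel \<Otimes>\<^sub>M borel) (\<lambda>\<omega>. (X \<omega>, Z \<omega>)))"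
    by (subst nn_integral_distr) (auto simp: Y_eq)
  also have "\<dots> = (\<integral>\<^sup>+x. \<integral>\<^sup>+z. u (x, \<rho> * x + s * z) \<partial>std_normal_distribution \<partial>std_normal_distribution)"
    unfolding law_XZ by (subst std_normal.nn_integral_fst[symmetric]) auto
  also have "\<dots> = (\<integral>\<^sup>+z. ennreal (mehler_kernel \<rho> z) * u z \<partial>std_normal_pair)"
    unfolding inner by (subst std_normal.nn_integral_fst[symmetric]) auto
  finally show ?thesis .
qed

lemma law_XY: "distr M (borel \<Otimes>\<^sub>M borel) (\<lambda>\<omega>. (X \<omega>, Y \<omega>)) =
    density std_normal_pair (\<lambda>z. ennreal (mehler_kernel \<rho> z))"
proof (rule measure_eqI)
  fix A assume "A \<in> sets (distr M (borel \<Otimes>\<^sub>M borel) (\<lambda>\<omega>. (X \<omega>, Y \<omega>)))"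
  then have [measurable]: "A \<in> sets (borel \<Otimes>\<^sub>M borel)" by simp
  have "emeasure (distr M (borel \<Otimes>\<^sub>M borel) (\<lambda>\<omega>. (X \<omega>, Y \<omega>))) A =
      (\<integral>\<^sup>+z. indicator A z \<partial>distr M (borel \<Otimes>\<^sub>M borel) (\<lambda>\<omega>. (X \<omega>, Y \<omega>)))"
    by simp
  also have "\<dots> = (\<integral>\<^sup>+\<omega>. indicator A (X \<omega>, Y \<omega>) \<partial>M)"
    by (rule nn_integral_distr) measurable
  also have "\<dots> = emeasure (density std_normal_pair (\<lambda>z. ennreal (mehler_kernel \<rho> z))) A"
    by (subst nn_integral_XY) (auto simp: emeasure_density)
  finally show "emeasure (distr M (borel \<Otimes>\<^sub>M borel) (\<lambda>\<omega>. (X \<omega>, Y \<omega>))) A = \<dots>" .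
qed (simp add: sets_std_normal_pair)

lemma expectation_XY:
  fixes u :: "real \<times> real \<Rightarrow> real"
  assumes [measurable]: "u \<in> borel_measurable (borel \<Otimes>\<^sub>M borel)"
  shows "expectation (\<lambda>\<omega>. u (X \<omega>, Y \<omega>)) = (\<integral>z. mehler_kernel \<rho> z * u z \<partial>std_normal_pair)"
proof -
  have "expectation (\<lambda>\<omega>. u (X \<omega>, Y \<omega>)) = (\<integral>z. u z \<partial>distr M (borel \<Otimes>\<^sub>M borel) (\<lambda>\<omega>. (X \<omega>, Y \<omega>)))"
    by (rule integral_distr[symmetric]) measurable
  also have "\<dots> = (\<integral>z. mehler_kernel \<rho> z * u z \<partial>std_normal_pair)"
    unfolding law_XY by (subst integral_density) (auto simp: mehler_kernel_nonneg)
  finally show ?thesis .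
qed

lemma integrable_X:
  assumes "integrable std_normal_distribution (f :: real \<Rightarrow> real)"
  shows "integrable M (\<lambda>\<omega>. f (X \<omega>))"
proof -
  have [measurable]: "f \<in> borel_measurable borel" using borel_measurable_integrable[OF assms] by simp
  show ?thesis using assms unfolding law_X[symmetric] by (subst (asm) integrable_distr_eq) auto
qed

lemma integrable_Y:
  assumes "integrable std_normal_distribution (f :: real \<Rightarrow> real)"
  shows "integrable M (\<lambda>\<omega>. f (Y \<omega>))"
proof -
  have [measurable]: "f \<in> borel_measurable borel" using borel_measurable_integrable[OF assms] by simp
  show ?thesis using assms unfolding law_Y[symmetric] by (subst (asm) integrable_distr_eq) auto
qed

lemma integrable_hermite_XY: "integrable M (\<lambda>\<omega>. hermite j (X \<omega>) * hermite k (Y \<omega>))"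
  using integrable_X[OF std_normal_integrable_hermite_mult[of j j]]
    integrable_Y[OF std_normal_integrable_hermite_mult[of k k]]
  by (intro integrable_mult_L2) (auto simp: power2_eq_square)

text \<open>With Y = \<rho> X + s Z, integrating over the independent Z first turns
  \<open>hermite k\<close> of Y into \<rho>^k times \<open>hermite k\<close> of X, by
  \<open>hermite_mehler\<close>; orthogonality does the rest.\<close>

lemma hermite_covariance:
  "expectation (\<lambda>\<omega>. hermite j (X \<omega>) * hermite k (Y \<omega>)) = (if j = k then fact k * \<rho> ^ k else 0)"
proof -
  let ?g = "\<lambda>z. hermite j (fst z) * hermite k (\<rho> * fst z + s * snd z)"
  have int: "integrable std_normal_pair ?g"
    unfolding law_XZ[symmetric] using integrable_hermite_XY[of j k]
    by (subst integrable_distr_eq) (auto simp: Y_eq)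
  have "expectation (\<lambda>\<omega>. hermite j (X \<omega>) * hermite k (Y \<omega>)) = (\<integral>z. ?g z \<partial>distr M (borel \<Otimes>\<^sub>M borel) (\<lambda>\<omega>. (X \<omega>, Z \<omega>)))"
    by (subst integral_distr) (auto simp: Y_eq)
  also have "\<dots> = (\<integral>x. \<integral>z. hermite j x * hermite k (\<rho> * x + s * z) \<partial>std_normal_distribution \<partial>std_normal_distribution)"
    unfolding law_XZ using std_normal_pair.integral_fst'[OF int] by simp
  also have "\<dots> = (\<integral>x. \<rho> ^ k * (hermite j x * hermite k x) \<partial>std_normal_distribution)"
    by (simp add: hermite_mehler[OF s_sq] mult.left_commute)
  also have "\<dots> = \<rho> ^ k * (\<integral>x. hermite j x * hermite k x \<partial>std_normal_distribution)"
    by (rule integral_mult_right_zero)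
  also have "\<dots> = (if j = k then fact k * \<rho> ^ k else 0)"
    by (simp add: hermite_orthogonal)
  finally show ?thesis .
qed

definition mehler_remainder :: "nat \<Rightarrow> real \<times> real \<Rightarrow> real" where
  "mehler_remainder m z =
     mehler_kernel \<rho> z - (\<Sum>k\<le>m. \<rho> ^ k / fact k * (hermite k (fst z) * hermite k (snd z)))"

lemma mehler_remainder_measurable [measurable]:
  "mehler_remainder m \<in> borel_measurable (borel \<Otimes>\<^sub>M borel)"
  unfolding mehler_remainder_def[abs_def] by measurable

text \<open>By \<open>expectation_XY\<close> the inner product of the kernel with the k-th Hermite
  product is a covariance, already known to be k! \<rho>^k. Each subtracted term therefore removes
  \<rho>^(2k) from the squared norm 1 / (1 - \<rho>^2), the sum of the full geometric series, and
  the tail from index m + 1 is left.\<close>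

lemma mehler_remainder_L2:
  "integrable std_normal_pair (\<lambda>z. (mehler_remainder m z)\<^sup>2)"
  "(\<integral>z. (mehler_remainder m z)\<^sup>2 \<partial>std_normal_pair) = \<rho>\<^sup>2 ^ Suc m / (1 - \<rho>\<^sup>2)"
proof -
  let ?e = "\<lambda>k z. hermite k (fst z) * hermite k (snd z)"
  let ?c = "\<lambda>k. \<rho> ^ k / fact k"
  have ee: "integrable std_normal_pair (\<lambda>z. ?e j z * ?e k z)"
    and iee: "(\<integral>z. ?e j z * ?e k z \<partial>std_normal_pair) = (if j = k then (fact k)\<^sup>2 else 0)" for j k
  proof -
    have e: "(\<lambda>z. ?e j z * ?e k z) = (\<lambda>z. (hermite j (fst z) * hermite k (fst z)) * (hermite j (snd z) * hermite k (snd z)))"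
      by (auto simp: mult_ac)
    note t = std_normal_pair_tensor[OF std_normal_integrable_hermite_mult[of j k] std_normal_integrable_hermite_mult[of j k]]
    show "integrable std_normal_pair (\<lambda>z. ?e j z * ?e k z)" unfolding e by (rule t(1))
    show "(\<integral>z. ?e j z * ?e k z \<partial>std_normal_pair) = (if j = k then (fact k)\<^sup>2 else 0)"
      unfolding e t(2) hermite_orthogonal by (simp add: power2_eq_square)
  qed
  have Ke: "integrable std_normal_pair (\<lambda>z. mehler_kernel \<rho> z * ?e k z)" for k
    using ee[of k k] mehler_kernel_L2(1)[OF rho_less_1]
    by (intro integrable_mult_L2) (auto simp: power2_eq_square)
  have iKe: "(\<integral>z. mehler_kernel \<rho> z * ?e k z \<partial>std_normal_pair) = fact k * \<rho> ^ k" for k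
    using expectation_XY[of "?e k"] hermite_covariance[of k k] by simp
  note L2 = integral_square_diff_sum[OF mehler_kernel_L2(1)[OF rho_less_1] Ke ee, where m = m and c = ?c]
  show "integrable std_normal_pair (\<lambda>z. (mehler_remainder m z)\<^sup>2)"
    unfolding mehler_remainder_def by (rule L2(1))
  have "(\<integral>z. (mehler_remainder m z)\<^sup>2 \<partial>std_normal_pair) =
     (\<integral>z. (mehler_kernel \<rho> z)\<^sup>2 \<partial>std_normal_pair)
     - 2 * (\<Sum>k\<le>m. ?c k * (\<integral>z. mehler_kernel \<rho> z * ?e k z \<partial>std_normal_pair))
     + (\<Sum>j\<le>m. \<Sum>k\<le>m. ?c j * ?c k * (\<integral>z. ?e j z * ?e k z \<partial>std_normal_pair))"
    unfolding mehler_remainder_def by (rule L2(2))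
  also have "\<dots> = 1 / (1 - \<rho>\<^sup>2) - 2 * (\<Sum>k\<le>m. \<rho>\<^sup>2 ^ k) + (\<Sum>k\<le>m. \<rho>\<^sup>2 ^ k)"
    unfolding iKe iee mehler_kernel_L2(2)[OF rho_less_1]
    by (simp add: sum.delta if_distrib power2_eq_square power_mult_distrib cong: if_cong)
  also have "\<dots> = 1 / (1 - \<rho>\<^sup>2) - (1 - \<rho>\<^sup>2 ^ Suc m) / (1 - \<rho>\<^sup>2)"
    using rho_sq_less_1 by (simp add: sum_gp0)
  also have "\<dots> = \<rho>\<^sup>2 ^ Suc m / (1 - \<rho>\<^sup>2)"
    by (simp add: diff_divide_distrib)
  finally show "(\<integral>z. (mehler_remainder m z)\<^sup>2 \<partial>std_normal_pair) = \<rho>\<^sup>2 ^ Suc m / (1 - \<rho>\<^sup>2)" .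
qed

text \<open>The subtracted Hermite products integrate to 0 against the tensor square of f, so the
  kernel may be replaced by its remainder; then Cauchy-Schwarz applies, the tensor square having
  norm equal to the squared norm of f.\<close>

lemma covariance_bound_orthogonal:
  fixes f :: "real \<Rightarrow> real"
  assumes [measurable]: "f \<in> borel_measurable borel"
    and f2: "integrable std_normal_distribution (\<lambda>x. (f x)\<^sup>2)"
    and orth: "\<And>k. k \<le> m \<Longrightarrow> (\<integral>x. f x * hermite k x \<partial>std_normal_distribution) = 0"
  shows "\<bar>expectation (\<lambda>\<omega>. f (X \<omega>) * f (Y \<omega>))\<bar> \<le>
    \<bar>\<rho>\<bar> ^ Suc m / sqrt (1 - \<rho>\<^sup>2) * (\<integral>x. (f x)\<^sup>2 \<partial>std_normal_distribution)"
proof -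
  let ?ff = "\<lambda>z. f (fst z) * f (snd z)"
  let ?e = "\<lambda>k z. hermite k (fst z) * hermite k (snd z)"
  have fh: "integrable std_normal_distribution (\<lambda>x. f x * hermite k x)" for k
    using f2 std_normal_integrable_hermite_mult[of k k]
    by (intro integrable_mult_L2) (auto simp: power2_eq_square)
  have ff2: "integrable std_normal_pair (\<lambda>z. (?ff z)\<^sup>2)"
    and iff2: "(\<integral>z. (?ff z)\<^sup>2 \<partial>std_normal_pair) = (\<integral>x. (f x)\<^sup>2 \<partial>std_normal_distribution)\<^sup>2"
    unfolding power_mult_distrib std_normal_pair_tensor(2)[OF f2 f2]
    by (rule std_normal_pair_tensor(1)[OF f2 f2], rule power2_eq_square[symmetric])
  have e: "(\<lambda>z. ?e k z * ?ff z) = (\<lambda>z. (f (fst z) * hermite k (fst z)) * (f (snd z) * hermite k (snd z)))" for k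
    by (auto simp: mult_ac)
  have eff: "integrable std_normal_pair (\<lambda>z. ?e k z * ?ff z)" for k
    unfolding e by (rule std_normal_pair_tensor(1)[OF fh fh])
  have ieff: "(\<integral>z. ?e k z * ?ff z \<partial>std_normal_pair) = 0" if "k \<le> m" for k
    unfolding e by (simp add: std_normal_pair_tensor(2)[OF fh fh] orth[OF that])
  have rff: "integrable std_normal_pair (\<lambda>z. mehler_remainder m z * ?ff z)"
    using mehler_remainder_L2(1) ff2 by (intro integrable_mult_L2) auto
  have "expectation (\<lambda>\<omega>. f (X \<omega>) * f (Y \<omega>)) = (\<integral>z. mehler_kernel \<rho> z * ?ff z \<partial>std_normal_pair)"
    using expectation_XY[of ?ff] by simp
  also have "\<dots> = (\<integral>z. mehler_remainder m z * ?ff z +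
      (\<Sum>k\<le>m. \<rho> ^ k / fact k * (?e k z * ?ff z)) \<partial>std_normal_pair)"
    unfolding mehler_remainder_def by (simp add: algebra_simps sum_distrib_left)
  also have "\<dots> = (\<integral>z. mehler_remainder m z * ?ff z \<partial>std_normal_pair) +
      (\<Sum>k\<le>m. \<rho> ^ k / fact k * (\<integral>z. ?e k z * ?ff z \<partial>std_normal_pair))"
  proof -
    define c where "c k = \<rho> ^ k / fact k" for k
    show ?thesis
      unfolding c_def[symmetric] using rff eff by (simp add: Bochner_Integration.integral_sum)
  qed
  finally have "\<bar>expectation (\<lambda>\<omega>. f (X \<omega>) * f (Y \<omega>))\<bar> = \<bar>\<integral>z. mehler_remainder m z * ?ff z \<partial>std_normal_pair\<bar>"
    by (simp add: ieff)
  also have "\<dots> \<le> sqrt (\<integral>z. (mehler_remainder m z)\<^sup>2 \<partial>std_normal_pair) * sqrt (\<integral>z. (?ff z)\<^sup>2 \<partial>std_normal_pair)"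
    using mehler_remainder_L2(1) ff2 by (intro integral_cauchy_schwarz) auto
  also have "sqrt (\<integral>z. (?ff z)\<^sup>2 \<partial>std_normal_pair) = (\<integral>x. (f x)\<^sup>2 \<partial>std_normal_distribution)"
    unfolding iff2 by simp
  also have "sqrt (\<integral>z. (mehler_remainder m z)\<^sup>2 \<partial>std_normal_pair) = \<bar>\<rho>\<bar> ^ Suc m / sqrt (1 - \<rho>\<^sup>2)"
    unfolding mehler_remainder_L2(2) real_sqrt_divide real_sqrt_power[of "\<rho>\<^sup>2"] real_sqrt_abs ..
  finally show ?thesis .
qed

end

section \<open>Stationary Gaussian sequences\<close>

context prob_space
begin

lemma normal_rv_integrable:
  assumes "normal_rv M W"
  shows "integrable M W" "integrable M (\<lambda>\<omega>. (W \<omega>)\<^sup>2)"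
proof -
  have [measurable]: "W \<in> borel_measurable M" using assms by (simp add: normal_rv_def)
  consider (density) \<mu> \<sigma> where "0 < \<sigma>" "distributed M lborel W (normal_density \<mu> \<sigma>)"
    | (const) \<mu> where "AE \<omega> in M. W \<omega> = \<mu>"
    using assms unfolding normal_rv_def by blast
  then have "integrable M W \<and> integrable M (\<lambda>\<omega>. (W \<omega>)\<^sup>2)"
  proof cases
    case density
    have W: "integrable M W"
      using distributed_integrable[OF density(2), of "\<lambda>x. x"] integrable_normal_moment_nz_1[OF density(1)] by simp
    moreover have "integrable M (\<lambda>\<omega>. (W \<omega> - \<mu>)\<^sup>2)"
      using distributed_integrable[OF density(2), of "\<lambda>x. (x - \<mu>)\<^sup>2"] integrable_normal_moment[OF density(1), of \<mu> 2] by simp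
    ultimately have "integrable M (\<lambda>\<omega>. (W \<omega> - \<mu>)\<^sup>2 + 2 * \<mu> * W \<omega> - \<mu>\<^sup>2)" by simp
    also have "(\<lambda>\<omega>. (W \<omega> - \<mu>)\<^sup>2 + 2 * \<mu> * W \<omega> - \<mu>\<^sup>2) = (\<lambda>\<omega>. (W \<omega>)\<^sup>2)"
      by (auto simp: power2_eq_square algebra_simps)
    finally show ?thesis using W by simp
  next
    case const
    have "integrable M W \<longleftrightarrow> integrable M (\<lambda>_. \<mu>)"
      using const by (intro integrable_cong_AE) auto
    moreover have "integrable M (\<lambda>\<omega>. (W \<omega>)\<^sup>2) \<longleftrightarrow> integrable M (\<lambda>_. \<mu>\<^sup>2)"
      using const by (intro integrable_cong_AE) auto
    ultimately show ?thesis by simp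
  qed
  then show "integrable M W" "integrable M (\<lambda>\<omega>. (W \<omega>)\<^sup>2)" by auto
qed

lemma centred_normal_rv_cases:
  assumes "normal_rv M W" "expectation W = 0" "expectation (\<lambda>\<omega>. (W \<omega>)\<^sup>2) = v"
  obtains (density) "0 < v" "distr M borel (\<lambda>\<omega>. W \<omega> / sqrt v) = std_normal_distribution"
    | (const) "v = 0" "AE \<omega> in M. W \<omega> = 0"
proof -
  have [measurable]: "W \<in> borel_measurable M" using assms by (simp add: normal_rv_def)
  consider (density) \<mu> \<sigma> where "0 < \<sigma>" "distributed M lborel W (normal_density \<mu> \<sigma>)"
    | (const) \<mu> where "AE \<omega> in M. W \<omega> = \<mu>"
    using assms unfolding normal_rv_def by blast
  then show ?thesis
  proof cases
    case density
    have mu: "\<mu> = 0" using normal_distributed_expectation[OF density] assms by simp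
    have "variance W = \<sigma>\<^sup>2" by (rule normal_distributed_variance[OF density])
    then have v: "v = \<sigma>\<^sup>2" using assms by simp
    have "distributed M lborel (\<lambda>\<omega>. (W \<omega> - \<mu>) / \<sigma>) std_normal_density"
      using density normal_standard_normal_convert[OF density(1)] by simp
    then have "distr M lborel (\<lambda>\<omega>. W \<omega> / \<sigma>) = std_normal_distribution"
      unfolding mu by (simp add: distributed_distr_eq_density)
    moreover have "distr M lborel (\<lambda>\<omega>. W \<omega> / \<sigma>) = distr M borel (\<lambda>\<omega>. W \<omega> / \<sigma>)"
      by (intro distr_cong) auto
    moreover have "\<sigma> = sqrt v" "0 < v" using v density by auto
    ultimately show ?thesis using that(1) by simp
  next
    case const
    have "expectation W = expectation (\<lambda>_. \<mu>)" using const by (intro integral_cong_AE) auto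
    then have mu: "\<mu> = 0" using assms by (simp add: prob_space)
    have "expectation (\<lambda>\<omega>. (W \<omega>)\<^sup>2) = expectation (\<lambda>_. 0)"
      using const mu by (intro integral_cong_AE) auto
    then show ?thesis using that(2) assms const mu by simp
  qed
qed

text \<open>The degenerate case fits the same formula with v = 0, so linear combinations of two
  process values can be treated without asking whether they degenerate.\<close>

lemma centred_normal_rv_char:
  assumes "normal_rv M W" "expectation W = 0" "expectation (\<lambda>\<omega>. (W \<omega>)\<^sup>2) = v"
  shows "(CLINT \<omega>|M. iexp (W \<omega>)) = complex_of_real (exp (- v / 2))"
proof -
  have [measurable]: "W \<in> borel_measurable M" using assms by (simp add: normal_rv_def)
  from assms show ?thesis
  proof (cases rule: centred_normal_rv_cases)
    case density
    have "(CLINT \<omega>|M. iexp (W \<omega>)) = (CLINT \<omega>|M. iexp (sqrt v * (W \<omega> / sqrt v)))"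
      using density by simp
    also have "\<dots> = char (distr M borel (\<lambda>\<omega>. W \<omega> / sqrt v)) (sqrt v)"
      unfolding char_def by (subst integral_distr) auto
    also have "\<dots> = complex_of_real (exp (- v / 2))"
      using density by (simp add: char_std_normal_distribution)
    finally show ?thesis .
  next
    case const
    have "(CLINT \<omega>|M. iexp (W \<omega>)) = (CLINT \<omega>|M. 1)"
      using const by (intro integral_cong_AE) auto
    then show ?thesis using const by (simp add: prob_space)
  qed
qed

end

abbreviation lag :: "nat \<Rightarrow> nat \<Rightarrow> nat" where
  "lag i j \<equiv> nat \<bar>int i - int j\<bar>"

locale stationary_gaussian = prob_space M for M :: "'a measure" +
  fixes X :: "nat \<Rightarrow> 'a \<Rightarrow> real" and r :: "nat \<Rightarrow> real"
  assumes gaussian: "gaussian_process M X"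
    and mean_0: "\<And>j. 1 \<le> j \<Longrightarrow> expectation (X j) = 0"
    and covariance: "\<And>i j. 1 \<le> i \<Longrightarrow> 1 \<le> j \<Longrightarrow> expectation (\<lambda>\<omega>. X i \<omega> * X j \<omega>) = r (lag i j)"
    and r_0: "r 0 = 1"
begin

lemma normal_X: "1 \<le> j \<Longrightarrow> normal_rv M (X j)"
  using gaussian[unfolded gaussian_process_def, rule_format, of "{j}" "\<lambda>_. 1"] by simp

lemma X_measurable [measurable]: "1 \<le> j \<Longrightarrow> X j \<in> borel_measurable M"
  using normal_X[of j] by (simp add: normal_rv_def)

lemma law_X:
  assumes "1 \<le> j"
  shows "distr M borel (X j) = std_normal_distribution"
proof -
  have "expectation (\<lambda>\<omega>. (X j \<omega>)\<^sup>2) = 1"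
    using covariance[of j j] assms r_0 by (simp add: power2_eq_square)
  from normal_X[OF assms] mean_0[OF assms] this show ?thesis
    by (cases rule: centred_normal_rv_cases) auto
qed

lemma std_normal_correlated_X:
  assumes ij: "1 \<le> i" "1 \<le> j" "i \<noteq> j" and r: "\<bar>r (lag i j)\<bar> < 1"
  shows "std_normal_correlated M (X i) (X j) (r (lag i j))"
proof
  fix a b
  have sq: "expectation (\<lambda>\<omega>. (X k \<omega>)\<^sup>2) = 1" if "1 \<le> k" for k
    using covariance[of k k] that r_0 by (simp add: power2_eq_square)
  have int: "integrable M (X k)" "integrable M (\<lambda>\<omega>. (X k \<omega>)\<^sup>2)" if "1 \<le> k" for k
    using normal_rv_integrable[OF normal_X[OF that]] by auto
  have int2: "integrable M (\<lambda>\<omega>. X i \<omega> * X j \<omega>)"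
    using ij int by (intro integrable_mult_L2) auto
  have "normal_rv M (\<lambda>\<omega>. \<Sum>k\<in>{i, j}. (if k = i then a else b) * X k \<omega>)"
    using gaussian[unfolded gaussian_process_def, rule_format, of "{i, j}" "\<lambda>k. if k = i then a else b"] ij by simp
  then have n: "normal_rv M (\<lambda>\<omega>. a * X i \<omega> + b * X j \<omega>)"
    using ij by simp
  have m: "expectation (\<lambda>\<omega>. a * X i \<omega> + b * X j \<omega>) = 0"
    using ij int mean_0 by simp
  have "expectation (\<lambda>\<omega>. (a * X i \<omega> + b * X j \<omega>)\<^sup>2) =
      expectation (\<lambda>\<omega>. a\<^sup>2 * (X i \<omega>)\<^sup>2 + (2 * a * b) * (X i \<omega> * X j \<omega>) + b\<^sup>2 * (X j \<omega>)\<^sup>2)"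
    by (simp add: power2_eq_square algebra_simps)
  also have "\<dots> = a\<^sup>2 + 2 * a * b * r (lag i j) + b\<^sup>2"
    using ij int int2 sq covariance by simp
  finally show "(CLINT \<omega>|M. iexp (a * X i \<omega> + b * X j \<omega>)) =
      complex_of_real (exp (- (a\<^sup>2 + 2 * a * b * r (lag i j) + b\<^sup>2) / 2))"
    by (rule centred_normal_rv_char[OF n m])
qed (use assms law_X in auto)

lemma
  fixes f :: "real \<Rightarrow> real"
  assumes f: "integrable std_normal_distribution f" and j: "1 \<le> j"
  shows integrable_fX: "integrable M (\<lambda>\<omega>. f (X j \<omega>))"
    and expectation_fX: "expectation (\<lambda>\<omega>. f (X j \<omega>)) = (\<integral>x. f x \<partial>std_normal_distribution)"
proof -
  have [measurable]: "f \<in> borel_measurable borel" using borel_measurable_integrable[OF f] by simp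
  show "integrable M (\<lambda>\<omega>. f (X j \<omega>))"
    using f unfolding law_X[OF j, symmetric] by (subst (asm) integrable_distr_eq) (use j in auto)
  show "expectation (\<lambda>\<omega>. f (X j \<omega>)) = (\<integral>x. f x \<partial>std_normal_distribution)"
    unfolding law_X[OF j, symmetric] by (subst integral_distr) (use j in auto)
qed

lemma integrable_fX_mult:
  fixes f :: "real \<Rightarrow> real"
  assumes [measurable]: "f \<in> borel_measurable borel"
    and "integrable std_normal_distribution (\<lambda>x. (f x)\<^sup>2)" "1 \<le> i" "1 \<le> j"
  shows "integrable M (\<lambda>\<omega>. f (X i \<omega>) * f (X j \<omega>))"
  using assms integrable_fX[of "\<lambda>x. (f x)\<^sup>2"] by (intro integrable_mult_L2) auto

lemma covariance_fX_le:
  fixes f :: "real \<Rightarrow> real"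
  assumes [measurable]: "f \<in> borel_measurable borel"
    and f2: "integrable std_normal_distribution (\<lambda>x. (f x)\<^sup>2)" and ij: "1 \<le> i" "1 \<le> j"
  shows "\<bar>expectation (\<lambda>\<omega>. f (X i \<omega>) * f (X j \<omega>))\<bar> \<le> (\<integral>x. (f x)\<^sup>2 \<partial>std_normal_distribution)"
proof -
  have "\<bar>expectation (\<lambda>\<omega>. f (X i \<omega>) * f (X j \<omega>))\<bar> \<le>
      sqrt (expectation (\<lambda>\<omega>. (f (X i \<omega>))\<^sup>2)) * sqrt (expectation (\<lambda>\<omega>. (f (X j \<omega>))\<^sup>2))"
    using ij integrable_fX[OF f2] by (intro integral_cauchy_schwarz) auto
  also have "\<dots> = (\<integral>x. (f x)\<^sup>2 \<partial>std_normal_distribution)"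
    using ij expectation_fX[OF f2] by simp
  finally show ?thesis .
qed

text \<open>The factor 2 removes the singularity of 1 / sqrt (1 - \<rho>^2): for correlations up to
  1/2 that factor is at most 2, and for larger ones, including modulus 1 and i = j, the quantity (2
  |r|)^(m+1) is at least 1 and plain Cauchy-Schwarz is enough.\<close>

lemma covariance_bound:
  fixes f :: "real \<Rightarrow> real"
  assumes f[measurable]: "f \<in> borel_measurable borel"
    and f2: "integrable std_normal_distribution (\<lambda>x. (f x)\<^sup>2)"
    and orth: "\<And>k. k \<le> m \<Longrightarrow> (\<integral>x. f x * hermite k x \<partial>std_normal_distribution) = 0"
    and ij: "1 \<le> i" "1 \<le> j"
  shows "\<bar>expectation (\<lambda>\<omega>. f (X i \<omega>) * f (X j \<omega>))\<bar> \<le>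
    2 ^ Suc m * \<bar>r (lag i j)\<bar> ^ Suc m * (\<integral>x. (f x)\<^sup>2 \<partial>std_normal_distribution)"
proof (cases "\<bar>r (lag i j)\<bar> \<le> 1 / 2")
  case True
  have "i \<noteq> j" using True r_0 by auto
  then interpret std_normal_correlated M "X i" "X j" "r (lag i j)"
    using True ij by (intro std_normal_correlated_X) auto
  have "(r (lag i j))\<^sup>2 \<le> (1 / 2)\<^sup>2"
    using True by (intro abs_le_square_iff[THEN iffD1]) auto
  then have half: "1 / 2 \<le> sqrt (1 - (r (lag i j))\<^sup>2)"
    by (intro real_le_rsqrt) (simp add: power2_eq_square)
  then have "0 < sqrt (1 - (r (lag i j))\<^sup>2)" by linarith
  with half have "\<bar>r (lag i j)\<bar> ^ Suc m / sqrt (1 - (r (lag i j))\<^sup>2) \<le> \<bar>r (lag i j)\<bar> ^ Suc m / (1 / 2)"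
    by (intro divide_left_mono) auto
  also have "\<dots> \<le> 2 ^ Suc m * \<bar>r (lag i j)\<bar> ^ Suc m"
  proof -
    have "(2::real) ^ 1 \<le> 2 ^ Suc m" by (intro power_increasing) auto
    then have "2 ^ 1 * \<bar>r (lag i j)\<bar> ^ Suc m \<le> 2 ^ Suc m * \<bar>r (lag i j)\<bar> ^ Suc m"
      by (intro mult_right_mono) auto
    then show ?thesis by simp
  qed
  finally have "\<bar>r (lag i j)\<bar> ^ Suc m / sqrt (1 - (r (lag i j))\<^sup>2) * (\<integral>x. (f x)\<^sup>2 \<partial>std_normal_distribution) \<le>
      2 ^ Suc m * \<bar>r (lag i j)\<bar> ^ Suc m * (\<integral>x. (f x)\<^sup>2 \<partial>std_normal_distribution)"
    by (intro mult_right_mono) auto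
  with covariance_bound_orthogonal[OF f f2 orth] show ?thesis by (rule order_trans)
next
  case False
  have "1 \<le> (2 * \<bar>r (lag i j)\<bar>) ^ Suc m"
    using False by (intro one_le_power) simp
  then have "1 * (\<integral>x. (f x)\<^sup>2 \<partial>std_normal_distribution) \<le>
      2 ^ Suc m * \<bar>r (lag i j)\<bar> ^ Suc m * (\<integral>x. (f x)\<^sup>2 \<partial>std_normal_distribution)"
    unfolding power_mult_distrib by (intro mult_right_mono) auto
  with covariance_fX_le[OF f f2 ij] show ?thesis by simp
qed

lemma hermite_covariance_X:
  assumes "1 \<le> i" "1 \<le> j" "i \<noteq> j" "\<bar>r (lag i j)\<bar> < 1"
  shows "expectation (\<lambda>\<omega>. hermite m (X i \<omega>) * hermite m (X j \<omega>)) = fact m * r (lag i j) ^ m"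
proof -
  interpret std_normal_correlated M "X i" "X j" "r (lag i j)"
    using assms by (intro std_normal_correlated_X)
  show ?thesis by (simp add: hermite_covariance)
qed

text \<open>A crude Cauchy-Schwarz bound for the small lags, where the sign of r^m is unknown and
  |r| may be 1.\<close>

lemma hermite_covariance_X_ge:
  assumes "1 \<le> i" "1 \<le> j"
  shows "- fact m \<le> expectation (\<lambda>\<omega>. hermite m (X i \<omega>) * hermite m (X j \<omega>))"
proof -
  have "integrable std_normal_distribution (\<lambda>x. (hermite m x)\<^sup>2)"
    using std_normal_integrable_hermite_mult[of m m] by (simp add: power2_eq_square)
  from covariance_fX_le[OF _ this assms] have
    "\<bar>expectation (\<lambda>\<omega>. hermite m (X i \<omega>) * hermite m (X j \<omega>))\<bar> \<le> fact m"
    using hermite_orthogonal[of m m] by (simp add: power2_eq_square)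
  then show ?thesis by linarith
qed

end

section \<open>Slow variation\<close>

text \<open>Karamata's uniform convergence theorem in additive form, by the measure-theoretic argument:
  two sets of shifts of measure greater than \<open>3/2\<close> inside \<open>{0..3}\<close> must intersect.\<close>

lemma additive_uniform_convergence:
  fixes f :: "real \<Rightarrow> real"
  assumes [measurable]: "f \<in> borel_measurable borel"
    and lim: "\<And>u. ((\<lambda>t. f (t + u) - f t) \<longlongrightarrow> 0) at_top" and "0 < \<epsilon>"
  obtains T where "\<And>t u. T \<le> t \<Longrightarrow> 0 \<le> u \<Longrightarrow> u \<le> 1 \<Longrightarrow> \<bar>f (t + u) - f t\<bar> < \<epsilon>"
proof (rule ccontr)
  assume "\<not> thesis"
  then have "\<forall>T. \<exists>t u. T \<le> t \<and> 0 \<le> u \<and> u \<le> 1 \<and> \<epsilon> \<le> \<bar>f (t + u) - f t\<bar>"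
    using that by (metis not_less)
  then have "\<forall>n::nat. \<exists>p. real n \<le> fst p \<and> 0 \<le> snd p \<and> snd p \<le> 1 \<and> \<epsilon> \<le> \<bar>f (fst p + snd p) - f (fst p)\<bar>"
    by (metis fst_conv snd_conv)
  then obtain p where p: "\<forall>n::nat. real n \<le> fst (p n) \<and> 0 \<le> snd (p n) \<and> snd (p n) \<le> 1 \<and>
      \<epsilon> \<le> \<bar>f (fst (p n) + snd (p n)) - f (fst (p n))\<bar>"
    by (rule choice[THEN exE])
  define x u where "x = (\<lambda>n. fst (p n))" and "u = (\<lambda>n. snd (p n))"
  have xu: "\<And>n::nat. real n \<le> x n" "\<And>n. 0 \<le> u n" "\<And>n. u n \<le> 1"
    "\<And>n. \<epsilon> \<le> \<bar>f (x n + u n) - f (x n)\<bar>"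
    using p by (auto simp: x_def u_def)
  have x_top: "filterlim x at_top sequentially"
    by (rule filterlim_at_top_mono[OF filterlim_real_sequentially]) (use xu in auto)
  have y_top: "filterlim (\<lambda>n. x n + u n) at_top sequentially"
    by (rule filterlim_at_top_mono[OF filterlim_real_sequentially], rule always_eventually)
      (use xu(1,2) in \<open>auto intro: add_increasing2\<close>)
  \<comment> \<open>The shifts in [0, 2] that are good for y from index n on. By pointwise
    convergence these sets increase to the whole interval, so their measure tends to 2.\<close>
  define V where "V y n = {v \<in> {0..2}. \<forall>k\<ge>n. \<bar>f (y k + v) - f (y k)\<bar> < \<epsilon> / 2}" for y :: "nat \<Rightarrow> real" and n
  have [measurable]: "V y n \<in> sets borel" for y n
    unfolding V_def by measurable
  have V_large: "eventually (\<lambda>n. 3 / 2 < measure lborel (V y n)) sequentially"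
    if y: "filterlim y at_top sequentially" for y
  proof -
    have inc: "incseq (V y)" by (auto simp: V_def incseq_def)
    have "v \<in> (\<Union>n. V y n)" if v: "v \<in> {0..2}" for v
    proof -
      have "((\<lambda>n. f (y n + v) - f (y n)) \<longlongrightarrow> 0) sequentially"
        using filterlim_compose[OF lim[of v] y] .
      then have "eventually (\<lambda>n. \<bar>f (y n + v) - f (y n)\<bar> < \<epsilon> / 2) sequentially"
        using \<open>0 < \<epsilon>\<close> unfolding tendsto_iff by (auto dest: spec[of _ "\<epsilon> / 2"] simp: dist_real_def)
      then show ?thesis
        using v by (auto simp: V_def eventually_sequentially)
    qed
    then have un: "(\<Union>n. V y n) = {0..2}" by (auto simp: V_def)
    have "(\<lambda>n. measure lborel (V y n)) \<longlonglongrightarrow> measure lborel (\<Union>n. V y n)"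
      by (rule Lim_measure_incseq) (auto simp: inc un)
    then have "(\<lambda>n. measure lborel (V y n)) \<longlonglongrightarrow> 2" by (simp add: un)
    then show ?thesis by (rule order_tendstoD) simp
  qed
  have "eventually (\<lambda>n. 3 / 2 < measure lborel (V x n) \<and> 3 / 2 < measure lborel (V (\<lambda>n. x n + u n) n)) sequentially"
    using V_large[OF x_top] V_large[OF y_top] by eventually_elim auto
  then obtain n where n: "3 / 2 < measure lborel (V x n)" "3 / 2 < measure lborel (V (\<lambda>n. x n + u n) n)"
    by (auto simp: eventually_sequentially)
  \<comment> \<open>Translating the second set by \<open>u n\<close> makes both sets refer to the
    same point: a common v puts f (x n + v) within \<epsilon> / 2 of both f (x n) and f (x n + u n),
    against the choice of u. Since \<open>u n\<close> is at most 1, both sets stay in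
    [0, 3].\<close>
  define A B where "A = V x n" and "B = {z. z - u n \<in> V (\<lambda>n. x n + u n) n}"
  have [measurable]: "A \<in> sets borel" "B \<in> sets borel" unfolding A_def B_def by measurable
  have "measure lborel B = measure (distr lborel borel ((+) (u n))) B"
    by (simp add: lborel_distr_plus)
  also have "\<dots> = measure lborel (V (\<lambda>n. x n + u n) n)"
    by (subst measure_distr) (auto simp: B_def vimage_def)
  finally have B: "3 / 2 < measure lborel B" using n by simp
  have sub: "A \<union> B \<subseteq> {0..3}"
    using xu(2,3)[of n] by (auto simp: A_def B_def V_def)
  have fin: "emeasure lborel S \<noteq> \<infinity>" if "S \<subseteq> {0..3}" "S \<in> sets borel" for S :: "real set"
    using emeasure_mono[OF that(1), of lborel] by (auto simp: top_unique)
  have "A \<inter> B \<noteq> {}"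
  proof
    assume "A \<inter> B = {}"
    then have "measure lborel (A \<union> B) = measure lborel A + measure lborel B"
      using sub fin by (intro measure_Union) auto
    moreover have "measure lborel (A \<union> B) \<le> measure lborel {0..3::real}"
      using sub by (intro measure_mono_fmeasurable) (auto simp: fmeasurable_def)
    ultimately show False using n B by (simp add: A_def)
  qed
  then obtain v where "v \<in> A" "v \<in> B" by auto
  then have "\<bar>f (x n + v) - f (x n)\<bar> < \<epsilon> / 2" "\<bar>f (x n + u n + (v - u n)) - f (x n + u n)\<bar> < \<epsilon> / 2"
    unfolding A_def B_def V_def by blast+
  then show False using xu(4)[of n] by (simp add: abs_if split: if_splits)
qed

text \<open>Beyond some T every step of length at most 1 changes f by less than \<epsilon> / 2, so
  telescoping gives growth of slope \<epsilon> / 2 plus a constant; the other half of \<epsilon>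
  absorbs the constant for large t.\<close>

lemma additive_growth:
  fixes f :: "real \<Rightarrow> real"
  assumes "f \<in> borel_measurable borel"
    and "\<And>u. ((\<lambda>t. f (t + u) - f t) \<longlongrightarrow> 0) at_top" and "0 < \<epsilon>"
  shows "eventually (\<lambda>t. \<bar>f t\<bar> \<le> \<epsilon> * t) at_top"
proof -
  obtain T where T: "\<And>t u. T \<le> t \<Longrightarrow> 0 \<le> u \<Longrightarrow> u \<le> 1 \<Longrightarrow> \<bar>f (t + u) - f t\<bar> < \<epsilon> / 2"
    using additive_uniform_convergence[OF assms(1,2), of "\<epsilon> / 2"] assms(3) by auto
  have step: "\<bar>f (t + real n) - f t\<bar> \<le> real n * (\<epsilon> / 2)" if "T \<le> t" for t n
  proof (induction n)
    case (Suc n)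
    have "\<bar>f (t + real n + 1) - f (t + real n)\<bar> < \<epsilon> / 2"
      using that by (intro T) auto
    moreover have "t + real (Suc n) = t + real n + 1" by simp
    moreover have "real (Suc n) * (\<epsilon> / 2) = real n * (\<epsilon> / 2) + \<epsilon> / 2" by (simp add: field_simps)
    ultimately show ?case using Suc by (simp only:)
  qed simp
  have bound: "\<bar>f t\<bar> \<le> \<bar>f T\<bar> + \<epsilon> / 2 + (\<epsilon> / 2) * (t - T)" if "T \<le> t" for t
  proof -
    define n where "n = nat \<lfloor>t - T\<rfloor>"
    have n: "real n \<le> t - T" "t - T - real n \<le> 1"
      using that by (auto simp: n_def) linarith
    have "\<bar>f (T + (t - T - real n)) - f T\<bar> < \<epsilon> / 2"
      using n by (intro T) auto
    moreover have "\<bar>f (T + (t - T - real n) + real n) - f (T + (t - T - real n))\<bar> \<le> real n * (\<epsilon> / 2)"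
      using n by (intro step) auto
    moreover have "real n * (\<epsilon> / 2) \<le> (t - T) * (\<epsilon> / 2)"
      using n assms(3) by (intro mult_right_mono) auto
    moreover have "T + (t - T - real n) + real n = t" by simp
    ultimately show ?thesis unfolding mult.commute[of "\<epsilon> / 2"] by (simp only:)
  qed
  \<comment> \<open>Chosen so that (\<epsilon> / 2) * c equals the constant terms to be
    absorbed.\<close>
  define c where "c = 2 * (\<bar>f T\<bar> + \<epsilon> / 2 + (\<epsilon> / 2) * \<bar>T\<bar>) / \<epsilon>"
  have "eventually (\<lambda>t. max T c \<le> t) at_top" by (rule eventually_ge_at_top)
  then show ?thesis
  proof eventually_elim
    case (elim t)
    have "(\<epsilon> / 2) * c \<le> (\<epsilon> / 2) * t" using elim assms(3) by (intro mult_left_mono) auto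
    then have "\<bar>f T\<bar> + \<epsilon> / 2 + (\<epsilon> / 2) * \<bar>T\<bar> \<le> (\<epsilon> / 2) * t"
      using assms(3) by (simp add: c_def)
    moreover have "- ((\<epsilon> / 2) * T) \<le> (\<epsilon> / 2) * \<bar>T\<bar>"
    proof -
      have "(\<epsilon> / 2) * (- T) \<le> (\<epsilon> / 2) * \<bar>T\<bar>" using assms(3) by (intro mult_left_mono) auto
      then show ?thesis by simp
    qed
    moreover have "\<bar>f t\<bar> \<le> \<bar>f T\<bar> + \<epsilon> / 2 + ((\<epsilon> / 2) * t - (\<epsilon> / 2) * T)"
      using bound[of t] elim by (simp add: right_diff_distrib)
    moreover have "\<epsilon> * t = (\<epsilon> / 2) * t + (\<epsilon> / 2) * t" by simp
    ultimately show ?case by linarith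
  qed
qed

text \<open>In the coordinate t = ln x slow variation is the additive condition on t \<mapsto> ln (L
  (exp t)), and sublinear growth of this function exponentiates to both inequalities.\<close>

lemma slowly_varying_potter:
  assumes "slowly_varying L" "0 < \<eta>"
  shows "eventually (\<lambda>x. x powr (- \<eta>) \<le> L x \<and> L x \<le> x powr \<eta>) at_top"
proof -
  obtain a where pos: "\<And>x. a \<le> x \<Longrightarrow> 0 < L x" and meas: "L \<in> borel_measurable (restrict_space borel {a..})"
    and lim: "\<And>c. 0 < c \<Longrightarrow> ((\<lambda>x. L (c * x) / L x) \<longlongrightarrow> 1) at_top"
    using assms(1) unfolding slowly_varying_def by blast
  \<comment> \<open>L is controlled only on a half-line; the value 1 below it gives a measurable
    function on the whole line with the same behaviour at infinity.\<close>
  define L' where "L' = (\<lambda>x. if x \<in> {a..} then L x else 1)"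
  have L'[measurable]: "L' \<in> borel_measurable borel"
    unfolding L'_def using meas by (intro measurable_If_restrict_space_iff[THEN iffD2]) (auto simp: measurable_If_restrict_space_iff atLeast_def)
  define f where "f = (\<lambda>t. ln (L' (exp t)))"
  have f_meas: "f \<in> borel_measurable borel" unfolding f_def by measurable
  have f_eq: "f t = ln (L (exp t))" if "a \<le> exp t" for t using that by (simp add: f_def L'_def)
  have "((\<lambda>t. f (t + u) - f t) \<longlongrightarrow> 0) at_top" for u
  proof -
    have "((\<lambda>t. L (exp u * exp t) / L (exp t)) \<longlongrightarrow> 1) at_top"
      using filterlim_compose[OF lim[of "exp u"] exp_at_top] by simp
    then have "((\<lambda>t. ln (L (exp u * exp t) / L (exp t))) \<longlongrightarrow> ln 1) at_top"
      by (intro tendsto_ln) auto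
    moreover have "eventually (\<lambda>t. ln (L (exp u * exp t) / L (exp t)) = f (t + u) - f t) at_top"
    proof -
      have e: "eventually (\<lambda>t. a \<le> exp t) at_top"
        using exp_at_top by (auto simp: filterlim_at_top)
      have "filterlim (\<lambda>t. t + u) at_top at_top"
        by (rule filterlim_tendsto_add_at_top[OF tendsto_const filterlim_ident, of u, simplified add.commute])
      then have "eventually (\<lambda>t. a \<le> exp (t + u)) at_top"
        using e by (rule eventually_compose_filterlim[rotated])
      with e show ?thesis
      proof eventually_elim
        case (elim t)
        have "0 < L (exp (t + u))" "0 < L (exp t)" using elim pos by auto
        then show ?case using elim by (simp add: f_eq exp_add mult.commute ln_div)
      qed
    qed
    ultimately show ?thesis by (simp add: tendsto_cong)
  qed
  then have "eventually (\<lambda>t. \<bar>f t\<bar> \<le> \<eta> * t) at_top"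
    by (intro additive_growth f_meas assms(2))
  then have "eventually (\<lambda>x. \<bar>f (ln x)\<bar> \<le> \<eta> * ln x) at_top"
    by (rule eventually_compose_filterlim[OF _ ln_at_top])
  moreover have "eventually (\<lambda>x. max a 1 \<le> x) at_top" by (rule eventually_ge_at_top)
  ultimately show ?thesis
  proof eventually_elim
    case (elim x)
    then have x: "0 < x" "a \<le> x" by auto
    have "\<bar>ln (L x)\<bar> \<le> \<eta> * ln x" using elim(1) x by (simp add: f_eq)
    then have "- \<eta> * ln x \<le> ln (L x)" "ln (L x) \<le> \<eta> * ln x" by auto
    then have "exp (- \<eta> * ln x) \<le> exp (ln (L x))" "exp (ln (L x)) \<le> exp (\<eta> * ln x)" by auto
    then show ?case using x pos by (simp add: powr_def)
  qed
qed

section \<open>Power sums, sums over lags, and the choice of exponents\<close>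

lemma sum_powr_le:
  fixes s :: real
  assumes "0 < s" "s < 1"
  shows "(\<Sum>k=1..N. real k powr (- s)) \<le> real N powr (1 - s) / (1 - s)"
proof (induction N)
  case (Suc N)
  \<comment> \<open>The mean value theorem bounds each term by an increment of x^(1-s) / (1 - s),
    and the increments telescope.\<close>
  have "(1 - s) * real (Suc N) powr (- s) \<le> real (Suc N) powr (1 - s) - real N powr (1 - s)"
  proof (cases "N = 0")
    case True
    then show ?thesis using assms by simp
  next
    case False
    have "\<exists>z. real N < z \<and> z < real (Suc N) \<and> real (Suc N) powr (1 - s) - real N powr (1 - s) =
        (real (Suc N) - real N) * ((1 - s) * z powr (1 - s - 1))"
      using False by (intro MVT2) (auto intro!: derivative_eq_intros)
    then obtain z where z: "real N < z" "z < real (Suc N)"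
      "real (Suc N) powr (1 - s) - real N powr (1 - s) = (1 - s) * z powr (- s)"
      by auto
    have "real (Suc N) powr (- s) \<le> z powr (- s)"
      using z assms False by (intro powr_mono2') auto
    then show ?thesis using z assms by (simp add: mult_left_mono)
  qed
  then have "real (Suc N) powr (- s) \<le> (real (Suc N) powr (1 - s) - real N powr (1 - s)) / (1 - s)"
    using assms by (simp add: pos_le_divide_eq mult.commute)
  with Suc show ?case by (simp add: diff_divide_distrib)
qed simp

lemma card_lag_eq: "finite T \<Longrightarrow> card {j\<in>T. lag i j = k} \<le> 2"
proof -
  have "{j\<in>T. lag i j = k} \<subseteq> {i + k, i - k}" by auto
  then have "card {j\<in>T. lag i j = k} \<le> card {i + k, i - k}" by (intro card_mono) auto
  also have "\<dots> \<le> 2" by (simp add: card_insert_if)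
  finally show ?thesis .
qed

lemma sum_lag_le:
  fixes g :: "nat \<Rightarrow> real"
  assumes "\<And>k. 0 \<le> g k" "i \<in> {1..N}"
  shows "(\<Sum>j=1..N. g (lag i j)) \<le> 2 * (\<Sum>k\<le>N. g k)"
proof -
  have "(\<Sum>j=1..N. g (lag i j)) = (\<Sum>k\<le>N. \<Sum>j\<in>{j\<in>{1..N}. lag i j = k}. g (lag i j))"
    by (rule sum.group[symmetric]) (use assms in auto)
  also have "\<dots> = (\<Sum>k\<le>N. real (card {j\<in>{1..N}. lag i j = k}) * g k)"
    by (intro sum.cong refl) simp
  also have "\<dots> \<le> (\<Sum>k\<le>N. 2 * g k)"
  proof (intro sum_mono mult_right_mono)
    fix k show "real (card {j \<in> {1..N}. lag i j = k}) \<le> 2"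
      using card_lag_eq[of "{1..N}" i k] by simp
  qed (use assms in auto)
  finally show ?thesis by (simp add: sum_distrib_left)
qed

text \<open>Since m D < min 1 ((m + 1) D), there is room for m D < s' < s below this minimum.
  Staying below (m + 1) D controls |r|^(m+1) by k^(-s), staying below 1 gives the power sum the
  order N^(1-s), and s' > m D bounds r^m from below.\<close>

lemma long_range_bounds:
  fixes r :: "nat \<Rightarrow> real"
  assumes L: "slowly_varying L" and r: "\<And>k. 1 \<le> k \<Longrightarrow> r k = real k powr (- D) * L (real k)"
    and r1: "\<And>k. \<bar>r k\<bar> \<le> 1" and D: "0 < D" "D < 1 / real m" and m: "1 \<le> m"
  obtains s s' C k0 where "0 < s'" "s' < s" "s < 1" "0 < C"
    "\<And>N i. i \<in> {1..N} \<Longrightarrow> (\<Sum>j=1..N. \<bar>r (lag i j)\<bar> ^ Suc m) \<le> C * real N powr (1 - s)"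
    "\<And>k. k0 \<le> k \<Longrightarrow> real k powr (- s') \<le> r k ^ m \<and> \<bar>r k\<bar> < 1" "1 \<le> k0"
proof -
  have mD: "0 < real m * D" "real m * D < 1"
    using D m by (auto simp: field_simps)
  have "real m * D < min 1 (real (Suc m) * D)" using D mD by (simp add: algebra_simps)
  then obtain s where s: "real m * D < s" "s < 1" "s < real (Suc m) * D"
    using dense[of "real m * D" "min 1 (real (Suc m) * D)"] by auto
  obtain s' where s': "real m * D < s'" "s' < s" using dense[OF s(1)] by auto
  have s_pos: "0 < s'" "0 < s" using mD s' by linarith+
  \<comment> \<open>The tolerance granted to L, small enough for (D - \<eta>) (m + 1) \<ge> s and (D
    + \<eta>) m \<le> s'.\<close>
  define \<eta> where "\<eta> = min (D - s / real (Suc m)) (s' / real m - D)"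
  have \<eta>: "0 < \<eta>" "\<eta> \<le> D - s / real (Suc m)" "\<eta> \<le> s' / real m - D"
    using s s' m by (auto simp: \<eta>_def field_simps)
  have "0 < s / real (Suc m)" using s_pos by simp
  then have D\<eta>: "\<eta> < D" using \<eta>(2) by linarith
  obtain x0 where x0: "\<And>x. x0 \<le> x \<Longrightarrow> x powr (- \<eta>) \<le> L x \<and> L x \<le> x powr \<eta>"
    using slowly_varying_potter[OF L \<eta>(1)] by (auto simp: eventually_at_top_linorder)
  \<comment> \<open>The value 2 ensures k > 1, which turns the upper power bound into the strict
    inequality |r k| < 1.\<close>
  define k0 where "k0 = max 2 (nat \<lceil>x0\<rceil>)"
  have k0x: "x0 \<le> real k" if "k0 \<le> k" for k
    using that by (simp add: k0_def)
  have k0: "2 \<le> k0" by (simp add: k0_def)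
  have lower: "real k powr (- (D + \<eta>)) \<le> r k" and upper: "r k \<le> real k powr (- (D - \<eta>))" if "k0 \<le> k" for k
  proof -
    have k: "1 \<le> k" using that k0 by linarith
    have "real k powr (- D) * real k powr (- \<eta>) \<le> r k" "r k \<le> real k powr (- D) * real k powr \<eta>"
      unfolding r[OF k] using x0[OF k0x[OF that]] by (auto intro!: mult_left_mono)
    then show "real k powr (- (D + \<eta>)) \<le> r k" "r k \<le> real k powr (- (D - \<eta>))"
      by (simp_all flip: powr_add)
  qed
  have r_pos: "0 < r k" if "k0 \<le> k" for k
  proof -
    have "0 < real k powr (- (D + \<eta>))" using that k0 by simp
    also have "\<dots> \<le> r k" by (rule lower[OF that])
    finally show ?thesis .
  qed
  have tail: "real k powr (- s') \<le> r k ^ m \<and> \<bar>r k\<bar> < 1" if k: "k0 \<le> k" for k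
  proof
    have k1: "1 < real k" using k k0 by simp
    have "real k powr (- s') \<le> real k powr (- (D + \<eta>) * real m)"
      using k1 \<eta>(3) m by (intro powr_mono) (auto simp: field_simps)
    also have "\<dots> = (real k powr (- (D + \<eta>))) ^ m"
      using k1 by (simp add: powr_powr[symmetric] powr_realpow)
    also have "\<dots> \<le> r k ^ m"
      using lower[OF k] by (intro power_mono) auto
    finally show "real k powr (- s') \<le> r k ^ m" .
    have "r k \<le> real k powr (- (D - \<eta>))" by (rule upper[OF k])
    also have "\<dots> < real k powr 0" using k1 D\<eta> by (intro powr_less_mono) auto
    finally show "\<bar>r k\<bar> < 1" using r_pos[OF k] k1 by simp
  qed
  \<comment> \<open>Pays for the lags below k0, where only |r k| \<le> 1 is known: there 1 \<le> (k0
    / k)^s.\<close>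
  define C0 where "C0 = real k0 powr s"
  have C0: "1 \<le> C0" using k0 s_pos by (simp add: C0_def ge_one_powr_ge_zero)
  have rk: "\<bar>r k\<bar> ^ Suc m \<le> C0 * real k powr (- s)" if k: "1 \<le> k" for k
  proof (cases "k0 \<le> k")
    case True
    have k1: "1 < real k" using True k0 by simp
    have "\<bar>r k\<bar> ^ Suc m \<le> (real k powr (- (D - \<eta>))) ^ Suc m"
      using upper[OF True] r_pos[OF True] by (intro power_mono) auto
    also have "\<dots> = real k powr (- (D - \<eta>) * real (Suc m))"
      using k1 by (simp add: powr_powr[symmetric] powr_realpow del: power_Suc of_nat_Suc)
    also have "\<dots> \<le> real k powr (- s)"
      using k1 \<eta>(2) by (intro powr_mono) (auto simp: field_simps)
    also have "\<dots> \<le> C0 * real k powr (- s)" using C0 by (simp add: mult_le_cancel_right1)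
    finally show ?thesis .
  next
    case False
    have "\<bar>r k\<bar> ^ Suc m \<le> 1" using r1 by (intro power_le_one) auto
    also have "1 = real k powr s * real k powr (- s)" using k by (simp flip: powr_add)
    also have "\<dots> \<le> C0 * real k powr (- s)"
      unfolding C0_def using False k s_pos by (intro mult_right_mono powr_mono2) auto
    finally show ?thesis .
  qed
  \<comment> \<open>The summand 1 stands for lag 0, and the factor 2 for the two indices at a given
    lag from i.\<close>
  define C where "C = 2 * (1 + C0 / (1 - s))"
  have C: "0 < C" using C0 s by (simp add: C_def add_pos_pos)
  have sum: "(\<Sum>j=1..N. \<bar>r (lag i j)\<bar> ^ Suc m) \<le> C * real N powr (1 - s)" if i: "i \<in> {1..N}" for N i
  proof -
    have N: "1 \<le> N" using i by simp
    have "(\<Sum>k\<le>N. \<bar>r k\<bar> ^ Suc m) = \<bar>r 0\<bar> ^ Suc m + (\<Sum>k=1..N. \<bar>r k\<bar> ^ Suc m)"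
      by (simp add: atMost_atLeast0 sum.atLeast_Suc_atMost del: power_Suc)
    also have "\<dots> \<le> 1 + (\<Sum>k=1..N. C0 * real k powr (- s))"
      using r1 by (intro add_mono sum_mono rk power_le_one) auto
    also have "\<dots> \<le> 1 + C0 * (real N powr (1 - s) / (1 - s))"
      unfolding sum_distrib_left[symmetric] using C0 s s_pos by (intro add_left_mono mult_left_mono sum_powr_le) auto
    also have "\<dots> \<le> real N powr (1 - s) + C0 * (real N powr (1 - s) / (1 - s))"
      using N s by (intro add_right_mono ge_one_powr_ge_zero) auto
    also have "\<dots> = (C / 2) * real N powr (1 - s)"
      by (simp add: C_def algebra_simps)
    finally show ?thesis
      using sum_lag_le[of "\<lambda>k. \<bar>r k\<bar> ^ Suc m", OF _ i] by simp
  qed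
  show ?thesis
    by (rule that[of s' s C k0]) (use s s' s_pos C k0 sum tail in auto)
qed

section \<open>Dyadic maximal inequality\<close>

text \<open>Binary expansion of the interval below b: each digit 1 of b, at position k, contributes
  the dyadic block of length 2^k that ends where the higher digits of b place it. As b div 2^k is
  odd there, subtracting 1 never truncates.\<close>

lemma dyadic_digit_sum:
  fixes b c :: nat
  assumes "b < 2 ^ K"
  shows "(of_bool (c < b) :: real) =
    (\<Sum>k<K. of_bool (odd (b div 2 ^ k) \<and> c div 2 ^ k = b div 2 ^ k - 1))"
  using assms
proof (induction K arbitrary: b c)
  case (Suc K)
  \<comment> \<open>Only the last bit of b is split off; the other bits are left to the induction,
    after halving b and c.\<close>
  have "(of_bool (c < b) :: real) = of_bool (odd b \<and> c = b - 1) + of_bool (c div 2 < b div 2)"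
  proof (cases "odd b")
    case True
    then obtain d where "b = 2 * d + 1" by (elim oddE)
    then show ?thesis by auto
  next
    case False
    then have "even b" by simp
    then obtain d where "b = 2 * d" by (elim evenE)
    then show ?thesis by auto
  qed
  also have "(of_bool (c div 2 < b div 2) :: real) =
      (\<Sum>k<K. of_bool (odd (b div 2 div 2 ^ k) \<and> c div 2 div 2 ^ k = b div 2 div 2 ^ k - 1))"
    by (rule Suc.IH) (use Suc.prems in auto)
  finally show ?case
    by (simp add: sum.lessThan_Suc_shift div_mult2_eq del: sum.lessThan_Suc)
qed simp

section \<open>Residuals of indicators and their second moments\<close>

lemma std_normal_hermite_mean: "(\<integral>x. hermite k x \<partial>std_normal_distribution) = (if k = 0 then 1 else 0)"
  using hermite_orthogonal[of 0 k] by simp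

text \<open>When the coefficients of orders 1 to m - 1 vanish, this is the indicator minus its
  projection onto H_0, ..., H_m. As a function of the set it is additive, which is what the dyadic
  splitting exploits.\<close>

definition hermite_residual :: "nat \<Rightarrow> real set \<Rightarrow> real \<Rightarrow> real" where
  "hermite_residual m A x = indicator A x - measure std_normal_distribution A
     - (\<integral>y. indicator A y * hermite m y \<partial>std_normal_distribution) / fact m * hermite m x"

lemma hermite_residual_measurable [measurable]:
  assumes [measurable]: "A \<in> sets borel"
  shows "hermite_residual m A \<in> borel_measurable borel"
  unfolding hermite_residual_def[abs_def] by measurable

lemma integrable_indicator_hermite [simp]:
  assumes [measurable]: "A \<in> sets borel"
  shows "integrable std_normal_distribution (\<lambda>x. indicator A x * hermite k x)"
  by (rule Bochner_Integration.integrable_bound[OF std_normal_integrable_hermite[of k]])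
    (auto split: split_indicator)

lemma hermite_residual_UN:
  assumes "finite I" and "\<And>i. i \<in> I \<Longrightarrow> A i \<in> sets borel" and "B \<in> sets borel"
    and ind: "\<And>x. (indicator B x :: real) = (\<Sum>i\<in>I. indicator (A i) x)"
  shows "hermite_residual m B x = (\<Sum>i\<in>I. hermite_residual m (A i) x)"
proof -
  have "(\<integral>y. indicator B y \<partial>std_normal_distribution) = (\<Sum>i\<in>I. \<integral>y. indicator (A i) y \<partial>std_normal_distribution :: real)"
    unfolding ind using assms by (intro Bochner_Integration.integral_sum) (auto intro!: std_normal.integrable_const_bound[where B = 1])
  then have P: "measure std_normal_distribution B = (\<Sum>i\<in>I. measure std_normal_distribution (A i))"
    by simp
  have "(\<integral>y. indicator B y * hermite m y \<partial>std_normal_distribution) =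
      (\<Sum>i\<in>I. \<integral>y. indicator (A i) y * hermite m y \<partial>std_normal_distribution)"
    unfolding ind sum_distrib_right using assms by (intro Bochner_Integration.integral_sum) auto
  then show ?thesis
    unfolding hermite_residual_def P ind
    by (simp add: sum_subtractf sum_divide_distrib sum_distrib_right)
qed

text \<open>The residual is orthogonal to H_0 and H_m, so its squared norm equals its inner product
  with the indicator, namely P - P^2 - J^2 / m!, which is at most P.\<close>

lemma
  assumes [measurable]: "A \<in> sets borel" and m: "1 \<le> m"
    and rank: "\<And>k. 1 \<le> k \<Longrightarrow> k < m \<Longrightarrow> (\<integral>x. indicator A x * hermite k x \<partial>std_normal_distribution) = 0"
  shows hermite_residual_orthogonal: "\<And>k. k \<le> m \<Longrightarrow>
      (\<integral>x. hermite_residual m A x * hermite k x \<partial>std_normal_distribution) = 0"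
    and integrable_hermite_residual_sq: "integrable std_normal_distribution (\<lambda>x. (hermite_residual m A x)\<^sup>2)"
    and hermite_residual_sq_le: "(\<integral>x. (hermite_residual m A x)\<^sup>2 \<partial>std_normal_distribution) \<le> measure std_normal_distribution A"
proof -
  define J where "J = (\<integral>y. indicator A y * hermite m y \<partial>std_normal_distribution)"
  define P where "P = measure std_normal_distribution A"
  note res = hermite_residual_def[of m A, folded J_def P_def]
  have int_A: "integrable std_normal_distribution (\<lambda>x. indicator A x :: real)"
    by (rule std_normal.integrable_const_bound[where B = 1]) auto
  have rh: "integrable std_normal_distribution (\<lambda>x. hermite_residual m A x * hermite k x)"
    and irh: "(\<integral>x. hermite_residual m A x * hermite k x \<partial>std_normal_distribution) =
      (\<integral>x. indicator A x * hermite k x \<partial>std_normal_distribution) - P * (if k = 0 then 1 else 0)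
        - J / fact m * (if m = k then fact k else 0)" for k
  proof -
    have e: "(\<lambda>x. hermite_residual m A x * hermite k x) =
        (\<lambda>x. indicator A x * hermite k x - P * hermite k x - J / fact m * (hermite m x * hermite k x))"
      unfolding res by (auto simp: algebra_simps)
    show "integrable std_normal_distribution (\<lambda>x. hermite_residual m A x * hermite k x)"
      unfolding e by simp
    show "(\<integral>x. hermite_residual m A x * hermite k x \<partial>std_normal_distribution) =
      (\<integral>x. indicator A x * hermite k x \<partial>std_normal_distribution) - P * (if k = 0 then 1 else 0)
        - J / fact m * (if m = k then fact k else 0)"
      unfolding e hermite_orthogonal[symmetric] std_normal_hermite_mean[symmetric] by simp
  qed
  have AP: "(\<integral>x. indicator A x \<partial>std_normal_distribution) = P" by (simp add: P_def)
  show orth: "(\<integral>x. hermite_residual m A x * hermite k x \<partial>std_normal_distribution) = 0" if km: "k \<le> m" for k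
  proof -
    have "k = 0 \<or> 1 \<le> k \<and> k < m \<or> k = m" using km by linarith
    then consider "k = 0" | "1 \<le> k" "k < m" | "k = m" by blast
    then show ?thesis
    proof cases
      case 1
      then show ?thesis using m AP irh[of 0] by simp
    next
      case 2
      then show ?thesis using rank by (simp add: irh)
    next
      case 3
      then show ?thesis using m by (simp add: irh J_def)
    qed
  qed
  have rA: "integrable std_normal_distribution (\<lambda>x. hermite_residual m A x * indicator A x)"
    and irA: "(\<integral>x. hermite_residual m A x * indicator A x \<partial>std_normal_distribution) = P - P\<^sup>2 - J\<^sup>2 / fact m"
  proof -
    have e: "(\<lambda>x. hermite_residual m A x * indicator A x) =
        (\<lambda>x. (1 - P) * indicator A x - J / fact m * (indicator A x * hermite m x))"
      unfolding res by (auto simp: algebra_simps split: split_indicator)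
    show "integrable std_normal_distribution (\<lambda>x. hermite_residual m A x * indicator A x)"
      unfolding e using int_A by simp
    have "(\<integral>x. hermite_residual m A x * indicator A x \<partial>std_normal_distribution) = (1 - P) * P - J / fact m * J"
      unfolding e using int_A by (simp add: J_def P_def)
    then show "(\<integral>x. hermite_residual m A x * indicator A x \<partial>std_normal_distribution) = P - P\<^sup>2 - J\<^sup>2 / fact m"
      by (simp add: power2_eq_square algebra_simps)
  qed
  have e: "(\<lambda>x. (hermite_residual m A x)\<^sup>2) = (\<lambda>x. hermite_residual m A x * indicator A x
      - P * (hermite_residual m A x * hermite 0 x) - J / fact m * (hermite_residual m A x * hermite m x))"
    by (auto simp: res power2_eq_square algebra_simps)
  show "integrable std_normal_distribution (\<lambda>x. (hermite_residual m A x)\<^sup>2)"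
    unfolding e using rA rh[of 0] rh[of m] by simp
  have "(\<integral>x. (hermite_residual m A x)\<^sup>2 \<partial>std_normal_distribution) = P - P\<^sup>2 - J\<^sup>2 / fact m"
    unfolding e using rA rh[of 0] rh[of m] orth[of 0] orth[of m] irA by simp
  also have "\<dots> \<le> P"
  proof -
    have "0 \<le> P\<^sup>2" "0 \<le> J\<^sup>2 / fact m" by auto
    then show ?thesis by linarith
  qed
  finally show "(\<integral>x. (hermite_residual m A x)\<^sup>2 \<partial>std_normal_distribution) \<le> measure std_normal_distribution A"
    by (simp add: P_def)
qed

context stationary_gaussian
begin

text \<open>Every row sum of |r|^(m+1) is at most R, so the double sum over T costs only R times the
  size of T. The resulting bound is linear in the number of times and in the mass of A, hence adds
  up over disjoint boxes.\<close>

lemma block_second_moment: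
  assumes A [measurable]: "A \<in> sets borel" and m: "1 \<le> m"
    and rank: "\<And>k. 1 \<le> k \<Longrightarrow> k < m \<Longrightarrow> (\<integral>x. indicator A x * hermite k x \<partial>std_normal_distribution) = 0"
    and T: "T \<subseteq> {1..N}"
    and R: "\<And>i. i \<in> {1..N} \<Longrightarrow> (\<Sum>j=1..N. \<bar>r (lag i j)\<bar> ^ Suc m) \<le> R"
  shows "integrable M (\<lambda>\<omega>. (\<Sum>j\<in>T. hermite_residual m A (X j \<omega>))\<^sup>2)"
    and "expectation (\<lambda>\<omega>. (\<Sum>j\<in>T. hermite_residual m A (X j \<omega>))\<^sup>2) \<le>
      2 ^ Suc m * R * real (card T) * measure std_normal_distribution A"
proof -
  let ?f = "hermite_residual m A"
  have fin: "finite T" using T finite_subset by blast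
  note f2 = integrable_hermite_residual_sq[OF A m rank]
  have int: "integrable M (\<lambda>\<omega>. ?f (X i \<omega>) * ?f (X j \<omega>))" if "i \<in> T" "j \<in> T" for i j
    using that T by (intro integrable_fX_mult f2) auto
  have e: "(\<lambda>\<omega>. (\<Sum>j\<in>T. ?f (X j \<omega>))\<^sup>2) = (\<lambda>\<omega>. \<Sum>i\<in>T. \<Sum>j\<in>T. ?f (X i \<omega>) * ?f (X j \<omega>))"
    by (simp add: power2_eq_square sum_product)
  show "integrable M (\<lambda>\<omega>. (\<Sum>j\<in>T. ?f (X j \<omega>))\<^sup>2)"
    unfolding e by (intro Bochner_Integration.integrable_sum int)
  let ?P = "measure std_normal_distribution A"
  have "expectation (\<lambda>\<omega>. (\<Sum>j\<in>T. ?f (X j \<omega>))\<^sup>2) = (\<Sum>i\<in>T. \<Sum>j\<in>T. expectation (\<lambda>\<omega>. ?f (X i \<omega>) * ?f (X j \<omega>)))"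
    unfolding e by (simp add: Bochner_Integration.integral_sum int Bochner_Integration.integrable_sum)
  also have "\<dots> \<le> (\<Sum>i\<in>T. \<Sum>j\<in>T. 2 ^ Suc m * \<bar>r (lag i j)\<bar> ^ Suc m * ?P)"
  proof (intro sum_mono)
    fix i j assume ij: "i \<in> T" "j \<in> T"
    then have "1 \<le> i" "1 \<le> j" using T by auto
    then have "expectation (\<lambda>\<omega>. ?f (X i \<omega>) * ?f (X j \<omega>)) \<le>
        2 ^ Suc m * \<bar>r (lag i j)\<bar> ^ Suc m * (\<integral>x. (?f x)\<^sup>2 \<partial>std_normal_distribution)"
      using covariance_bound[OF _ f2 hermite_residual_orthogonal[OF A m rank], of m i j]
      by (simp add: abs_le_iff)
    also have "\<dots> \<le> 2 ^ Suc m * \<bar>r (lag i j)\<bar> ^ Suc m * ?P"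
      by (intro mult_left_mono hermite_residual_sq_le[OF A m rank]) auto
    finally show "expectation (\<lambda>\<omega>. ?f (X i \<omega>) * ?f (X j \<omega>)) \<le> 2 ^ Suc m * \<bar>r (lag i j)\<bar> ^ Suc m * ?P" .
  qed
  also have "\<dots> = 2 ^ Suc m * ?P * (\<Sum>i\<in>T. \<Sum>j\<in>T. \<bar>r (lag i j)\<bar> ^ Suc m)"
    by (simp add: sum_distrib_left sum_distrib_right mult_ac)
  also have "\<dots> \<le> 2 ^ Suc m * ?P * (\<Sum>i\<in>T. R)"
  proof (intro mult_left_mono sum_mono)
    fix i assume "i \<in> T"
    have "(\<Sum>j\<in>T. \<bar>r (lag i j)\<bar> ^ Suc m) \<le> (\<Sum>j=1..N. \<bar>r (lag i j)\<bar> ^ Suc m)"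
      using T by (intro sum_mono2) auto
    also have "\<dots> \<le> R" using R \<open>i \<in> T\<close> T by auto
    finally show "(\<Sum>j\<in>T. \<bar>r (lag i j)\<bar> ^ Suc m) \<le> R" .
  qed auto
  finally show "expectation (\<lambda>\<omega>. (\<Sum>j\<in>T. ?f (X j \<omega>))\<^sup>2) \<le> 2 ^ Suc m * R * real (card T) * ?P"
    by (simp add: mult_ac)
qed

text \<open>The Rademacher--Menshov device: an initial segment of the time axis times a lower orthant of
  cells splits into at most \<open>K ^ (1 + p)\<close> dyadic boxes, one for each vector of levels, and the boxes
  of a given level vector are disjoint, so that their second moments add up without loss.\<close>

lemma dyadic_maximal_inequality:
  fixes c :: "'p::finite \<Rightarrow> real \<Rightarrow> nat"
  assumes c [measurable]: "\<And>i. c i \<in> borel \<rightarrow>\<^sub>M count_space UNIV" and m: "1 \<le> m"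
    and rank: "\<And>l k q. 1 \<le> l \<Longrightarrow> l < m \<Longrightarrow>
      (\<integral>x. indicator {x. \<forall>i. c i x div 2 ^ k i = q i} x * hermite l x \<partial>std_normal_distribution) = 0"
    and R: "\<And>i. i \<in> {1..N} \<Longrightarrow> (\<Sum>j=1..N. \<bar>r (lag i j)\<bar> ^ Suc m) \<le> R" "0 \<le> R"
  obtains Q where "integrable M Q" "\<And>\<omega>. 0 \<le> Q \<omega>"
    "expectation Q \<le> (real K ^ (1 + CARD('p)))\<^sup>2 * (2 ^ Suc m * R * real N)"
    "\<And>\<omega> n b. n \<le> N \<Longrightarrow> n + 1 < 2 ^ K \<Longrightarrow> (\<And>i. b i < 2 ^ K) \<Longrightarrow>
      (\<Sum>j=1..n. hermite_residual m {x. \<forall>i. c i x < b i} (X j \<omega>))\<^sup>2 \<le> Q \<omega>"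
proof -
  define A where "A k q = {x. \<forall>i. c i x div 2 ^ k i = q i}" for k q :: "'p \<Rightarrow> nat"
  define T where "T k0 q0 = {j\<in>{1..N}. j div 2 ^ k0 = q0}" for k0 q0 :: nat
  define W where "W k0 q0 k q \<omega> = (\<Sum>j\<in>T k0 q0. hermite_residual m (A k q) (X j \<omega>))" for k0 q0 k q \<omega>
  define levels :: "('p \<Rightarrow> nat) set" where "levels = PiE UNIV (\<lambda>_. {..<K})"
  define labels :: "('p \<Rightarrow> nat) set" where "labels = PiE UNIV (\<lambda>_. {..<2 ^ K})"
  have fin: "finite levels" "finite labels" by (auto simp: levels_def labels_def intro!: finite_PiE)
  have card_levels: "card levels = K ^ CARD('p)" by (simp add: levels_def card_PiE)
  have A_meas [measurable]: "A k q \<in> sets borel" for k q unfolding A_def by measurable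
  \<comment> \<open>The prefactor is the number of level vectors, time included; it comes from
    Cauchy-Schwarz for the sum over levels. All boxes of all levels enter, which makes Q independent
    of n and b.\<close>
  define Q where "Q \<omega> = real K ^ (1 + CARD('p)) *
    (\<Sum>k0<K. \<Sum>k\<in>levels. \<Sum>q0<2 ^ K. \<Sum>q\<in>labels. (W k0 q0 k q \<omega>)\<^sup>2)" for \<omega>
  have TN: "T k0 q0 \<subseteq> {1..N}" for k0 q0 by (auto simp: T_def)
  note W2 = block_second_moment[OF A_meas m rank[folded A_def] TN R(1), folded W_def]
  have Q_int: "integrable M Q"
    unfolding Q_def by (intro integrable_mult_right Bochner_Integration.integrable_sum W2)
  have Q_nonneg: "0 \<le> Q \<omega>" for \<omega>
    unfolding Q_def by (intro mult_nonneg_nonneg sum_nonneg) auto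
  \<comment> \<open>At fixed levels the sum factorises: the blocks of times have total size at most
    N, and the boxes have total mass at most 1.\<close>
  have level: "(\<Sum>q0<2 ^ K. \<Sum>q\<in>labels. expectation (\<lambda>\<omega>. (W k0 q0 k q \<omega>)\<^sup>2)) \<le> 2 ^ Suc m * R * real N" for k0 k
  proof -
    have cardT: "(\<Sum>q0<2 ^ K. real (card (T k0 q0))) \<le> real N"
    proof -
      have "(\<Sum>q0<2 ^ K. card (T k0 q0)) = card (\<Union>q0<2 ^ K. T k0 q0)"
        by (rule card_UN_disjoint[symmetric]) (auto simp: T_def)
      also have "\<dots> \<le> card {1..N}" by (intro card_mono) (auto simp: T_def)
      finally have "(\<Sum>q0<2 ^ K. card (T k0 q0)) \<le> N" by simp
      then show ?thesis unfolding of_nat_sum[symmetric] by (simp only: of_nat_le_iff)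
    qed
    have probA: "(\<Sum>q\<in>labels. measure std_normal_distribution (A k q)) \<le> 1"
    proof -
      have "(\<Sum>q\<in>labels. measure std_normal_distribution (A k q)) = measure std_normal_distribution (\<Union>q\<in>labels. A k q)"
      proof (rule std_normal.finite_measure_finite_Union[symmetric])
        show "disjoint_family_on (A k) labels"
          by (auto simp: disjoint_family_on_def A_def fun_eq_iff)
      qed (use fin in auto)
      then show ?thesis by simp
    qed
    have "(\<Sum>q0<2 ^ K. \<Sum>q\<in>labels. expectation (\<lambda>\<omega>. (W k0 q0 k q \<omega>)\<^sup>2)) \<le>
        (\<Sum>q0<2 ^ K. \<Sum>q\<in>labels. 2 ^ Suc m * R * real (card (T k0 q0)) * measure std_normal_distribution (A k q))"
      by (intro sum_mono W2)
    also have "\<dots> = 2 ^ Suc m * R * ((\<Sum>q0<2 ^ K. real (card (T k0 q0))) * (\<Sum>q\<in>labels. measure std_normal_distribution (A k q)))"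
      unfolding sum_product by (simp add: sum_distrib_left mult_ac)
    also have "\<dots> \<le> 2 ^ Suc m * R * (real N * 1)"
      using cardT probA R(2) by (intro mult_left_mono mult_mono) (auto intro: sum_nonneg)
    finally show ?thesis by simp
  qed
  have "expectation Q = real K ^ (1 + CARD('p)) *
    (\<Sum>k0<K. \<Sum>k\<in>levels. \<Sum>q0<2 ^ K. \<Sum>q\<in>labels. expectation (\<lambda>\<omega>. (W k0 q0 k q \<omega>)\<^sup>2))"
    unfolding Q_def integral_mult_right_zero
    by (intro arg_cong2[where f = "(*)"] refl trans[OF Bochner_Integration.integral_sum] sum.cong
        Bochner_Integration.integrable_sum W2(1))
  also have "\<dots> \<le> real K ^ (1 + CARD('p)) * (\<Sum>k0<K. \<Sum>k\<in>levels. 2 ^ Suc m * R * real N)"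
    by (intro mult_left_mono sum_mono level) auto
  also have "\<dots> = (real K ^ (1 + CARD('p)))\<^sup>2 * (2 ^ Suc m * R * real N)"
    by (simp add: card_levels power2_eq_square)
  finally have EQ: "expectation Q \<le> (real K ^ (1 + CARD('p)))\<^sup>2 * (2 ^ Suc m * R * real N)" .
  have bound: "(\<Sum>j=1..n. hermite_residual m {x. \<forall>i. c i x < b i} (X j \<omega>))\<^sup>2 \<le> Q \<omega>"
    if n: "n \<le> N" "n + 1 < 2 ^ K" and b: "\<And>i. b i < 2 ^ K" for \<omega> n b
  proof -
    \<comment> \<open>If some bound has digit 0 at its level, that coordinate contributes no block,
      and the box is empty.\<close>
    define E where "E k = (if \<forall>i. odd (b i div 2 ^ k i) then A k (\<lambda>i. b i div 2 ^ k i - 1) else {})" for k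
    have [measurable]: "E k \<in> sets borel" for k by (simp add: E_def)
    have [measurable]: "{x. \<forall>i. c i x < b i} \<in> sets borel" by measurable
    have "(indicator {x. \<forall>i. c i x < b i} x :: real) = (\<Sum>k\<in>levels. indicator (E k) x)" for x
    proof -
      have prod_of_bool: "(\<Prod>i\<in>UNIV. of_bool (P i) :: real) = of_bool (\<forall>i. P i)" for P :: "'p \<Rightarrow> bool"
        by (cases "\<forall>i. P i") auto
      have "(indicator {x. \<forall>i. c i x < b i} x :: real) = (\<Prod>i\<in>UNIV. of_bool (c i x < b i))"
        unfolding prod_of_bool by (simp add: indicator_def)
      also have "\<dots> = (\<Prod>i\<in>UNIV. \<Sum>k<K. of_bool (odd (b i div 2 ^ k) \<and> c i x div 2 ^ k = b i div 2 ^ k - 1))"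
        by (intro prod.cong refl dyadic_digit_sum b)
      \<comment> \<open>Multiplying out the digit sums of the coordinates produces one product for
        each vector of levels.\<close>
      also have "\<dots> = (\<Sum>k\<in>levels. \<Prod>i\<in>UNIV. of_bool (odd (b i div 2 ^ k i) \<and> c i x div 2 ^ k i = b i div 2 ^ k i - 1))"
        unfolding levels_def by (rule prod_sum_PiE) auto
      also have "\<dots> = (\<Sum>k\<in>levels. indicator (E k) x)"
        unfolding prod_of_bool by (intro sum.cong refl) (auto simp: E_def A_def indicator_def)
      finally show ?thesis .
    qed
    then have split_cells: "hermite_residual m {x. \<forall>i. c i x < b i} x = (\<Sum>k\<in>levels. hermite_residual m (E k) x)" for x
      by (intro hermite_residual_UN fin) auto
    define S where "S k0 k = (\<Sum>j=1..N. of_bool (odd ((n + 1) div 2 ^ k0) \<and> j div 2 ^ k0 = (n + 1) div 2 ^ k0 - 1) *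
      hermite_residual m (E k) (X j \<omega>))" for k0 k
    \<comment> \<open>The segment from 1 to n is given by j < n + 1; this is why n + 1, and not n,
      has to lie below 2^K.\<close>
    have "(\<Sum>j=1..n. hermite_residual m {x. \<forall>i. c i x < b i} (X j \<omega>)) =
        (\<Sum>j=1..N. of_bool (j < n + 1) * hermite_residual m {x. \<forall>i. c i x < b i} (X j \<omega>))"
      using n by (intro sum.mono_neutral_cong_left) auto
    also have "\<dots> = (\<Sum>j=1..N. \<Sum>k0<K. \<Sum>k\<in>levels.
        of_bool (odd ((n + 1) div 2 ^ k0) \<and> j div 2 ^ k0 = (n + 1) div 2 ^ k0 - 1) * hermite_residual m (E k) (X j \<omega>))"
      unfolding dyadic_digit_sum[OF n(2)] split_cells sum_product ..
    also have "\<dots> = (\<Sum>k0<K. \<Sum>j=1..N. \<Sum>k\<in>levels.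
        of_bool (odd ((n + 1) div 2 ^ k0) \<and> j div 2 ^ k0 = (n + 1) div 2 ^ k0 - 1) * hermite_residual m (E k) (X j \<omega>))"
      by (rule sum.swap)
    also have "\<dots> = (\<Sum>k0<K. \<Sum>k\<in>levels. S k0 k)"
      unfolding S_def by (intro sum.cong refl sum.swap)
    also have "\<dots> = (\<Sum>(k0, k)\<in>{..<K} \<times> levels. S k0 k)"
      by (rule sum.cartesian_product)
    finally have "(\<Sum>j=1..n. hermite_residual m {x. \<forall>i. c i x < b i} (X j \<omega>))\<^sup>2 =
        (\<Sum>(k0, k)\<in>{..<K} \<times> levels. S k0 k)\<^sup>2" by simp
    also have "\<dots> \<le> (\<Sum>z\<in>{..<K} \<times> levels. (case z of (k0, k) \<Rightarrow> S k0 k)\<^sup>2) * real (card ({..<K} \<times> levels))"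
      by (rule sum_squared_le_sum_of_squares[where f = "\<lambda>z. case z of (k0, k) \<Rightarrow> S k0 k"])
    also have "\<dots> = real K ^ (1 + CARD('p)) * (\<Sum>k0<K. \<Sum>k\<in>levels. (S k0 k)\<^sup>2)"
      by (simp add: card_cartesian_product card_levels sum.cartesian_product case_prod_beta)
    also have "\<dots> \<le> Q \<omega>"
      unfolding Q_def
    proof (intro mult_left_mono sum_mono)
      fix k0 k assume k: "k0 \<in> {..<K}" "k \<in> levels"
      show "(S k0 k)\<^sup>2 \<le> (\<Sum>q0<2 ^ K. \<Sum>q\<in>labels. (W k0 q0 k q \<omega>)\<^sup>2)"
      proof (cases "odd ((n + 1) div 2 ^ k0) \<and> (\<forall>i. odd (b i div 2 ^ k i))")
        case True
        let ?t = "(n + 1) div 2 ^ k0 - 1" and ?q = "\<lambda>i. b i div 2 ^ k i - 1"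
        have q0: "?t \<in> {..<2 ^ K}"
          using le_less_trans[OF le_trans[OF diff_le_self div_le_dividend] n(2)] by simp
        have q: "?q \<in> labels"
          using le_less_trans[OF le_trans[OF diff_le_self div_le_dividend] b] by (auto simp: labels_def PiE_def extensional_def)
        have "S k0 k = W k0 ?t k ?q \<omega>"
          using True unfolding S_def W_def T_def E_def
          by (intro sum.mono_neutral_cong_right) auto
        then have "(S k0 k)\<^sup>2 = (W k0 ?t k ?q \<omega>)\<^sup>2" by simp
        also have "\<dots> \<le> (\<Sum>q\<in>labels. (W k0 ?t k q \<omega>)\<^sup>2)"
          using q fin by (intro member_le_sum) auto
        also have "\<dots> \<le> (\<Sum>q0<2 ^ K. \<Sum>q\<in>labels. (W k0 q0 k q \<omega>)\<^sup>2)"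
          using q0 by (intro member_le_sum) (auto intro!: sum_nonneg)
        finally show ?thesis .
      next
        case False
        have "S k0 k = 0"
        proof (cases "odd ((n + 1) div 2 ^ k0)")
          case True
          then have "E k = {}" using False by (auto simp: E_def)
          then show ?thesis by (simp add: S_def hermite_residual_def)
        next
          case False
          then show ?thesis by (simp add: S_def)
        qed
        then show ?thesis by (auto intro!: sum_nonneg)
      qed
    qed auto
    finally show ?thesis .
  qed
  show ?thesis by (rule that[OF Q_int Q_nonneg EQ bound])
qed

end

section \<open>Bracketing by cells\<close>

context stationary_gaussian
begin

text \<open>Every pair at lag at least k0 contributes at least m! N^(-s'). The close pairs may
  contribute negatively, but there are at most 2 k0 of them in each row, of lower order than
  N^(1-s').\<close>

lemma hermite_variance_lower_bound:
  assumes m: "1 \<le> m" and s': "0 < s'" "s' < 1"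
    and tail: "\<And>k. k0 \<le> k \<Longrightarrow> real k powr (- s') \<le> r k ^ m \<and> \<bar>r k\<bar> < 1" and k0: "1 \<le> k0"
  obtains N0 where "\<And>N. N0 \<le> N \<Longrightarrow>
    fact m / 2 * real N powr (2 - s') \<le> variance (\<lambda>\<omega>. \<Sum>j=1..N. hermite m (X j \<omega>))"
proof -
  let ?h = "\<lambda>i j. expectation (\<lambda>\<omega>. hermite m (X i \<omega>) * hermite m (X j \<omega>))"
  have sq: "integrable std_normal_distribution (\<lambda>x. (hermite m x)\<^sup>2)"
    using std_normal_integrable_hermite_mult[of m m] by (simp add: power2_eq_square)
  \<comment> \<open>The at most 2 k0 close pairs of a row, each corrected by 2, cost 4 k0; the
    threshold 8 k0 makes this at most half of N^(1-s').\<close>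
  have lower: "fact m / 2 * real N powr (2 - s') \<le> variance (\<lambda>\<omega>. \<Sum>j=1..N. hermite m (X j \<omega>))"
    if large: "8 * real k0 \<le> real N powr (1 - s')" and N: "1 \<le> N" for N
  proof -
    have mean: "expectation (\<lambda>\<omega>. \<Sum>j=1..N. hermite m (X j \<omega>)) = 0"
    proof -
      have "expectation (\<lambda>\<omega>. \<Sum>j=1..N. hermite m (X j \<omega>)) = (\<Sum>j=1..N. expectation (\<lambda>\<omega>. hermite m (X j \<omega>)))"
        by (intro Bochner_Integration.integral_sum integrable_fX) auto
      also have "\<dots> = 0"
        using m by (intro sum.neutral ballI) (simp add: expectation_fX std_normal_hermite_mean)
      finally show ?thesis .
    qed
    have int: "integrable M (\<lambda>\<omega>. hermite m (X i \<omega>) * hermite m (X j \<omega>))" if "i \<in> {1..N}" "j \<in> {1..N}" for i j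
      using that by (intro integrable_fX_mult sq) auto
    have "variance (\<lambda>\<omega>. \<Sum>j=1..N. hermite m (X j \<omega>)) =
        expectation (\<lambda>\<omega>. \<Sum>i=1..N. \<Sum>j=1..N. hermite m (X i \<omega>) * hermite m (X j \<omega>))"
      unfolding mean by (simp add: power2_eq_square sum_product)
    also have "\<dots> = (\<Sum>i=1..N. \<Sum>j=1..N. ?h i j)"
      by (intro trans[OF Bochner_Integration.integral_sum] sum.cong refl Bochner_Integration.integrable_sum int)
    finally have var: "variance (\<lambda>\<omega>. \<Sum>j=1..N. hermite m (X j \<omega>)) = (\<Sum>i=1..N. \<Sum>j=1..N. ?h i j)" .
    \<comment> \<open>For close pairs the correction 2 pushes the bracket below -1, as N^(-s') \<le>
      1, and there the crude bound -m! applies.\<close>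
    have pair: "fact m * (real N powr (- s') - 2 * of_bool (lag i j < k0)) \<le> ?h i j"
      if ij: "i \<in> {1..N}" "j \<in> {1..N}" for i j
    proof (cases "lag i j < k0")
      case True
      have "real N powr (- s') \<le> 1"
        using N s' by (simp add: powr_minus ge_one_powr_ge_zero inverse_le_1_iff)
      then have "fact m * (real N powr (- s') - 2) \<le> fact m * (- 1)"
        by (intro mult_left_mono) auto
      then show ?thesis
        using True hermite_covariance_X_ge[of i j m] ij by simp
    next
      case False
      then have k: "k0 \<le> lag i j" by simp
      have "i \<noteq> j" using False k0 by auto
      have "real N powr (- s') \<le> real (lag i j) powr (- s')"
        using ij s' k k0 by (intro powr_mono2') auto
      also have "\<dots> \<le> r (lag i j) ^ m" using tail[OF k] by simp
      finally show ?thesis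
        using hermite_covariance_X[of i j m] ij \<open>i \<noteq> j\<close> tail[OF k] False by simp
    qed
    have near: "(\<Sum>j=1..N. of_bool (lag i j < k0) :: real) \<le> 2 * real k0" if "i \<in> {1..N}" for i
    proof -
      have "(\<Sum>j=1..N. of_bool (lag i j < k0) :: real) \<le> 2 * (\<Sum>k\<le>N. of_bool (k < k0))"
        using that by (intro sum_lag_le) auto
      also have "(\<Sum>k\<le>N. of_bool (k < k0) :: real) = real (card ({..N} \<inter> {..<k0}))"
        by (simp add: of_bool_def sum.If_cases lessThan_def)
      also have "card ({..N} \<inter> {..<k0}) \<le> k0"
        using card_mono[of "{..<k0}" "{..N} \<inter> {..<k0}"] by simp
      finally show ?thesis by simp
    qed
    have p1: "real N * real N powr (- s') = real N powr (1 - s')"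
      using N by (simp add: powr_diff powr_minus divide_inverse)
    have p2: "real N * real N powr (1 - s') = real N powr (2 - s')"
    proof -
      have "2 - s' = 1 + (1 - s')" by simp
      then have "real N powr (2 - s') = real N powr 1 * real N powr (1 - s')" by (simp only: powr_add)
      then show ?thesis using N by simp
    qed
    have "fact m / 2 * real N powr (2 - s') = real N * (fact m * (real N powr (1 - s') - real N powr (1 - s') / 2))"
      using p2 by (simp add: algebra_simps)
    also have "\<dots> \<le> real N * (fact m * (real N powr (1 - s') - 4 * real k0))"
      using large by (intro mult_left_mono) auto
    also have "\<dots> = (\<Sum>i=1..N. fact m * (real N * real N powr (- s') - 2 * (2 * real k0)))"
      by (simp add: p1)
    also have "\<dots> \<le> (\<Sum>i=1..N. fact m * (real N * real N powr (- s') - 2 * (\<Sum>j=1..N. of_bool (lag i j < k0))))"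
      by (intro sum_mono mult_left_mono diff_left_mono near) auto
    also have "\<dots> = (\<Sum>i=1..N. \<Sum>j=1..N. fact m * (real N powr (- s') - 2 * of_bool (lag i j < k0)))"
      by (intro sum.cong refl) (simp add: sum_subtractf flip: sum_distrib_left)
    also have "\<dots> \<le> (\<Sum>i=1..N. \<Sum>j=1..N. ?h i j)"
      by (intro sum_mono pair)
    finally show ?thesis unfolding var .
  qed
  \<comment> \<open>The solution of b^(1-s') = 8 k0.\<close>
  define b where "b = (8 * real k0) powr (1 / (1 - s'))"
  have "8 * real k0 \<le> real N powr (1 - s') \<and> 1 \<le> N" if N: "max 1 (nat \<lceil>b\<rceil>) \<le> N" for N
  proof
    have "b \<le> real N" using N by (simp add: le_nat_iff ceiling_le_iff)
    then have "b powr (1 - s') \<le> real N powr (1 - s')"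
      using s' by (intro powr_mono2) (auto simp: b_def)
    then show "8 * real k0 \<le> real N powr (1 - s')"
      using s' by (simp add: b_def powr_powr)
  qed (use N in simp)
  then show ?thesis using lower that by blast
qed

end

text \<open>The law \<open>\<mu>\<close> is cut into at most \<open>2n + 1\<close> consecutive cells: the index of \<open>t\<close> counts the multiples
  of \<open>1 / n\<close> passed by the left limit and by the value of the distribution function at \<open>t\<close>. A cell
  with more than one point carries mass at most \<open>1 / n\<close>; heavy atoms form cells of their own.\<close>

definition cell :: "real measure \<Rightarrow> nat \<Rightarrow> ereal \<Rightarrow> nat" where
  "cell \<mu> n t = nat \<lfloor>real n * measure \<mu> {y. ereal y < t}\<rfloor> + nat \<lfloor>real n * measure \<mu> {y. ereal y \<le> t}\<rfloor>"

context real_distribution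
begin

lemma cdf_le_left: "s < t \<Longrightarrow> prob {y. ereal y \<le> s} \<le> prob {y. ereal y < t}"
  by (intro finite_measure_mono) auto

lemma left_le_cdf: "prob {y. ereal y < t} \<le> prob {y. ereal y \<le> t}"
  by (intro finite_measure_mono) auto

lemma cell_mono:
  assumes "s \<le> t" shows "cell M n s \<le> cell M n t"
proof (cases "s = t")
  case False
  then have "s < t" using assms by simp
  then have "real n * prob {y. ereal y < s} \<le> real n * prob {y. ereal y < t}"
    and "real n * prob {y. ereal y \<le> s} \<le> real n * prob {y. ereal y \<le> t}"
    by (intro mult_left_mono finite_measure_mono; auto)+
  then show ?thesis unfolding cell_def by (intro add_mono nat_mono floor_mono)
qed simp

lemma cell_le: "cell M n t \<le> 2 * n"
proof -
  have "nat \<lfloor>real n * prob A\<rfloor> \<le> n" for A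
  proof -
    have "\<lfloor>real n * prob A\<rfloor> \<le> \<lfloor>real n * 1\<rfloor>" by (intro floor_mono mult_left_mono) auto
    then show ?thesis by simp
  qed
  then have "cell M n t \<le> n + n" unfolding cell_def by (intro add_mono)
  then show ?thesis by simp
qed

lemma cell_measurable [measurable]: "(\<lambda>y. cell M n (ereal y)) \<in> borel \<rightarrow>\<^sub>M count_space UNIV"
proof -
  have "mono (\<lambda>y. prob {x. ereal x < ereal y})" "mono (\<lambda>y. prob {x. ereal x \<le> ereal y})"
    by (auto intro!: monoI finite_measure_mono)
  then have [measurable]: "(\<lambda>y. prob {x. ereal x < ereal y}) \<in> borel_measurable borel"
    "(\<lambda>y. prob {x. ereal x \<le> ereal y}) \<in> borel_measurable borel"
    by (auto intro: borel_measurable_mono)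
  show ?thesis unfolding cell_def by measurable
qed

text \<open>The rounded values at the left limit of s, at s, at the left limit of t and at t
  increase in this order; equal sums of the first two and the last two force all four to
  coincide.\<close>

lemma cell_eq_gap:
  assumes "cell M n s = cell M n t" "s < t" and "1 \<le> n"
  shows "\<lfloor>real n * prob {y. ereal y < s}\<rfloor> = \<lfloor>real n * prob {y. ereal y \<le> t}\<rfloor>"
proof -
  let ?f = "\<lambda>A. nat \<lfloor>real n * prob A\<rfloor>"
  have mono: "?f {y. ereal y < s} \<le> ?f {y. ereal y \<le> s}" "?f {y. ereal y \<le> s} \<le> ?f {y. ereal y < t}"
    "?f {y. ereal y < t} \<le> ?f {y. ereal y \<le> t}"
    using cdf_le_left[OF assms(2)] left_le_cdf by (intro nat_mono floor_mono mult_left_mono; simp)+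
  then have "?f {y. ereal y < s} = ?f {y. ereal y \<le> t}"
    using assms(1) unfolding cell_def by linarith
  then show ?thesis by (subst (asm) eq_nat_nat_iff) auto
qed

text \<open>A cell need not contain its end points, so its mass is approximated from inside by
  compact sets. Such a set lies between its minimum and maximum, both in the cell, and n times the
  relevant values of the distribution function all lie in one interval [a, a + 1).\<close>

lemma cell_mass:
  assumes n: "1 \<le> n" and two: "cell M n s = l" "cell M n t = l" "s \<noteq> t"
  shows "prob {y. cell M n (ereal y) = l} \<le> 1 / real n"
proof -
  obtain s t where st: "cell M n s = l" "cell M n t = l" "s < t"
    using two by (metis neqE)
  define a where "a = \<lfloor>real n * prob {y. ereal y < s}\<rfloor>"
  have a_t: "a = \<lfloor>real n * prob {y. ereal y \<le> t}\<rfloor>"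
    unfolding a_def using st n by (intro cell_eq_gap) auto
  have a_all: "real_of_int a \<le> real n * prob {y. ereal y < u}" "real n * prob {y. ereal y \<le> u} < real_of_int a + 1"
    if u: "cell M n u = l" for u
  proof -
    have "\<lfloor>real n * prob {y. ereal y < u}\<rfloor> = a \<and> \<lfloor>real n * prob {y. ereal y \<le> u}\<rfloor> = a"
    proof -
      have sand: "\<lfloor>real n * prob {y. ereal y < v}\<rfloor> \<le> \<lfloor>real n * prob {y. ereal y \<le> v}\<rfloor>" for v
        using left_le_cdf by (intro floor_mono mult_left_mono) auto
      have mono: "\<lfloor>real n * prob {y. ereal y \<le> v}\<rfloor> \<le> \<lfloor>real n * prob {y. ereal y < w}\<rfloor>" if "v < w" for v w
        using cdf_le_left[OF that] by (intro floor_mono mult_left_mono) auto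
      \<comment> \<open>\<open>cell_eq_gap\<close> compares distinct points: u is paired with t when
        it lies below t, and otherwise with s, which is then strictly smaller.\<close>
      consider "u < t" | "t \<le> u" by force
      then show ?thesis
      proof cases
        case 1
        then have "\<lfloor>real n * prob {y. ereal y < u}\<rfloor> = a"
          unfolding a_t using u st n by (intro cell_eq_gap) auto
        moreover have "\<lfloor>real n * prob {y. ereal y \<le> u}\<rfloor> \<le> a"
          using mono[OF 1] sand[of t] by (simp add: a_t)
        ultimately show ?thesis using sand[of u] by simp
      next
        case 2
        then have "s < u" using st by simp
        then have "\<lfloor>real n * prob {y. ereal y \<le> u}\<rfloor> = a"
          unfolding a_def using u st n by (intro cell_eq_gap[symmetric]) auto
        moreover have "a \<le> \<lfloor>real n * prob {y. ereal y < u}\<rfloor>"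
          using mono[OF \<open>s < u\<close>] sand[of s] by (simp add: a_def)
        ultimately show ?thesis using sand[of u] by simp
      qed
    qed
    then show "real_of_int a \<le> real n * prob {y. ereal y < u}" "real n * prob {y. ereal y \<le> u} < real_of_int a + 1"
      by linarith+
  qed
  let ?C = "{y. cell M n (ereal y) = l}"
  have [measurable]: "?C \<in> sets borel" by measurable
  have "emeasure M ?C = (SUP K\<in>{K. K \<subseteq> ?C \<and> compact K}. emeasure M K)"
    by (rule inner_regular) (auto simp: emeasure_eq_measure)
  also have "\<dots> \<le> ennreal (1 / real n)"
  proof (rule SUP_least)
    fix K assume "K \<in> {K. K \<subseteq> ?C \<and> compact K}"
    then have K: "K \<subseteq> ?C" "compact K" by auto
    show "emeasure M K \<le> ennreal (1 / real n)"
    proof (cases "K = {}")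
      case False
      obtain y0 where y0: "y0 \<in> K" "\<forall>y\<in>K. y0 \<le> y" using compact_attains_inf[OF K(2) False] by auto
      obtain y1 where y1: "y1 \<in> K" "\<forall>y\<in>K. y \<le> y1" using compact_attains_sup[OF K(2) False] by auto
      have "prob K \<le> prob ({y. ereal y \<le> ereal y1} - {y. ereal y < ereal y0})"
        using y0 y1 by (intro finite_measure_mono) auto
      also have "\<dots> = prob {y. ereal y \<le> ereal y1} - prob {y. ereal y < ereal y0}"
      proof (rule finite_measure_Diff)
        have "y0 \<le> y1" using y0 y1 by auto
        then show "{y. ereal y < ereal y0} \<subseteq> {y. ereal y \<le> ereal y1}" by auto
      qed auto
      also have "\<dots> \<le> 1 / real n"
      proof -
        have "real n * (prob {y. ereal y \<le> ereal y1} - prob {y. ereal y < ereal y0}) \<le> 1"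
        proof -
          have "cell M n (ereal y0) = l" "cell M n (ereal y1) = l" using y0 y1 K(1) by auto
          then show ?thesis
            using a_all(1)[of "ereal y0"] a_all(2)[of "ereal y1"] unfolding right_diff_distrib by linarith
        qed
        then show ?thesis using n by (simp add: field_simps)
      qed
      finally show ?thesis by (simp add: emeasure_eq_measure)
    qed simp
  qed
  finally show ?thesis by (simp add: emeasure_eq_measure)
qed

text \<open>If x shares its cell with another point, the bracket leaves out or includes this one
  cell, whose mass is small by \<open>cell_mass\<close>. Otherwise x is alone in its cell, the
  points up to x form exactly a union of cells, and both bounds coincide, so a heavy atom at x costs
  nothing.\<close>

lemma cell_sandwich:
  assumes n: "1 \<le> n"
  obtains lo hi where "lo \<le> 2 * n + 1" "hi \<le> 2 * n + 1"
    "\<And>y. cell M n y < lo \<Longrightarrow> y \<le> x" "\<And>y. y \<le> x \<Longrightarrow> cell M n y < hi"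
    "prob {y. lo \<le> cell M n (ereal y) \<and> cell M n (ereal y) < hi} \<le> 1 / real n"
proof (cases "\<exists>t. t \<noteq> x \<and> cell M n t = cell M n x")
  case True
  then obtain t where t: "t \<noteq> x" "cell M n t = cell M n x" by auto
  have "{y. cell M n x \<le> cell M n (ereal y) \<and> cell M n (ereal y) < cell M n x + 1} =
      {y. cell M n (ereal y) = cell M n x}" by auto
  moreover have "prob {y. cell M n (ereal y) = cell M n x} \<le> 1 / real n"
    using t by (intro cell_mass[OF n, of x _ t]) auto
  moreover have "y \<le> x" if "cell M n y < cell M n x" for y
    using that cell_mono[of x y n] by (metis leD linear)
  moreover have "cell M n y < cell M n x + 1" if "y \<le> x" for y
    using cell_mono[OF that, of n] by simp
  ultimately show ?thesis
    using cell_le[of n x] by (intro that[of "cell M n x" "cell M n x + 1"]) auto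
next
  case False
  have "y \<le> x" if "cell M n y < cell M n x + 1" for y
  proof (rule ccontr)
    assume "\<not> y \<le> x"
    then have "cell M n x \<le> cell M n y" "y \<noteq> x" by (auto intro: cell_mono)
    then show False using that False by auto
  qed
  moreover have "cell M n y < cell M n x + 1" if "y \<le> x" for y
    using cell_mono[OF that, of n] by simp
  moreover have "prob {y. cell M n x + 1 \<le> cell M n (ereal y) \<and> cell M n (ereal y) < cell M n x + 1} \<le> 1 / real n"
  proof -
    have "{y. cell M n x + 1 \<le> cell M n (ereal y) \<and> cell M n (ereal y) < cell M n x + 1} = {}" by auto
    then show ?thesis by (simp only: measure_empty) simp
  qed
  ultimately show ?thesis
    using cell_le[of n x] by (intro that[of "cell M n x + 1" "cell M n x + 1"]) auto
qed

end

section \<open>Comparison of nested sets and extension of the rank condition\<close>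

lemma integral_indicator_hermite_le:
  assumes [measurable]: "A \<in> sets borel"
  shows "\<bar>\<integral>y. indicator A y * hermite m y \<partial>std_normal_distribution\<bar> / fact m \<le> sqrt (measure std_normal_distribution A)"
proof -
  have "\<bar>\<integral>y. indicator A y * hermite m y \<partial>std_normal_distribution\<bar> \<le>
      sqrt (\<integral>y. (indicator A y)\<^sup>2 \<partial>std_normal_distribution) * sqrt (\<integral>y. (hermite m y)\<^sup>2 \<partial>std_normal_distribution)"
  proof (rule integral_cauchy_schwarz)
    show "integrable std_normal_distribution (\<lambda>y. (indicator A y)\<^sup>2 :: real)"
      by (rule std_normal.integrable_const_bound[where B = 1]) (auto split: split_indicator)
    show "integrable std_normal_distribution (\<lambda>y. (hermite m y)\<^sup>2)"
      using std_normal_integrable_hermite_mult[of m m] by (simp add: power2_eq_square)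
  qed auto
  also have "(\<lambda>y. (indicator A y)\<^sup>2 :: real) = indicator A" by (auto split: split_indicator)
  also have "(\<integral>y. (hermite m y)\<^sup>2 \<partial>std_normal_distribution) = fact m"
    using hermite_orthogonal[of m m] by (simp add: power2_eq_square)
  finally have "\<bar>\<integral>y. indicator A y * hermite m y \<partial>std_normal_distribution\<bar> \<le>
      sqrt (measure std_normal_distribution A) * sqrt (fact m)" by simp
  \<comment> \<open>As m! \<ge> 1, its square root is absorbed by the division by m!.\<close>
  also have "\<dots> \<le> sqrt (measure std_normal_distribution A) * fact m"
  proof (intro mult_left_mono)
    show "sqrt (fact m) \<le> (fact m :: real)"
      using fact_ge_1[of m, where 'a = real] by (intro real_le_lsqrt) (auto simp: power2_eq_square)
  qed auto
  finally show ?thesis by (simp add: pos_divide_le_eq)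
qed

text \<open>By additivity the residuals of nested sets differ by the residual of their difference.
  There the indicator is nonnegative, so a lower bound involves only the mass and, through
  Cauchy-Schwarz, the square root of the mass times the Hermite polynomial.\<close>

lemma hermite_residual_bracket:
  assumes [measurable]: "A \<in> sets borel" "B \<in> sets borel" "C \<in> sets borel" and sub: "A \<subseteq> B" "B \<subseteq> C"
    and \<delta>: "measure std_normal_distribution (C - A) \<le> \<delta>"
  shows "hermite_residual m B x \<le> hermite_residual m C x + (\<delta> + sqrt \<delta> * \<bar>hermite m x\<bar>)"
    and "hermite_residual m A x \<le> hermite_residual m B x + (\<delta> + sqrt \<delta> * \<bar>hermite m x\<bar>)"
proof -
  have *: "hermite_residual m A x \<le> hermite_residual m B x + (\<delta> + sqrt \<delta> * \<bar>hermite m x\<bar>)"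
    if [measurable]: "A \<in> sets borel" "B \<in> sets borel" and AB: "A \<subseteq> B"
      and \<delta>: "measure std_normal_distribution (B - A) \<le> \<delta>" for A B
  proof -
    have "hermite_residual m B x = hermite_residual m A x + hermite_residual m (B - A) x"
    proof -
      have "hermite_residual m B x = (\<Sum>b\<in>{True, False}. hermite_residual m (if b then A else B - A) x)"
        by (rule hermite_residual_UN) (use AB in \<open>auto split: split_indicator\<close>)
      then show ?thesis by simp
    qed
    moreover have "- (\<delta> + sqrt \<delta> * \<bar>hermite m x\<bar>) \<le> hermite_residual m (B - A) x"
    proof -
      define J where "J = (\<integral>y. indicator (B - A) y * hermite m y \<partial>std_normal_distribution) / fact m"
      have "\<bar>J\<bar> \<le> sqrt (measure std_normal_distribution (B - A))"
        using integral_indicator_hermite_le[of "B - A" m] by (simp add: J_def)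
      also have "\<dots> \<le> sqrt \<delta>" using \<delta> by simp
      finally have "\<bar>J * hermite m x\<bar> \<le> sqrt \<delta> * \<bar>hermite m x\<bar>"
        unfolding abs_mult by (intro mult_right_mono) auto
      moreover have "(0::real) \<le> indicator (B - A) x" by simp
      ultimately show ?thesis
        unfolding hermite_residual_def J_def[symmetric] using \<delta> by linarith
    qed
    ultimately show ?thesis by linarith
  qed
  have "measure std_normal_distribution (C - B) \<le> \<delta>" "measure std_normal_distribution (B - A) \<le> \<delta>"
    using sub by (auto intro!: order_trans[OF std_normal.finite_measure_mono \<delta>])
  then show "hermite_residual m B x \<le> hermite_residual m C x + (\<delta> + sqrt \<delta> * \<bar>hermite m x\<bar>)"
    and "hermite_residual m A x \<le> hermite_residual m B x + (\<delta> + sqrt \<delta> * \<bar>hermite m x\<bar>)"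
    using sub by (auto intro!: *)
qed

text \<open>Sets with vanishing moment form a Dynkin system, complements being covered because
  \<open>hermite q\<close> has mean 0 for q \<ge> 1, and the orthants generate the Borel sets and
  are stable under intersection. This carries the rank condition from orthants to the dyadic
  boxes.\<close>

lemma hermite_moment_vimage_eq_0:
  fixes G :: "real \<Rightarrow> real ^ 'p"
  assumes [measurable]: "G \<in> borel_measurable borel" and q: "1 \<le> q"
    and orthant: "\<And>a. (\<integral>x. indicator (G -` {..a}) x * hermite q x \<partial>std_normal_distribution) = 0"
    and A: "A \<in> sets borel"
  shows "(\<integral>x. indicator (G -` A) x * hermite q x \<partial>std_normal_distribution) = 0"
proof -
  have meas: "G -` B \<in> sets borel" if "B \<in> sets borel" for B
    using measurable_sets[OF assms(1) that] by simp
  have borel: "sets borel = sigma_sets UNIV (range (\<lambda>a::real ^ 'p. {..a}))"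
    by (subst borel_eq_atMost) simp
  have "Int_stable (range (\<lambda>a::real ^ 'p. {..a}))"
  proof (rule Int_stableI, elim rangeE)
    fix C D and a b :: "real ^ 'p" assume "C = {..a}" "D = {..b}"
    then have "C \<inter> D = {..inf a b}" by auto
    then show "C \<inter> D \<in> range (\<lambda>a::real ^ 'p. {..a})" by blast
  qed
  moreover have "range (\<lambda>a::real ^ 'p. {..a}) \<subseteq> Pow UNIV" by simp
  moreover have "A \<in> sigma_sets UNIV (range (\<lambda>a::real ^ 'p. {..a}))" using A borel by simp
  ultimately show ?thesis
  proof (induction rule: sigma_sets_induct_disjoint)
    case (compl B)
    then have B: "B \<in> sets borel" using borel by simp
    have "(\<lambda>x. indicator (G -` (UNIV - B)) x * hermite q x) =
        (\<lambda>x. hermite q x - indicator (G -` B) x * hermite q x)"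
      by (auto split: split_indicator)
    then show ?case
      using compl meas[OF B] q by (simp add: std_normal_hermite_mean)
  next
    case (union B)
    then have B: "B i \<in> sets borel" for i using borel by auto
    have "(LINT x:(\<Union>i. G -` B i)|std_normal_distribution. hermite q x) =
        (\<Sum>i. LINT x:(G -` B i)|std_normal_distribution. hermite q x)"
    proof (rule lebesgue_integral_countable_add)
      show "set_integrable std_normal_distribution (\<Union>i. G -` B i) (hermite q)"
        unfolding set_integrable_def real_scaleR_def
        by (intro integrable_indicator_hermite sets.countable_UN) (use B meas in auto)
      show "G -` B i \<inter> G -` B j = {}" if "i \<noteq> j" for i j
        using union that by (auto simp: disjoint_family_on_def)
    qed (use B meas in auto)
    then show ?case
      using union by (simp add: set_lebesgue_integral_def vimage_UN)
  qed (use orthant in auto)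
qed

lemma lower_orthant_eq: "lower_orthant x = {y. \<forall>i. ereal (y $ i) \<le> x $ i}"
  by (simp add: lower_orthant_def ereal_vec_def less_eq_vec_def)

lemma borel_measurable_vec_nth' [measurable]: "(\<lambda>y::real ^ 'p. y $ i) \<in> borel_measurable borel"
  by (intro borel_measurable_continuous_onI continuous_intros)

lemma lower_orthant_measurable [measurable]: "lower_orthant x \<in> sets borel"
  unfolding lower_orthant_eq by measurable

context stationary_gaussian
begin

text \<open>The supremum over n and x is removed here: Q controls the unions of cells bracketing an
  orthant, V the passage from the orthant to its bracket, and both are free of n and x.\<close>

lemma uniform_residual_bound:
  fixes G :: "real \<Rightarrow> real ^ 'p"
  assumes G [measurable]: "G \<in> borel_measurable borel" and m: "1 \<le> m"
    and rank: "\<And>A l. A \<in> sets borel \<Longrightarrow> 1 \<le> l \<Longrightarrow> l < m \<Longrightarrow>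
      (\<integral>x. indicator (G -` A) x * hermite l x \<partial>std_normal_distribution) = 0"
    and N: "1 \<le> N" and R: "\<And>i. i \<in> {1..N} \<Longrightarrow> (\<Sum>j=1..N. \<bar>r (lag i j)\<bar> ^ Suc m) \<le> R" "0 \<le> R"
    and K: "2 * N ^ 4 + 2 \<le> 2 ^ K"
  defines "\<delta> \<equiv> real CARD('p) / real N ^ 4"
  obtains Q V where "integrable M Q" "\<And>\<omega>. 0 \<le> Q \<omega>"
    "expectation Q \<le> (real K ^ (1 + CARD('p)))\<^sup>2 * (2 ^ Suc m * R * real N)"
    "integrable M V" "\<And>\<omega>. 0 \<le> V \<omega>"
    "expectation V = real N * (\<delta> + sqrt \<delta> * (\<integral>x. \<bar>hermite m x\<bar> \<partial>std_normal_distribution))"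
    "\<And>\<omega> n x. n \<le> N \<Longrightarrow>
      \<bar>\<Sum>j=1..n. hermite_residual m (G -` lower_orthant x) (X j \<omega>)\<bar> \<le> sqrt (Q \<omega>) + V \<omega>"
proof -
  define \<mu> where "\<mu> i = distr std_normal_distribution borel (\<lambda>x. G x $ i)" for i
  have \<mu>: "real_distribution (\<mu> i)" for i
    unfolding \<mu>_def by (intro real_distribution.intro std_normal.prob_space_distr)
      (auto simp: real_distribution_axioms_def)
  define c where "c i x = cell (\<mu> i) (N ^ 4) (ereal (G x $ i))" for i x
  have cell_meas [measurable]: "(\<lambda>y. cell (\<mu> i) (N ^ 4) (ereal y)) \<in> borel \<rightarrow>\<^sub>M count_space UNIV" for i
    by (rule real_distribution.cell_measurable[OF \<mu>])
  have c [measurable]: "c i \<in> borel \<rightarrow>\<^sub>M count_space UNIV" for i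
    unfolding c_def[abs_def] by measurable
  have rank_c: "(\<integral>x. indicator {x. \<forall>i. c i x div 2 ^ k i = q i} x * hermite l x \<partial>std_normal_distribution) = 0"
    if l: "1 \<le> l" "l < m" for l k q
  proof -
    have E: "{x. \<forall>i. c i x div 2 ^ k i = q i} = G -` {y. \<forall>i. cell (\<mu> i) (N ^ 4) (ereal (y $ i)) div 2 ^ k i = q i}"
      by (auto simp: c_def)
    have E_meas: "{y. \<forall>i. cell (\<mu> i) (N ^ 4) (ereal (y $ i)) div 2 ^ k i = q i} \<in> sets borel"
      by measurable
    show ?thesis unfolding E by (rule rank[OF E_meas l])
  qed
  obtain Q where Q: "integrable M Q" "\<And>\<omega>. 0 \<le> Q \<omega>"
    "expectation Q \<le> (real K ^ (1 + CARD('p)))\<^sup>2 * (2 ^ Suc m * R * real N)"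
    "\<And>\<omega> n b. n \<le> N \<Longrightarrow> n + 1 < 2 ^ K \<Longrightarrow> (\<And>i. b i < 2 ^ K) \<Longrightarrow>
      (\<Sum>j=1..n. hermite_residual m {x. \<forall>i. c i x < b i} (X j \<omega>))\<^sup>2 \<le> Q \<omega>"
    using dyadic_maximal_inequality[OF c m rank_c R] by blast
  define V where "V \<omega> = (\<Sum>j=1..N. \<delta> + sqrt \<delta> * \<bar>hermite m (X j \<omega>)\<bar>)" for \<omega>
  have \<delta>0: "0 \<le> \<delta>" by (simp add: \<delta>_def)
  have absH: "integrable std_normal_distribution (\<lambda>x. \<bar>hermite m x\<bar>)"
    by (intro integrable_abs std_normal_integrable_hermite)
  have intH: "integrable M (\<lambda>\<omega>. \<bar>hermite m (X j \<omega>)\<bar>)" if "1 \<le> j" for j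
    using integrable_fX[OF absH that] .
  have V_int: "integrable M V"
    unfolding V_def by (intro Bochner_Integration.integrable_sum Bochner_Integration.integrable_add
        integrable_mult_right intH) auto
  have V_nonneg: "0 \<le> V \<omega>" for \<omega> unfolding V_def using \<delta>0 by (intro sum_nonneg) auto
  have "expectation V = (\<Sum>j=1..N. expectation (\<lambda>\<omega>. \<delta> + sqrt \<delta> * \<bar>hermite m (X j \<omega>)\<bar>))"
    unfolding V_def by (intro Bochner_Integration.integral_sum Bochner_Integration.integrable_add
        integrable_mult_right intH) auto
  also have "\<dots> = (\<Sum>j=1..N. \<delta> + sqrt \<delta> * (\<integral>x. \<bar>hermite m x\<bar> \<partial>std_normal_distribution))"
    by (intro sum.cong refl) (simp add: intH prob_space expectation_fX[OF absH])
  finally have EV: "expectation V = real N * (\<delta> + sqrt \<delta> * (\<integral>x. \<bar>hermite m x\<bar> \<partial>std_normal_distribution))"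
    by simp
  have bound: "\<bar>\<Sum>j=1..n. hermite_residual m (G -` lower_orthant x) (X j \<omega>)\<bar> \<le> sqrt (Q \<omega>) + V \<omega>"
    if n: "n \<le> N" for \<omega> n x
  proof -
    have N4: "1 \<le> N ^ 4" using N by simp
    define bracket where "bracket i z \<longleftrightarrow> fst z \<le> 2 * N ^ 4 + 1 \<and> snd z \<le> 2 * N ^ 4 + 1 \<and>
      (\<forall>y. cell (\<mu> i) (N ^ 4) y < fst z \<longrightarrow> y \<le> x $ i) \<and> (\<forall>y. y \<le> x $ i \<longrightarrow> cell (\<mu> i) (N ^ 4) y < snd z) \<and>
      measure (\<mu> i) {y. fst z \<le> cell (\<mu> i) (N ^ 4) (ereal y) \<and> cell (\<mu> i) (N ^ 4) (ereal y) < snd z}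
        \<le> 1 / real (N ^ 4)" for i and z :: "nat \<times> nat"
    have "\<forall>i. \<exists>z. bracket i z"
    proof
      fix i
      show "\<exists>z. bracket i z"
      proof (rule real_distribution.cell_sandwich[OF \<mu>[of i] N4, of "x $ i"])
        fix lo hi
        assume "lo \<le> 2 * N ^ 4 + 1" "hi \<le> 2 * N ^ 4 + 1"
          "\<And>y. cell (\<mu> i) (N ^ 4) y < lo \<Longrightarrow> y \<le> x $ i" "\<And>y. y \<le> x $ i \<Longrightarrow> cell (\<mu> i) (N ^ 4) y < hi"
          "measure (\<mu> i) {y. lo \<le> cell (\<mu> i) (N ^ 4) (ereal y) \<and> cell (\<mu> i) (N ^ 4) (ereal y) < hi} \<le> 1 / real (N ^ 4)"
        then show ?thesis unfolding bracket_def by (intro exI[of _ "(lo, hi)"]) simp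
      qed
    qed
    then obtain z where z: "\<forall>i. bracket i (z i)" by (rule choice[THEN exE])
    define lo hi where "lo i = fst (z i)" and "hi i = snd (z i)" for i
    have lohi: "\<And>i. lo i \<le> 2 * N ^ 4 + 1" "\<And>i. hi i \<le> 2 * N ^ 4 + 1"
      "\<And>i y. cell (\<mu> i) (N ^ 4) y < lo i \<Longrightarrow> y \<le> x $ i" "\<And>i y. y \<le> x $ i \<Longrightarrow> cell (\<mu> i) (N ^ 4) y < hi i"
      "\<And>i. measure (\<mu> i) {y. lo i \<le> cell (\<mu> i) (N ^ 4) (ereal y) \<and> cell (\<mu> i) (N ^ 4) (ereal y) < hi i} \<le> 1 / real (N ^ 4)"
      using z unfolding bracket_def lo_def hi_def by blast+
    let ?A = "{x. \<forall>i. c i x < lo i}" and ?B = "G -` lower_orthant x" and ?C = "{x. \<forall>i. c i x < hi i}"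
    have [measurable]: "?A \<in> sets borel" "?C \<in> sets borel" by measurable
    have [measurable]: "?B \<in> sets borel" using measurable_sets[OF G lower_orthant_measurable[of x]] by simp
    have sub: "?A \<subseteq> ?B" "?B \<subseteq> ?C"
      using lohi(3,4) by (auto simp: c_def lower_orthant_eq)
    \<comment> \<open>A point between the brackets lies in the gap of at least one coordinate, so
      the union bound gives p gaps of mass N^(-4).\<close>
    have "measure std_normal_distribution (?C - ?A) \<le>
        measure std_normal_distribution (\<Union>i. {x. lo i \<le> c i x \<and> c i x < hi i})"
      by (intro std_normal.finite_measure_mono) (auto simp: not_less)
    also have "\<dots> \<le> (\<Sum>i\<in>UNIV. measure std_normal_distribution {x. lo i \<le> c i x \<and> c i x < hi i})"
      by (intro std_normal.finite_measure_subadditive_finite) auto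
    also have "\<dots> \<le> (\<Sum>i\<in>(UNIV :: 'p set). 1 / real (N ^ 4))"
    proof (intro sum_mono)
      fix i
      have "measure (\<mu> i) {y. lo i \<le> cell (\<mu> i) (N ^ 4) (ereal y) \<and> cell (\<mu> i) (N ^ 4) (ereal y) < hi i} =
          measure std_normal_distribution {x. lo i \<le> c i x \<and> c i x < hi i}"
      proof -
        have "measure (\<mu> i) S = measure std_normal_distribution ((\<lambda>x. G x $ i) -` S)" if "S \<in> sets borel" for S
          unfolding \<mu>_def using that by (subst measure_distr) auto
        then show ?thesis by (simp add: c_def vimage_def)
      qed
      then show "measure std_normal_distribution {x. lo i \<le> c i x \<and> c i x < hi i} \<le> 1 / real (N ^ 4)"
        using lohi(5)[of i] by simp
    qed
    also have "\<dots> = \<delta>" by (simp add: \<delta>_def)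
    finally have \<delta>: "measure std_normal_distribution (?C - ?A) \<le> \<delta>" .
    \<comment> \<open>The bracket bounds run from 0 to 2 N^4 + 1, which explains the 2 N^4 + 2 in
      the condition on K.\<close>
    have size: "n + 1 < 2 ^ K" "\<And>i. lo i < 2 ^ K" "\<And>i. hi i < 2 ^ K"
    proof -
      have "N ^ 1 \<le> N ^ 4" using N by (intro power_increasing) auto
      then show "n + 1 < 2 ^ K" using K n by simp
      show "lo i < 2 ^ K" "hi i < 2 ^ K" for i using lohi(1)[of i] lohi(2)[of i] K by simp_all
    qed
    have part: "(\<Sum>j=1..n. \<delta> + sqrt \<delta> * \<bar>hermite m (X j \<omega>)\<bar>) \<le> V \<omega>"
      unfolding V_def using n \<delta>0 by (intro sum_mono2) auto
    have sqrtQ: "\<bar>t\<bar> \<le> sqrt (Q \<omega>)" if "t\<^sup>2 \<le> Q \<omega>" for t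
      using real_sqrt_le_mono[OF that] by simp
    have upper: "(\<Sum>j=1..n. hermite_residual m ?B (X j \<omega>)) \<le> sqrt (Q \<omega>) + V \<omega>"
    proof -
      have "(\<Sum>j=1..n. hermite_residual m ?B (X j \<omega>)) \<le>
          (\<Sum>j=1..n. hermite_residual m ?C (X j \<omega>)) + (\<Sum>j=1..n. \<delta> + sqrt \<delta> * \<bar>hermite m (X j \<omega>)\<bar>)"
        unfolding sum.distrib[symmetric] by (intro sum_mono hermite_residual_bracket(1)[OF _ _ _ sub \<delta>]) auto
      moreover have "(\<Sum>j=1..n. hermite_residual m ?C (X j \<omega>))\<^sup>2 \<le> Q \<omega>"
        by (rule Q(4)[OF n size(1,3)])
      ultimately show ?thesis using part sqrtQ[of "\<Sum>j=1..n. hermite_residual m ?C (X j \<omega>)"] by linarith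
    qed
    have lower: "- (sqrt (Q \<omega>) + V \<omega>) \<le> (\<Sum>j=1..n. hermite_residual m ?B (X j \<omega>))"
    proof -
      have "(\<Sum>j=1..n. hermite_residual m ?A (X j \<omega>)) \<le>
          (\<Sum>j=1..n. hermite_residual m ?B (X j \<omega>)) + (\<Sum>j=1..n. \<delta> + sqrt \<delta> * \<bar>hermite m (X j \<omega>)\<bar>)"
        unfolding sum.distrib[symmetric] by (intro sum_mono hermite_residual_bracket(2)[OF _ _ _ sub \<delta>]) auto
      moreover have "(\<Sum>j=1..n. hermite_residual m ?A (X j \<omega>))\<^sup>2 \<le> Q \<omega>"
        by (rule Q(4)[OF n size(1,2)])
      ultimately show ?thesis using part sqrtQ[of "\<Sum>j=1..n. hermite_residual m ?A (X j \<omega>)"] by linarith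
    qed
    show ?thesis using upper lower by linarith
  qed
  show ?thesis by (rule that[OF Q(1-3) V_int V_nonneg EV bound])
qed

end

section \<open>Tail bound\<close>

context stationary_gaussian
begin

lemma uniform_reduction_tail:
  fixes G :: "real \<Rightarrow> real ^ 'p"
  assumes G: "G \<in> borel_measurable borel" and m: "1 \<le> m"
    and rank: "\<And>A l. A \<in> sets borel \<Longrightarrow> 1 \<le> l \<Longrightarrow> l < m \<Longrightarrow>
      (\<integral>x. indicator (G -` A) x * hermite l x \<partial>std_normal_distribution) = 0"
    and L: "slowly_varying L" and r: "\<And>k. 1 \<le> k \<Longrightarrow> r k = real k powr (- D) * L (real k)"
    and D: "0 < D" "D < 1 / real m"
  defines "d N \<equiv> sqrt (variance (\<lambda>\<omega>. \<Sum>j=1..N. hermite m (X j \<omega>)))"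
  shows "\<exists>C>0. \<exists>\<kappa>>0. \<forall>N\<ge>1. \<forall>\<epsilon>. 0 < \<epsilon> \<and> \<epsilon> \<le> 1 \<longrightarrow>
    prob {\<omega> \<in> space M. \<exists>n\<in>{1..N}. \<exists>x. \<epsilon> < inverse (d N) *
        \<bar>\<Sum>j=1..n. hermite_residual m (G -` lower_orthant x) (X j \<omega>)\<bar>}
      \<le> C * real N powr (- \<kappa>) * (1 + \<epsilon> powi (-3))"
proof -
  define E where "E N \<epsilon> = {\<omega> \<in> space M. \<exists>n\<in>{1..N}. \<exists>x. \<epsilon> < inverse (d N) *
    \<bar>\<Sum>j=1..n. hermite_residual m (G -` lower_orthant x) (X j \<omega>)\<bar>}" for N \<epsilon>
  have r1: "\<bar>r k\<bar> \<le> 1" for k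
  proof -
    have x2: "integrable std_normal_distribution (\<lambda>x. x\<^sup>2)" "(\<integral>x. x\<^sup>2 \<partial>std_normal_distribution) = 1"
      using integrable_std_normal_distribution_moment[of 2] std_normal_distribution_even_moments(1)[of 1] by simp_all
    have "lag 1 (1 + k) = k" by simp
    then show ?thesis
      using covariance_fX_le[OF _ x2(1), of 1 "1 + k"] covariance[of 1 "1 + k"] x2(2) by simp
  qed
  obtain s s' C k0 where s: "0 < s'" "s' < s" "s < 1" and C: "0 < C"
    and R: "\<And>N i. i \<in> {1..N} \<Longrightarrow> (\<Sum>j=1..N. \<bar>r (lag i j)\<bar> ^ Suc m) \<le> C * real N powr (1 - s)"
    and tail: "\<And>k. k0 \<le> k \<Longrightarrow> real k powr (- s') \<le> r k ^ m \<and> \<bar>r k\<bar> < 1" and k0: "1 \<le> k0"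
    by (rule long_range_bounds[OF L _ r1 D m], rule r, assumption, rule that, assumption+)
  have s'1: "s' < 1" using s by simp
  obtain N0 where N0: "\<And>N. N0 \<le> N \<Longrightarrow>
      fact m / 2 * real N powr (2 - s') \<le> variance (\<lambda>\<omega>. \<Sum>j=1..N. hermite m (X j \<omega>))"
    by (rule hermite_variance_lower_bound[OF m s(1) s'1 _ k0], rule tail, assumption, rule that, assumption+)
  \<comment> \<open>The power of \<open>K N\<close> in the bound for Q: the number of level vectors,
    squared.\<close>
  define e where "e = 2 * (1 + CARD('p))"
  \<comment> \<open>Half of the gap in the exponents; the other half pays for the power of
    \<open>K N\<close>, which with a = \<kappa> / e is bounded by a multiple of N^\<kappa>.\<close>
  define \<kappa> where "\<kappa> = (s - s') / 2"
  have \<kappa>: "0 < \<kappa>" "\<kappa> \<le> 1" using s by (auto simp: \<kappa>_def)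
  define a where "a = \<kappa> / real e"
  have a: "0 < a" using \<kappa> by (simp add: a_def e_def)
  define K where "K N = nat \<lceil>log 2 (real (2 * N ^ 4 + 2))\<rceil>" for N :: nat
  \<comment> \<open>From log 2 (4 N^4) + 1 \<le> 3 + 8 ln N and ln N \<le> N^a / a, using N^a \<ge>
    1.\<close>
  define B where "B = 3 + 8 / a"
  have B: "0 < B" using a by (simp add: B_def add_pos_pos)
  have K_large: "2 * N ^ 4 + 2 \<le> 2 ^ K N" for N
  proof -
    have "real (2 * N ^ 4 + 2) = 2 powr (log 2 (real (2 * N ^ 4 + 2)))"
      by (rule powr_log_cancel[symmetric]) (simp, simp, rule of_nat_0_less_iff[THEN iffD2], simp)
    also have "\<dots> \<le> 2 powr (real (K N))"
      unfolding K_def by (intro powr_mono) linarith+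
    also have "\<dots> = real (2 ^ K N)" by (simp add: powr_realpow)
    finally show ?thesis by (simp only: of_nat_le_iff)
  qed
  have K_small: "real (K N) \<le> B * real N powr a" if N: "1 \<le> N" for N
  proof -
    have N4: "1 \<le> real N ^ 4" using N by simp
    then have arg: "1 \<le> real (2 * N ^ 4 + 2)" "real (2 * N ^ 4 + 2) \<le> 4 * real N ^ 4" by simp_all
    have "0 \<le> log 2 (real (2 * N ^ 4 + 2))"
      using arg(1) by (subst zero_le_log_cancel_iff) linarith+
    then have "real (K N) \<le> log 2 (real (2 * N ^ 4 + 2)) + 1"
      unfolding K_def by linarith
    also have "log 2 (real (2 * N ^ 4 + 2)) \<le> log 2 (4 * real N ^ 4)"
      using arg by (subst log_le_cancel_iff) linarith+
    also have "log 2 (4 * real N ^ 4) = 2 + 4 * (ln (real N) / ln 2)"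
    proof -
      have "log 2 (4::real) = 2" using log_pow_cancel[of "2::real" 2] by simp
      then show ?thesis using N by (simp add: log_mult log_nat_power) (simp add: log_def)
    qed
    also have "ln (real N) / ln 2 \<le> 2 * ln (real N)"
    proof -
      have "1 / 2 \<le> ln (2::real)" using ln_le_minus_one[of "1 / 2 :: real"] by (simp add: ln_div)
      then have "ln (real N) / ln 2 \<le> ln (real N) / (1 / 2)"
        using N by (intro divide_left_mono) auto
      then show ?thesis by simp
    qed
    also have "ln (real N) \<le> real N powr a / a"
      using N a by (intro ln_powr_bound) auto
    finally have "real (K N) \<le> 3 + 8 * (real N powr a / a)" by simp
    moreover have "1 \<le> real N powr a" using N a by (intro ge_one_powr_ge_zero) auto
    ultimately show ?thesis by (simp add: B_def ring_distribs)
  qed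
  define H where "H = (\<integral>x. \<bar>hermite m x\<bar> \<partial>std_normal_distribution)"
  define p where "p = real CARD('p)"
  have p: "0 < p" by (simp add: p_def)
  have H: "0 \<le> H" by (simp add: H_def)
  \<comment> \<open>The factor 4, and the 2 in C2, come from the threshold \<epsilon> * d N / 2 for
    each of the two terms; m! / 2 is the constant of the variance bound.\<close>
  define C1 where "C1 = 4 * (B ^ e * (2 ^ Suc m * C)) / (fact m / 2)"
  define C2 where "C2 = 2 * (p + sqrt p * H) / sqrt (fact m / 2)"
  have C12: "0 \<le> C1" "0 \<le> C2" using B C p H by (auto simp: C1_def C2_def)
  have main: "prob (E N \<epsilon>) \<le> (C1 + C2) * real N powr (- \<kappa>) * (1 + \<epsilon> powi (-3))"
    if N: "N0 \<le> N" "1 \<le> N" and \<epsilon>: "0 < \<epsilon>" "\<epsilon> \<le> 1" for N \<epsilon>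
  proof -
    have N1: "1 \<le> real N" using N by simp
    have R0: "0 \<le> C * real N powr (1 - s)" using C by simp
    obtain Q V where Q: "integrable M Q" "\<And>\<omega>. 0 \<le> Q \<omega>"
      and EQ: "expectation Q \<le> (real (K N) ^ (1 + CARD('p)))\<^sup>2 * (2 ^ Suc m * (C * real N powr (1 - s)) * real N)"
      and V: "integrable M V" "\<And>\<omega>. 0 \<le> V \<omega>"
      and EV: "expectation V = real N * (p / real N ^ 4 + sqrt (p / real N ^ 4) * H)"
      and QV: "\<And>\<omega> n x. n \<le> N \<Longrightarrow>
        \<bar>\<Sum>j=1..n. hermite_residual m (G -` lower_orthant x) (X j \<omega>)\<bar> \<le> sqrt (Q \<omega>) + V \<omega>"
      by (rule uniform_residual_bound[OF G m _ N(2) _ R0 K_large, folded p_def H_def],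
          rule rank, assumption+, rule R, assumption, rule that, assumption+)
    have var: "fact m / 2 * real N powr (2 - s') \<le> (d N)\<^sup>2"
    proof -
      have "0 \<le> fact m / 2 * real N powr (2 - s')" by simp
      with N0[OF N(1)] show ?thesis by (simp add: d_def)
    qed
    have "0 < fact m / 2 * real N powr (2 - s')" using N by simp
    with var have "0 < (d N)\<^sup>2" by linarith
    moreover have "0 \<le> d N" unfolding d_def by (intro real_sqrt_ge_zero integral_nonneg_AE) auto
    ultimately have d: "0 < d N" by (simp add: less_le)
    let ?t = "\<epsilon> * d N / 2"
    have t: "0 < ?t" using d \<epsilon> by simp
    have [measurable]: "Q \<in> borel_measurable M" "V \<in> borel_measurable M" using Q V by auto
    let ?A = "{\<omega> \<in> space M. ?t\<^sup>2 \<le> Q \<omega>}" and ?B = "{\<omega> \<in> space M. ?t \<le> V \<omega>}"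
    have "E N \<epsilon> \<subseteq> ?A \<union> ?B"
    proof
      fix \<omega> assume "\<omega> \<in> E N \<epsilon>"
      then obtain n x where \<omega>: "\<omega> \<in> space M" and n: "n \<le> N"
        and "\<epsilon> < inverse (d N) * \<bar>\<Sum>j=1..n. hermite_residual m (G -` lower_orthant x) (X j \<omega>)\<bar>"
        by (auto simp: E_def)
      then have "\<epsilon> * d N < \<bar>\<Sum>j=1..n. hermite_residual m (G -` lower_orthant x) (X j \<omega>)\<bar>"
        using d by (simp add: field_simps)
      also have "\<dots> \<le> sqrt (Q \<omega>) + V \<omega>" by (rule QV[OF n])
      finally have "?t \<le> sqrt (Q \<omega>) \<or> ?t \<le> V \<omega>" by linarith
      moreover have "?t\<^sup>2 \<le> Q \<omega>" if "?t \<le> sqrt (Q \<omega>)"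
        using power_mono[OF that, of 2] t Q(2)[of \<omega>] by simp
      ultimately show "\<omega> \<in> ?A \<union> ?B" using \<omega> by auto
    qed
    then have "prob (E N \<epsilon>) \<le> prob (?A \<union> ?B)"
      \<comment> \<open>\<open>E N \<epsilon>\<close> involves an uncountable union; if it is not measurable, its \<open>prob\<close> is 0\<close>
      by (cases "E N \<epsilon> \<in> sets M") (auto intro: finite_measure_mono simp: measure_notin_sets)
    also have "\<dots> \<le> prob ?A + prob ?B" by (rule measure_Un_le) measurable
    also have "prob ?A \<le> expectation Q / ?t\<^sup>2"
      using Q t by (intro integral_Markov_inequality_measure[where A = "{}"]) auto
    also have "prob ?B \<le> expectation V / ?t"
      using V t by (intro integral_Markov_inequality_measure[where A = "{}"]) auto
    also have "expectation Q / ?t\<^sup>2 \<le> C1 * real N powr (- \<kappa>) * (1 / \<epsilon>\<^sup>2)"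
    proof -
      have "(real (K N) ^ (1 + CARD('p)))\<^sup>2 = real (K N) ^ e"
        unfolding e_def power_mult[symmetric] by (simp only: mult.commute)
      also have "\<dots> \<le> (B * real N powr a) ^ e"
        using K_small[OF N(2)] by (intro power_mono) auto
      also have "\<dots> = B ^ e * real N powr \<kappa>"
      proof -
        have "(real N powr a) ^ e = real N powr (a * real e)"
          using N1 by (simp add: powr_powr[symmetric] powr_realpow)
        moreover have "a * real e = \<kappa>" by (simp add: a_def e_def)
        ultimately show ?thesis by (simp only: power_mult_distrib)
      qed
      finally have "(real (K N) ^ (1 + CARD('p)))\<^sup>2 \<le> B ^ e * real N powr \<kappa>" .
      then have "expectation Q \<le> (B ^ e * real N powr \<kappa>) * (2 ^ Suc m * (C * real N powr (1 - s)) * real N)"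
        using C by (intro order_trans[OF EQ] mult_right_mono) auto
      also have "\<dots> = B ^ e * (2 ^ Suc m * C) * (real N powr \<kappa> * real N powr (1 - s) * real N powr 1)"
        using N1 by simp
      \<comment> \<open>Equality of exponents: \<kappa> + 2 - s = - \<kappa> + 2 - s', because 2
        \<kappa> = s - s'.\<close>
      also have "real N powr \<kappa> * real N powr (1 - s) * real N powr 1 = real N powr (- \<kappa>) * real N powr (2 - s')"
        unfolding powr_add[symmetric] by (simp add: \<kappa>_def field_simps)
      also have "B ^ e * (2 ^ Suc m * C) * (real N powr (- \<kappa>) * real N powr (2 - s')) =
          C1 / 4 * real N powr (- \<kappa>) * (fact m / 2 * real N powr (2 - s'))"
        by (simp add: C1_def)
      also have "\<dots> \<le> C1 / 4 * real N powr (- \<kappa>) * (d N)\<^sup>2"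
        using C12 by (intro mult_left_mono var) auto
      also have "\<dots> = C1 * real N powr (- \<kappa>) * (1 / \<epsilon>\<^sup>2) * ?t\<^sup>2"
        using \<epsilon> by (simp add: power2_eq_square)
      finally show ?thesis using zero_less_power[OF t, of 2] by (simp only: pos_divide_le_eq)
    qed
    also have "expectation V / ?t \<le> C2 * real N powr (- \<kappa>) * (1 / \<epsilon>)"
    proof -
      have "real N * (p / real N ^ 4) \<le> p * (1 / real N)"
      proof -
        have "real N * (p / real N ^ 4) = p * (1 / real N) * (1 / real N ^ 2)"
          using N1 by (simp add: power2_eq_square power4_eq_xxxx)
        also have "\<dots> \<le> p * (1 / real N) * 1"
          using N1 p by (intro mult_left_mono) auto
        finally show ?thesis by simp
      qed
      \<comment> \<open>The dominant part of V: the square root of N^(-4) against N summands leaves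
        1 / N, at most N^(-\<kappa>) since \<kappa> \<le> 1.\<close>
      moreover have "real N * (sqrt (p / real N ^ 4) * H) = sqrt p * H * (1 / real N)"
      proof -
        have "sqrt (real N ^ 4) = real N ^ 2"
          using real_sqrt_abs[of "real N ^ 2"] by (simp add: power_mult[symmetric])
        then show ?thesis using N1 by (simp add: real_sqrt_divide power2_eq_square)
      qed
      ultimately have "expectation V \<le> (p + sqrt p * H) * (1 / real N)"
        unfolding EV distrib_left by (simp add: distrib_right add_divide_distrib)
      also have "\<dots> \<le> (p + sqrt p * H) * real N powr (- \<kappa>)"
      proof (rule mult_left_mono)
        have "real N powr (- 1) \<le> real N powr (- \<kappa>)" using N1 \<kappa> by (intro powr_mono) auto
        then show "1 / real N \<le> real N powr (- \<kappa>)" using N1 by (simp add: powr_minus_divide)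
      qed (use p H in simp)
      also have "\<dots> = C2 / 2 * real N powr (- \<kappa>) * sqrt (fact m / 2)"
        by (simp add: C2_def)
      also have "\<dots> \<le> C2 / 2 * real N powr (- \<kappa>) * d N"
      proof (intro mult_left_mono)
        have "1 \<le> real N powr (2 - s')" using N1 s by (intro ge_one_powr_ge_zero) auto
        then have "fact m / 2 * 1 \<le> fact m / 2 * real N powr (2 - s')" by (intro mult_left_mono) auto
        with var have "fact m / 2 \<le> (d N)\<^sup>2" by linarith
        then show "sqrt (fact m / 2) \<le> d N" using d by (intro real_le_lsqrt) auto
      qed (use C12 in auto)
      also have "\<dots> = C2 * real N powr (- \<kappa>) * (1 / \<epsilon>) * ?t" using \<epsilon> by simp
      finally show ?thesis using t by (simp only: pos_divide_le_eq)
    qed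
    also have "C1 * real N powr (- \<kappa>) * (1 / \<epsilon>\<^sup>2) + C2 * real N powr (- \<kappa>) * (1 / \<epsilon>) \<le>
        C1 * real N powr (- \<kappa>) * (1 + \<epsilon> powi (-3)) + C2 * real N powr (- \<kappa>) * (1 + \<epsilon> powi (-3))"
    proof -
      have i: "1 \<le> inverse \<epsilon>" using \<epsilon> by (simp add: one_le_inverse_iff)
      have e3: "\<epsilon> powi (-3) = inverse \<epsilon> ^ 3" by (simp add: power_int_def power_inverse)
      have "inverse \<epsilon> ^ 2 \<le> inverse \<epsilon> ^ 3" "inverse \<epsilon> ^ 1 \<le> inverse \<epsilon> ^ 3"
        using i by (intro power_increasing; simp)+
      then have "1 / \<epsilon>\<^sup>2 \<le> 1 + \<epsilon> powi (-3)" "1 / \<epsilon> \<le> 1 + \<epsilon> powi (-3)"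
        unfolding e3 by (simp_all add: power_inverse divide_inverse)
      then show ?thesis using C12 by (intro add_mono mult_left_mono) auto
    qed
    also have "\<dots> = (C1 + C2) * real N powr (- \<kappa>) * (1 + \<epsilon> powi (-3))"
      by (simp add: algebra_simps)
    finally show ?thesis by simp
  qed
  \<comment> \<open>For N < N0 the trivial bound 1 = N^\<kappa> N^(-\<kappa>) is covered by the last
    summand; the successor keeps this summand positive even for N0 = 0.\<close>
  define C3 where "C3 = C1 + C2 + real (Suc N0) powr \<kappa>"
  have "prob (E N \<epsilon>) \<le> C3 * real N powr (- \<kappa>) * (1 + \<epsilon> powi (-3))"
    if N: "1 \<le> N" and \<epsilon>: "0 < \<epsilon>" "\<epsilon> \<le> 1" for N \<epsilon>
  proof (cases "N0 \<le> N")
    case True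
    have "(C1 + C2) * real N powr (- \<kappa>) * (1 + \<epsilon> powi (-3)) \<le> C3 * real N powr (- \<kappa>) * (1 + \<epsilon> powi (-3))"
      using \<epsilon> by (intro mult_right_mono) (auto simp: C3_def)
    with main[OF True N \<epsilon>] show ?thesis by linarith
  next
    case False
    have "prob (E N \<epsilon>) \<le> 1" by simp
    also have "1 = real N powr \<kappa> * real N powr (- \<kappa>)" using N by (simp flip: powr_add)
    also have "\<dots> \<le> C3 * real N powr (- \<kappa>)"
    proof (rule mult_right_mono)
      have "real N powr \<kappa> \<le> real (Suc N0) powr \<kappa>" using False \<kappa> by (intro powr_mono2) auto
      then show "real N powr \<kappa> \<le> C3" using C12 by (simp add: C3_def)
    qed simp
    also have "\<dots> = C3 * real N powr (- \<kappa>) * 1" by simp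
    also have "\<dots> \<le> C3 * real N powr (- \<kappa>) * (1 + \<epsilon> powi (-3))"
      using C12 \<epsilon> by (intro mult_left_mono) (auto simp: C3_def)
    finally show ?thesis .
  qed
  moreover have "0 < C3" using C12 by (simp add: C3_def add_nonneg_pos)
  ultimately show ?thesis using \<kappa>(1) unfolding E_def by blast
qed

end

section \<open>From the stationary process and the Hermite rank to the working hypotheses\<close>

lemma (in prob_space) stationary_expectation:
  fixes u :: "(nat \<Rightarrow> real) \<Rightarrow> real"
  assumes stat: "stationary_process M X" and X: "\<And>j. 1 \<le> j \<Longrightarrow> X j \<in> borel_measurable M"
    and [measurable]: "u \<in> borel_measurable (Pi\<^sub>M {1..} (\<lambda>_. borel))"
  shows "expectation (\<lambda>\<omega>. u (\<lambda>j\<in>{1..}. X (j + h) \<omega>)) = expectation (\<lambda>\<omega>. u (\<lambda>j\<in>{1..}. X j \<omega>))"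
proof -
  let ?P = "Pi\<^sub>M {1..} (\<lambda>_. borel) :: (nat \<Rightarrow> real) measure"
  have shift: "(\<lambda>\<omega>. \<lambda>j\<in>{1..}. X (j + h) \<omega>) \<in> M \<rightarrow>\<^sub>M ?P" for h
    by (intro measurable_restrict X) auto
  have "expectation (\<lambda>\<omega>. u (\<lambda>j\<in>{1..}. X (j + h) \<omega>)) = (\<integral>f. u f \<partial>distr M ?P (\<lambda>\<omega>. \<lambda>j\<in>{1..}. X (j + h) \<omega>))"
    by (rule integral_distr[OF shift assms(3), symmetric])
  also have "\<dots> = (\<integral>f. u f \<partial>distr M ?P (\<lambda>\<omega>. \<lambda>j\<in>{1..}. X j \<omega>))"
    using stat unfolding stationary_process_def by simp
  also have "\<dots> = expectation (\<lambda>\<omega>. u (\<lambda>j\<in>{1..}. X j \<omega>))"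
    by (rule integral_distr[OF _ assms(3)]) (use shift[of 0] in simp)
  finally show ?thesis .
qed

text \<open>Only moments that involve \<open>X 1\<close> are prescribed; a shift by i - 1 moves any
  pair of indices, the smaller being i, to one that starts at 1.\<close>

lemma (in prob_space) stationary_gaussianI:
  assumes gauss: "gaussian_process M X" and stat: "stationary_process M X"
    and mean: "expectation (X 1) = 0" and var: "expectation (\<lambda>\<omega>. (X 1 \<omega>)\<^sup>2) = 1"
  shows "stationary_gaussian M X (\<lambda>k. expectation (\<lambda>\<omega>. X 1 \<omega> * X (k + 1) \<omega>))"
proof
  have "normal_rv M (X j)" if "1 \<le> j" for j
    using gauss[unfolded gaussian_process_def, rule_format, of "{j}" "\<lambda>_. 1"] that by simp
  then have X: "X j \<in> borel_measurable M" if "1 \<le> j" for j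
    using that by (simp add: normal_rv_def)
  note shift = stationary_expectation[OF stat X]
  show "expectation (X j) = 0" if "1 \<le> j" for j
    using shift[of "\<lambda>f. f 1" "j - 1"] mean that by simp
  have cov: "expectation (\<lambda>\<omega>. X i \<omega> * X j \<omega>) = expectation (\<lambda>\<omega>. X 1 \<omega> * X (j - i + 1) \<omega>)"
    if "1 \<le> i" "i \<le> j" for i j
    using shift[of "\<lambda>f. f 1 * f (j - i + 1)" "i - 1"] that by simp
  show "expectation (\<lambda>\<omega>. X i \<omega> * X j \<omega>) = expectation (\<lambda>\<omega>. X 1 \<omega> * X (lag i j + 1) \<omega>)"
    if ij: "1 \<le> i" "1 \<le> j" for i j
  proof (cases "i \<le> j")
    case True
    then have "j - i = lag i j" by simp
    then show ?thesis using cov[OF ij(1) True] by (simp only:)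
  next
    case False
    then have "i - j = lag i j" "j \<le> i" by simp_all
    then show ?thesis using cov[OF ij(2), of i] by (simp only: mult.commute[of "X i _"])
  qed
  show "expectation (\<lambda>\<omega>. X 1 \<omega> * X (0 + 1) \<omega>) = 1"
    using var by (simp add: power2_eq_square)
qed fact

context stationary_gaussian
begin

lemma dist_fun_eq:
  fixes G :: "real \<Rightarrow> real ^ 'p"
  assumes [measurable]: "G \<in> borel_measurable borel"
  shows "dist_fun M (G \<circ> X 1) x = measure std_normal_distribution (G -` lower_orthant x)"
proof -
  have "measure std_normal_distribution (G -` lower_orthant x) =
      prob (X 1 -` (G -` lower_orthant x) \<inter> space M)"
    unfolding law_X[OF order_refl, symmetric]
    using measurable_sets[OF assms lower_orthant_measurable[of x]] by (intro measure_distr) auto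
  then show ?thesis by (simp add: dist_fun_def vimage_def Int_def conj_commute)
qed

text \<open>Centring by F(x) matters at order 0 alone, where it cancels the mean of the indicator;
  for q \<ge> 1 the polynomial itself has mean 0.\<close>

lemma hermite_coeff_eq:
  fixes G :: "real \<Rightarrow> real ^ 'p"
  assumes [measurable]: "G \<in> borel_measurable borel"
  shows "hermite_coeff M G (X 1) q x = (if q = 0 then 0
    else \<integral>y. indicator (G -` lower_orthant x) y * hermite q y \<partial>std_normal_distribution)"
proof -
  let ?B = "G -` lower_orthant x"
  have [measurable]: "?B \<in> sets borel"
    using measurable_sets[OF assms lower_orthant_measurable[of x]] by simp
  have int: "integrable std_normal_distribution
      (\<lambda>y. indicator ?B y * hermite q y - measure std_normal_distribution ?B * hermite q y)"
    by simp
  have "hermite_coeff M G (X 1) q x = expectation (\<lambda>\<omega>. indicator ?B (X 1 \<omega>) * hermite q (X 1 \<omega>)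
      - measure std_normal_distribution ?B * hermite q (X 1 \<omega>))"
    unfolding hermite_coeff_def dist_fun_eq[OF assms] by (simp add: indicator_vimage left_diff_distrib)
  also have "\<dots> = (\<integral>y. indicator ?B y * hermite q y - measure std_normal_distribution ?B * hermite q y \<partial>std_normal_distribution)"
    by (rule expectation_fX[OF int order_refl])
  also have "\<dots> = (if q = 0 then 0 else \<integral>y. indicator ?B y * hermite q y \<partial>std_normal_distribution)"
    by (simp add: std_normal_hermite_mean)
  finally show ?thesis .
qed

text \<open>Order 0 never counts, because the centred indicator has mean 0. Below m the coefficients
  at real corners vanish by minimality, and \<open>hermite_moment_vimage_eq_0\<close> passes to all
  Borel preimages.\<close>

lemma hermite_rank_props:
  fixes G :: "real \<Rightarrow> real ^ 'p"
  assumes G: "G \<in> borel_measurable borel" and rank: "hermite_rank M G (X 1) = enat m"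
  shows "1 \<le> m"
    and "A \<in> sets borel \<Longrightarrow> 1 \<le> l \<Longrightarrow> l < m \<Longrightarrow>
      (\<integral>x. indicator (G -` A) x * hermite l x \<partial>std_normal_distribution) = 0"
proof -
  show "1 \<le> m"
  proof (rule ccontr)
    assume "\<not> 1 \<le> m"
    then have "m = 0" by simp
    then have "hermite_rank M G (X 1) < 1" unfolding rank by (simp add: enat_0)
    then obtain x :: "real ^ 'p" and q where "hermite_coeff M G (X 1) q (ereal_vec x) \<noteq> 0" "enat q < 1"
      by (auto simp: hermite_rank_def hermite_rank_at_def INF_less_iff Inf_less_iff simp del: One_nat_def)
    then show False by (simp add: hermite_coeff_eq[OF G] one_enat_def split: if_splits del: One_nat_def)
  qed
  show "(\<integral>x. indicator (G -` A) x * hermite l x \<partial>std_normal_distribution) = 0"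
    if "A \<in> sets borel" and l: "1 \<le> l" "l < m"
  proof (rule hermite_moment_vimage_eq_0[OF G l(1) _ that(1)])
    fix a :: "real ^ 'p"
    have "hermite_coeff M G (X 1) l (ereal_vec a) = 0"
    proof (rule ccontr)
      assume "hermite_coeff M G (X 1) l (ereal_vec a) \<noteq> 0"
      then have "hermite_rank M G (X 1) \<le> enat l"
        unfolding hermite_rank_def hermite_rank_at_def by (intro INF_lower2[of a] Inf_lower) auto
      then show False using rank l by simp
    qed
    moreover have "lower_orthant (ereal_vec a) = {..a}"
      by (auto simp: lower_orthant_eq ereal_vec_def less_eq_vec_def)
    ultimately show "(\<integral>x. indicator (G -` {..a}) x * hermite l x \<partial>std_normal_distribution) = 0"
      using l by (simp add: hermite_coeff_eq[OF G] del: One_nat_def)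
  qed
qed

end

theorem theorem2:
  fixes M :: "'a measure"
    and X :: "nat \<Rightarrow> 'a \<Rightarrow> real"
    and L :: "real \<Rightarrow> real"
    and D :: real
    and G :: "real \<Rightarrow> real ^ 'p"
    and m :: nat
    and F :: "ereal ^ 'p \<Rightarrow> real"
    and J :: "nat \<Rightarrow> ereal ^ 'p \<Rightarrow> real"
    and d :: "nat \<Rightarrow> real"
  assumes "prob_space M"
    and "gaussian_process M X"
    and "stationary_process M X"
    and "prob_space.expectation M (X 1) = 0"
    and "prob_space.expectation M (\<lambda>\<omega>. (X 1 \<omega>)\<^sup>2) = 1"
    and "0 < D" and "D < 1"
    and "slowly_varying L"
    and "\<And>k::nat. 1 \<le> k \<Longrightarrow>
           prob_space.expectation M (\<lambda>\<omega>. X 1 \<omega> * X (k + 1) \<omega>) = real k powr (- D) * L (real k)"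
    and "G \<in> borel_measurable borel"
    and "hermite_rank M G (X 1) = enat m"
    and "D < 1 / real m"
  defines "F \<equiv> dist_fun M (G \<circ> X 1)"
    and "J \<equiv> hermite_coeff M G (X 1)"
    and "d \<equiv> (\<lambda>N. sqrt (prob_space.variance M (\<lambda>\<omega>. \<Sum>j=1..N. hermite m (X j \<omega>))))"
  shows "\<exists>C>0. \<exists>\<kappa>>0. \<forall>N::nat\<ge>1. \<forall>\<epsilon>::real. 0 < \<epsilon> \<and> \<epsilon> \<le> 1 \<longrightarrow>
     measure M {\<omega> \<in> space M.
        (MAX n\<in>{1..N}. SUP x :: ereal ^ 'p.
           ereal (inverse (d N) * \<bar>\<Sum>j=1..n.
             indicator (lower_orthant x) (G (X j \<omega>)) - F x - J m x / fact m * hermite m (X j \<omega>)\<bar>))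
        > ereal \<epsilon>}
     \<le> C * real N powr (- \<kappa>) * (1 + \<epsilon> powi (-3))"
proof -
  interpret prob_space M by fact
  interpret stationary_gaussian M X "\<lambda>k. expectation (\<lambda>\<omega>. X 1 \<omega> * X (k + 1) \<omega>)"
    by (rule stationary_gaussianI) fact+
  note G = \<open>G \<in> borel_measurable borel\<close>
  note rank = hermite_rank_props[OF G \<open>hermite_rank M G (X 1) = enat m\<close>]
  \<comment> \<open>Here 1 \<le> m selects the branch of \<open>hermite_coeff_eq\<close> for nonzero
    order.\<close>
  have residual: "indicator (lower_orthant x) (G y) - F x - J m x / fact m * hermite m y =
      hermite_residual m (G -` lower_orthant x) y" for x y
    using rank(1) unfolding F_def J_def dist_fun_eq[OF G] hermite_coeff_eq[OF G] hermite_residual_def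
    by (simp add: indicator_vimage)
  \<comment> \<open>Exceeding \<epsilon> strictly is witnessed by a single n and x, whether or not
    the supremum is attained; N \<ge> 1 makes the set under the maximum nonempty.\<close>
  have event: "ereal \<epsilon> < (MAX n\<in>{1..N}. SUP x :: ereal ^ 'p. ereal (S n x)) \<longleftrightarrow> (\<exists>n\<in>{1..N}. \<exists>x. \<epsilon> < S n x)"
    if "1 \<le> N" for N \<epsilon> and S :: "nat \<Rightarrow> ereal ^ 'p \<Rightarrow> real"
    using that by (subst Max_gr_iff) (auto simp: less_SUP_iff)
  have "\<exists>C>0. \<exists>\<kappa>>0. \<forall>N\<ge>1. \<forall>\<epsilon>. 0 < \<epsilon> \<and> \<epsilon> \<le> 1 \<longrightarrow>
    prob {\<omega> \<in> space M. \<exists>n\<in>{1..N}. \<exists>x. \<epsilon> < inverse (d N) *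
        \<bar>\<Sum>j=1..n. hermite_residual m (G -` lower_orthant x) (X j \<omega>)\<bar>}
      \<le> C * real N powr (- \<kappa>) * (1 + \<epsilon> powi (-3))"
    unfolding d_def by (rule uniform_reduction_tail[OF G rank(1) _ assms(8,9,6,12)]) (rule rank(2))
  then show ?thesis
    unfolding residual by (simp only: event cong: conj_cong imp_cong)
qed

end
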